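(* Let $\Bbbk$ be a field. Suppose we are given the following data: (1) a group $Q$ and a class $[\pi]\in H^4(Q,\Bbbk^\times)$ with a normalized representative $\pi\in Z^4(Q,\Bbbk^\times)$; (2) a group $G$ and a surjective homomorphism $\rho:G\to Q$ with kernel $K$; (3) a normalized cochain $\omega\in C^3(G,\Bbbk^\times)$ such that $d\omega=\rho^*(\pi)$; (4) an action of $G$ on a tensor category $\mathcal{C}$. Then there exists a $\pi$-anomalous action of $Q$ on the twisted crossed product tensor category $\mathcal{C}\rtimes_\omega K$, where $K$ acts on $\mathcal{C}$ by restriction of the $G$-action and $\omega\in Z^3(K,\Bbbk^\times)$ here denotes the restriction of $\omega$ to $K$.
   Context: **Cochains.** $\Bbbk^\times$ carries the trivial action of every group, written multiplicatively. $C^n(G,\Bbbk^\times)$ is the group of normalized functions $f:G^{n}\to\Bbbk^\times$ (value $1$ if any argument is $1$), with the usual differential $$df(g_1,\dots,g_{n+1})=f(g_2,\dots,g_{n+1})\prod_{i=1}^n f(g_1,\dots,g_ig_{i+1},\dots,g_{n+1})^{(-1)^i}\, f(g_1,\dots,g_n)^{(-1)^{n+1}}.$$ $Z^n=\ker d$, $H^n$ is the cohomology, and $\rho^*(\pi)(x_1,\dots,x_n)=\pi(\rho(x_1),\dots,\rho(x_n))$. Thus $d\omega=\rho^*(\pi)$ reads $$\omega(y,z,w)\,\omega(x,yz,w)\,\omega(x,y,z)=\pi(\rho(x),\rho(y),\rho(z),\rho(w))\,\omega(xy,z,w)\,\omega(x,y,zw).$$ Since $\pi$ is normalized, $\omega|_K$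 is a normalized 3-cocycle. **Tensor categories.** A tensor category is a $\Bbbk$-linear monoidal category. All monoidal categories are strictly unital ($I\otimes a=a=a\otimes I$ with identity unitors, $I$ the unit). Associators go $\alpha_{V,W,Z}:V\otimes(W\otimes Z)\to(V\otimes W)\otimes Z$. **Group actions.** An action of $G$ on $\mathcal{C}$ is a monoidal functor from the discrete 2-group $\underline{G}$ to the 2-group of linear monoidal autoequivalences of $\mathcal{C}$ and monoidal natural isomorphisms. Explicitly, it consists of monoidal autoequivalences $(\sigma_*,\psi^\sigma)$ for $\sigma\in G$, with $\psi^\sigma_{V,W}:\sigma_*V\otimes\sigma_*W\to\sigma_*(V\otimes W)$, and monoidal natural isomorphisms $\chi_{\sigma,\tau}:\sigma_*\tau_*\to(\sigma\tau)_*$ with $$\chi_{\sigma\tau,\rho}(V)\circ\chi_{\sigma,\tau}(\rho_*V)=\chi_{\sigma,\tau\rho}(V)\circ\sigma_*(\chi_{\tau,\rho}(V)),$$ together with an isomorphism $\nu:e_*\to\mathrm{id}_{\mathcal{C}}$. Unit data are taken to be trivial. **Twisted crossed product.** For a group $K$ acting on $\mathcal{C}$ and a normalized $\omega\in Z^3(K,\Bbbk^\times)$, the category $\mathcal{C}\rtimes_\omega K$ is $\bigoplus_{k\in K}\mathcal{C}_k$ with $\mathcal{C}_k=\mathcal{C}$. An object $V$ of $\mathcal{C}_k$ is written $[V,k]$, and a morphism $f$ in $\mathcal{C}_k$ is written $[f,k]$. The tensor product is $[V,k]\cdot[W,l]=[V\otimes k_*W,kl]$ and $[f,k]\cdot[g,l]=[f\otimes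 k_*g,kl]$, with unit $[I,e]$. The associator $[V,k]\cdot([W,l]\cdot[Z,m])\to([V,k]\cdot[W,l])\cdot[Z,m]$ is $\omega(k,l,m)$ times $[a,klm]$, where $a$ is the composite $$V\otimes k_*(W\otimes l_*Z)\xrightarrow{\mathrm{id}\otimes(\psi^k_{W,l_*Z})^{-1}}V\otimes(k_*W\otimes k_*l_*Z)\xrightarrow{\mathrm{id}\otimes(\mathrm{id}\otimes\chi_{k,l}(Z))}V\otimes(k_*W\otimes(kl)_*Z)\xrightarrow{\alpha}(V\otimes k_*W)\otimes(kl)_*Z.$$ **Anomalous actions.** A $\Bbbk^\times$-linear 3-group is a monoidal 2-category in which objects and 1-morphisms are weakly invertible, and 2-morphisms form a torsor over $\Bbbk^\times$, with composition compatible with scalars. Regarded as a one-object 3-category, its objects, 1-morphisms and 2-morphisms are called 1-, 2- and 3-morphisms. * $3\text{-Gr}(Q,\pi)$ has 1-morphisms the elements of $Q$ (tensor product is multiplication), only identity 2-morphisms, and 3-morphisms $\mathrm{Hom}(\mathrm{id}_g,\mathrm{id}_g)=\Bbbk^\times$. Associators and unitors are trivial, and the pentagonator is the scalar $\pi(g,h,j,k)$. * $2\text{-Aut}_\otimes(\mathcal{D})$, for a tensor category $\mathcal{D}$, has as 1-morphisms the linear monoidal autoequivalences of $\mathcal{D}$ (tensor product is composition). The 2-morphisms $F\Rightarrow F'$ are linear pseudonatural isomorphisms $(U,\chi)$: here $U$ is an invertible object of $\mathcal{D}$, and $\chi(V):F(V)\otimes U\to U\otimes F'(V)$ are natural isomorphisms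 compatible with the monoidal structures of $F$ and $F'$ (viewing $\mathcal{D}$ as a one-object 2-category). The 3-morphisms are invertible modifications, with $\Bbbk^\times$ acting by rescaling. The composite of $(U,\chi):F\Rightarrow F'$ and $(U',\chi'):F'\Rightarrow F''$ has object $U\otimes U'$. The tensor product of $(U_{K,K'},\chi'):K\Rightarrow K'$ and $(U_{H,H'},\chi):H\Rightarrow H'$ has object $K(U_{H,H'})\otimes U_{K,K'}$ and the evident structure map $KH\Rightarrow K'H'$. The tensor product of modifications $g$ (between 2-morphisms $K\Rightarrow K'$) and $f$ (between 2-morphisms $H\Rightarrow H'$) is $K(f)\otimes g$. * A $\pi$-anomalous action of $Q$ on $\mathcal{D}$ is a (strictly unital) $\Bbbk^\times$-linear monoidal 2-functor $3\text{-Gr}(Q,\pi)\to 2\text{-Aut}_\otimes(\mathcal{D})$. That is, it consists of linear monoidal autoequivalences $F(q)$, pseudonatural isomorphisms $(U_{q,r},\chi_{q,r}):F(q)F(r)\Rightarrow F(qr)$, and invertible modifications $$\Omega_{q,r,s}:\chi_{q,rs}\circ(\mathrm{id}_{F(q)}\otimes\chi_{r,s})\Rrightarrow\chi_{qr,s}\circ(\chi_{q,r}\otimes\mathrm{id}_{F(s)}),$$ strictly unital and satisfying the trihomomorphism axiom. The axiom says: for all $q,r,s,t\in Q$, the two pasted modifications from $\chi_{q,rst}\circ(1\otimes\chi_{r,st})\circ(1\otimes1\otimes\chi_{s,t})$ to $\chi_{qrs,t}\circ(\chi_{qr,s}\otimes1)\circ(\chi_{q,r}\otimes1\otimes1)$,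 one built from $1\otimes\Omega_{r,s,t}$, $\Omega_{q,rs,t}$, $\Omega_{q,r,s}\otimes1$ and the other from $\Omega_{q,r,st}$, $\Omega_{qr,s,t}$ and the canonical interchange, agree up to the scalar $\pi(q,r,s,t)$: $$[\Omega_{r,s,t},\Omega_{q,rs,t},\Omega_{q,r,s}]=\pi(q,r,s,t)\,[\Omega_{q,r,st},\Omega_{qr,s,t}].$$ *)

theory Defs
  imports "HOL-Algebra.Coset"
begin

section \<open>Normalized group cohomology with trivial coefficients in the units of a field\<close>

text \<open>
  The field is a type \<open>'k :: field\<close>, its unit group is the set of nonzero elements.  An \<open>n\<close>-cochain
  is a function on the lists of length \<open>n\<close> over the carrier, \<open>undefined\<close> elsewhere, so that
  cochains are equal iff they agree on all \<open>n\<close>-tuples of group elements.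
\<close>

definition tuples :: "('g, 'z) monoid_scheme \<Rightarrow> nat \<Rightarrow> 'g list set" where
  "tuples G n = {gs. set gs \<subseteq> carrier G \<and> length gs = n}"

definition cochains :: "('g, 'z) monoid_scheme \<Rightarrow> nat \<Rightarrow> ('g list \<Rightarrow> 'k::field) set" where
  "cochains G n =
     {f \<in> tuples G n \<rightarrow>\<^sub>E (UNIV - {0}). \<forall>gs \<in> tuples G n. \<one>\<^bsub>G\<^esub> \<in> set gs \<longrightarrow> f gs = 1}"

text \<open>\<open>merge G i\<close> multiplies the entries number \<open>i\<close> and \<open>i + 1\<close>, counting from 1.\<close>

definition merge :: "('g, 'z) monoid_scheme \<Rightarrow> nat \<Rightarrow> 'g list \<Rightarrow> 'g list" where
  "merge G i gs = take (i - 1) gs @ [gs ! (i - 1) \<otimes>\<^bsub>G\<^esub> gs ! i] @ drop (i + 1) gs"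

definition differential ::
    "('g, 'z) monoid_scheme \<Rightarrow> nat \<Rightarrow> ('g list \<Rightarrow> 'k::field) \<Rightarrow> 'g list \<Rightarrow> 'k" where
  "differential G n f = (\<lambda>gs \<in> tuples G (n + 1).
     f (tl gs) * (\<Prod>i = 1..n. f (merge G i gs) powi ((- 1) ^ i)) * f (butlast gs) powi ((- 1) ^ (n + 1)))"

definition cochain_group ::
    "('g, 'z) monoid_scheme \<Rightarrow> nat \<Rightarrow> ('g list \<Rightarrow> 'k::field) monoid" where
  "cochain_group G n =
     \<lparr>carrier = cochains G n,
      monoid.mult = (\<lambda>f g. \<lambda>gs \<in> tuples G n. f gs * g gs),
      one = (\<lambda>gs \<in> tuples G n. 1)\<rparr>"

definition cocycles :: "('g, 'z) monoid_scheme \<Rightarrow> nat \<Rightarrow> ('g list \<Rightarrow> 'k::field) set" where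
  "cocycles G n = {f \<in> cochains G n. differential G n f = \<one>\<^bsub>cochain_group G (n + 1)\<^esub>}"

definition coboundaries :: "('g, 'z) monoid_scheme \<Rightarrow> nat \<Rightarrow> ('g list \<Rightarrow> 'k::field) set" where
  "coboundaries G n =
     (if n = 0 then {\<one>\<^bsub>cochain_group G 0\<^esub>} else differential G (n - 1) ` cochains G (n - 1))"

definition cohomology ::
    "('g, 'z) monoid_scheme \<Rightarrow> nat \<Rightarrow> ('g list \<Rightarrow> 'k::field) set monoid" where
  "cohomology G n = (cochain_group G n \<lparr>carrier := cocycles G n\<rparr>) Mod (coboundaries G n)"

definition pullback ::
    "('g, 'z) monoid_scheme \<Rightarrow> ('g \<Rightarrow> 'q) \<Rightarrow> nat \<Rightarrow> ('q list \<Rightarrow> 'k) \<Rightarrow> 'g list \<Rightarrow> 'k" where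
  "pullback G \<rho> n \<pi> = (\<lambda>gs \<in> tuples G n. \<pi> (map \<rho> gs))"

lemma differential_eq_pullback_iff:
  assumes "group G" and \<omega>: "\<omega> \<in> cochains G 3"
  shows "differential G 3 \<omega> = pullback G \<rho> 4 \<pi> \<longleftrightarrow>
    (\<forall>x \<in> carrier G. \<forall>y \<in> carrier G. \<forall>z \<in> carrier G. \<forall>w \<in> carrier G.
       \<omega> [y, z, w] * \<omega> [x, y \<otimes>\<^bsub>G\<^esub> z, w] * \<omega> [x, y, z] =
       \<pi> [\<rho> x, \<rho> y, \<rho> z, \<rho> w] * \<omega> [x \<otimes>\<^bsub>G\<^esub> y, z, w] * \<omega> [x, y, z \<otimes>\<^bsub>G\<^esub> w])"
proof -
  interpret group G by fact
  have nz: "\<omega> [a, b, c] \<noteq> 0" if "a \<in> carrier G" "b \<in> carrier G" "c \<in> carrier G" for a b c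
    using \<omega> that by (auto simp: cochains_def tuples_def PiE_def Pi_def)
  have tuples4: "[x, y, z, w] \<in> tuples G 4"
    if "x \<in> carrier G" "y \<in> carrier G" "z \<in> carrier G" "w \<in> carrier G" for x y z w
    using that by (simp add: tuples_def)
  have pointwise: "differential G 3 \<omega> [x, y, z, w] = pullback G \<rho> 4 \<pi> [x, y, z, w] \<longleftrightarrow>
      \<omega> [y, z, w] * \<omega> [x, y \<otimes>\<^bsub>G\<^esub> z, w] * \<omega> [x, y, z] =
      \<pi> [\<rho> x, \<rho> y, \<rho> z, \<rho> w] * \<omega> [x \<otimes>\<^bsub>G\<^esub> y, z, w] * \<omega> [x, y, z \<otimes>\<^bsub>G\<^esub> w]"
    if x: "x \<in> carrier G" "y \<in> carrier G" "z \<in> carrier G" "w \<in> carrier G" for x y z w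
  proof -
    have "{1..3::nat} = {1, 2, 3}" by auto
    then have d: "differential G 3 \<omega> [x, y, z, w] =
        \<omega> [y, z, w] * (inverse (\<omega> [x \<otimes>\<^bsub>G\<^esub> y, z, w]) *
          (\<omega> [x, y \<otimes>\<^bsub>G\<^esub> z, w] * inverse (\<omega> [x, y, z \<otimes>\<^bsub>G\<^esub> w]))) * \<omega> [x, y, z]"
      using tuples4[OF x] by (simp add: differential_def merge_def power_int_minus)
    have p: "pullback G \<rho> 4 \<pi> [x, y, z, w] = \<pi> [\<rho> x, \<rho> y, \<rho> z, \<rho> w]"
      using tuples4[OF x] by (simp add: pullback_def)
    show ?thesis
      unfolding d p using nz[of "x \<otimes>\<^bsub>G\<^esub> y" z w] nz[of x y "z \<otimes>\<^bsub>G\<^esub> w"] x by (simp add: field_simps)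
  qed
  show ?thesis
  proof
    assume "differential G 3 \<omega> = pullback G \<rho> 4 \<pi>"
    then show "\<forall>x \<in> carrier G. \<forall>y \<in> carrier G. \<forall>z \<in> carrier G. \<forall>w \<in> carrier G.
       \<omega> [y, z, w] * \<omega> [x, y \<otimes>\<^bsub>G\<^esub> z, w] * \<omega> [x, y, z] =
       \<pi> [\<rho> x, \<rho> y, \<rho> z, \<rho> w] * \<omega> [x \<otimes>\<^bsub>G\<^esub> y, z, w] * \<omega> [x, y, z \<otimes>\<^bsub>G\<^esub> w]"
      by (simp flip: pointwise)
  next
    assume *: "\<forall>x \<in> carrier G. \<forall>y \<in> carrier G. \<forall>z \<in> carrier G. \<forall>w \<in> carrier G.
       \<omega> [y, z, w] * \<omega> [x, y \<otimes>\<^bsub>G\<^esub> z, w] * \<omega> [x, y, z] =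
       \<pi> [\<rho> x, \<rho> y, \<rho> z, \<rho> w] * \<omega> [x \<otimes>\<^bsub>G\<^esub> y, z, w] * \<omega> [x, y, z \<otimes>\<^bsub>G\<^esub> w]"
    show "differential G 3 \<omega> = pullback G \<rho> 4 \<pi>"
    proof (rule extensionalityI[where A = "tuples G 4"])
      show "differential G 3 \<omega> \<in> extensional (tuples G 4)"
        by (simp add: differential_def)
      show "pullback G \<rho> 4 \<pi> \<in> extensional (tuples G 4)"
        by (simp add: pullback_def)
    next
      fix gs assume "gs \<in> tuples G 4"
      then obtain x y z w where "gs = [x, y, z, w]" "x \<in> carrier G" "y \<in> carrier G"
          "z \<in> carrier G" "w \<in> carrier G"
        by (auto simp: tuples_def numeral_eq_Suc length_Suc_conv)
      with * pointwise show "differential G 3 \<omega> gs = pullback G \<rho> 4 \<pi> gs"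
        by simp
    qed
  qed
qed


section \<open>Linear and tensor categories\<close>

text \<open>
  Each arrow has a unique domain and codomain.  The fields are only meaningful on objects and arrows.
\<close>

record ('o, 'm) cat =
  Obj :: "'o set"
  Arr :: "'m set"
  Dom :: "'m \<Rightarrow> 'o"
  Cod :: "'m \<Rightarrow> 'o"
  Idn :: "'o \<Rightarrow> 'm" ("\<iota>\<index>")
  Cmp :: "'m \<Rightarrow> 'm \<Rightarrow> 'm" (infixr "\<cdot>\<index>" 60)

record ('o, 'm, 'k) lin_cat = "('o, 'm) cat" +
  Zero :: "'o \<Rightarrow> 'o \<Rightarrow> 'm"
  Add :: "'m \<Rightarrow> 'm \<Rightarrow> 'm"
  Scale :: "'k \<Rightarrow> 'm \<Rightarrow> 'm"

record ('o, 'm, 'k) tensor_cat = "('o, 'm, 'k) lin_cat" +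
  Unit :: "'o"
  TensO :: "'o \<Rightarrow> 'o \<Rightarrow> 'o" (infixl "\<boxdot>\<index>" 70)
  TensA :: "'m \<Rightarrow> 'm \<Rightarrow> 'm" (infixl "\<boxtimes>\<index>" 70)
  Assoc :: "'o \<Rightarrow> 'o \<Rightarrow> 'o \<Rightarrow> 'm" ("\<alpha>\<index>")

definition Hom :: "('o, 'm, 'z) cat_scheme \<Rightarrow> 'o \<Rightarrow> 'o \<Rightarrow> 'm set" where
  "Hom C A B = {f \<in> Arr C. Dom C f = A \<and> Cod C f = B}"

definition inverse_arrows :: "('o, 'm, 'z) cat_scheme \<Rightarrow> 'm \<Rightarrow> 'm \<Rightarrow> bool" where
  "inverse_arrows C f g \<longleftrightarrow>
     f \<in> Arr C \<and> g \<in> Hom C (Cod C f) (Dom C f) \<and>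
     Cmp C g f = Idn C (Dom C f) \<and> Cmp C f g = Idn C (Cod C f)"

definition Iso :: "('o, 'm, 'z) cat_scheme \<Rightarrow> 'o \<Rightarrow> 'o \<Rightarrow> 'm set" where
  "Iso C A B = {f \<in> Hom C A B. \<exists>g. inverse_arrows C f g}"

definition inv_arr :: "('o, 'm, 'z) cat_scheme \<Rightarrow> 'm \<Rightarrow> 'm" where
  "inv_arr C f = (THE g. inverse_arrows C f g)"

locale category =
  fixes C :: "('o, 'm, 'z) cat_scheme" (structure)
  assumes Dom_closed: "f \<in> Arr C \<Longrightarrow> Dom C f \<in> Obj C"
    and Cod_closed: "f \<in> Arr C \<Longrightarrow> Cod C f \<in> Obj C"
    and Idn_Hom: "A \<in> Obj C \<Longrightarrow> \<iota> A \<in> Hom C A A"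
    and Cmp_Hom: "\<lbrakk>f \<in> Hom C A B; g \<in> Hom C B D\<rbrakk> \<Longrightarrow> g \<cdot> f \<in> Hom C A D"
    and Cmp_Idn_right: "f \<in> Hom C A B \<Longrightarrow> f \<cdot> \<iota> A = f"
    and Cmp_Idn_left: "f \<in> Hom C A B \<Longrightarrow> \<iota> B \<cdot> f = f"
    and Cmp_assoc: "\<lbrakk>f \<in> Hom C A B; g \<in> Hom C B D; h \<in> Hom C D E\<rbrakk> \<Longrightarrow> (h \<cdot> g) \<cdot> f = h \<cdot> (g \<cdot> f)"

locale linear_category = category C
  for C :: "('o, 'm, 'k::field, 'z) lin_cat_scheme" (structure) +
  assumes Zero_Hom: "\<lbrakk>A \<in> Obj C; B \<in> Obj C\<rbrakk> \<Longrightarrow> Zero C A B \<in> Hom C A B"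
    and Add_Hom: "\<lbrakk>f \<in> Hom C A B; g \<in> Hom C A B\<rbrakk> \<Longrightarrow> Add C f g \<in> Hom C A B"
    and Scale_Hom: "f \<in> Hom C A B \<Longrightarrow> Scale C a f \<in> Hom C A B"
    and Add_assoc: "\<lbrakk>f \<in> Hom C A B; g \<in> Hom C A B; h \<in> Hom C A B\<rbrakk> \<Longrightarrow>
          Add C (Add C f g) h = Add C f (Add C g h)"
    and Add_commute: "\<lbrakk>f \<in> Hom C A B; g \<in> Hom C A B\<rbrakk> \<Longrightarrow> Add C f g = Add C g f"
    and Add_Zero: "f \<in> Hom C A B \<Longrightarrow> Add C f (Zero C A B) = f"
    and Add_inverse: "f \<in> Hom C A B \<Longrightarrow> \<exists>g \<in> Hom C A B. Add C f g = Zero C A B"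
    and Scale_one: "f \<in> Hom C A B \<Longrightarrow> Scale C 1 f = f"
    and Scale_Scale: "f \<in> Hom C A B \<Longrightarrow> Scale C a (Scale C b f) = Scale C (a * b) f"
    and Scale_add_left: "f \<in> Hom C A B \<Longrightarrow> Scale C (a + b) f = Add C (Scale C a f) (Scale C b f)"
    and Scale_add_right: "\<lbrakk>f \<in> Hom C A B; g \<in> Hom C A B\<rbrakk> \<Longrightarrow>
          Scale C a (Add C f g) = Add C (Scale C a f) (Scale C a g)"
    and Cmp_Add_right: "\<lbrakk>f \<in> Hom C A B; f' \<in> Hom C A B; g \<in> Hom C B D\<rbrakk> \<Longrightarrow>
          g \<cdot> Add C f f' = Add C (g \<cdot> f) (g \<cdot> f')"
    and Cmp_Add_left: "\<lbrakk>f \<in> Hom C A B; g \<in> Hom C B D; g' \<in> Hom C B D\<rbrakk> \<Longrightarrow>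
          Add C g g' \<cdot> f = Add C (g \<cdot> f) (g' \<cdot> f)"
    and Cmp_Scale_right: "\<lbrakk>f \<in> Hom C A B; g \<in> Hom C B D\<rbrakk> \<Longrightarrow> g \<cdot> Scale C a f = Scale C a (g \<cdot> f)"
    and Cmp_Scale_left: "\<lbrakk>f \<in> Hom C A B; g \<in> Hom C B D\<rbrakk> \<Longrightarrow> Scale C a g \<cdot> f = Scale C a (g \<cdot> f)"

text \<open>
  A tensor category is a \<open>'k\<close>-linear monoidal category, strictly unital.  Neither additivity nor
  rigidity is required.  Naturality of the (identity) unitors is \<open>Unit_arr_left\<close> and
  \<open>Unit_arr_right\<close>; \<open>triangle\<close> is the triangle axiom with identity unitors.
\<close>

locale tensor_category = linear_category C
  for C :: "('o, 'm, 'k::field, 'z) tensor_cat_scheme" (structure) +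
  assumes Unit_Obj: "Unit C \<in> Obj C"
    and TensO_Obj: "\<lbrakk>V \<in> Obj C; W \<in> Obj C\<rbrakk> \<Longrightarrow> V \<boxdot> W \<in> Obj C"
    and TensA_Hom: "\<lbrakk>f \<in> Hom C V V'; g \<in> Hom C W W'\<rbrakk> \<Longrightarrow> f \<boxtimes> g \<in> Hom C (V \<boxdot> W) (V' \<boxdot> W')"
    and TensA_Idn: "\<lbrakk>V \<in> Obj C; W \<in> Obj C\<rbrakk> \<Longrightarrow> \<iota> V \<boxtimes> \<iota> W = \<iota> (V \<boxdot> W)"
    and TensA_Cmp: "\<lbrakk>f \<in> Hom C V V'; f' \<in> Hom C V' V''; g \<in> Hom C W W'; g' \<in> Hom C W' W''\<rbrakk> \<Longrightarrow>
          (f' \<cdot> f) \<boxtimes> (g' \<cdot> g) = (f' \<boxtimes> g') \<cdot> (f \<boxtimes> g)"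
    and TensA_Add_left: "\<lbrakk>f \<in> Hom C V V'; f' \<in> Hom C V V'; g \<in> Hom C W W'\<rbrakk> \<Longrightarrow>
          Add C f f' \<boxtimes> g = Add C (f \<boxtimes> g) (f' \<boxtimes> g)"
    and TensA_Add_right: "\<lbrakk>f \<in> Hom C V V'; g \<in> Hom C W W'; g' \<in> Hom C W W'\<rbrakk> \<Longrightarrow>
          f \<boxtimes> Add C g g' = Add C (f \<boxtimes> g) (f \<boxtimes> g')"
    and TensA_Scale_left: "\<lbrakk>f \<in> Hom C V V'; g \<in> Hom C W W'\<rbrakk> \<Longrightarrow>
          Scale C a f \<boxtimes> g = Scale C a (f \<boxtimes> g)"
    and TensA_Scale_right: "\<lbrakk>f \<in> Hom C V V'; g \<in> Hom C W W'\<rbrakk> \<Longrightarrow>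
          f \<boxtimes> Scale C a g = Scale C a (f \<boxtimes> g)"
    and Unit_left: "V \<in> Obj C \<Longrightarrow> Unit C \<boxdot> V = V"
    and Unit_right: "V \<in> Obj C \<Longrightarrow> V \<boxdot> Unit C = V"
    and Unit_arr_left: "f \<in> Arr C \<Longrightarrow> \<iota> (Unit C) \<boxtimes> f = f"
    and Unit_arr_right: "f \<in> Arr C \<Longrightarrow> f \<boxtimes> \<iota> (Unit C) = f"
    and Assoc_Iso: "\<lbrakk>V \<in> Obj C; W \<in> Obj C; Z \<in> Obj C\<rbrakk> \<Longrightarrow>
          \<alpha> V W Z \<in> Iso C (V \<boxdot> (W \<boxdot> Z)) ((V \<boxdot> W) \<boxdot> Z)"
    and Assoc_natural: "\<lbrakk>f \<in> Hom C V V'; g \<in> Hom C W W'; h \<in> Hom C Z Z'\<rbrakk> \<Longrightarrow>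
          \<alpha> V' W' Z' \<cdot> (f \<boxtimes> (g \<boxtimes> h)) = ((f \<boxtimes> g) \<boxtimes> h) \<cdot> \<alpha> V W Z"
    and pentagon: "\<lbrakk>V \<in> Obj C; W \<in> Obj C; Y \<in> Obj C; Z \<in> Obj C\<rbrakk> \<Longrightarrow>
          (\<alpha> V W Y \<boxtimes> \<iota> Z) \<cdot> \<alpha> V (W \<boxdot> Y) Z \<cdot> (\<iota> V \<boxtimes> \<alpha> W Y Z) =
          \<alpha> (V \<boxdot> W) Y Z \<cdot> \<alpha> V W (Y \<boxdot> Z)"
    and triangle: "\<lbrakk>V \<in> Obj C; W \<in> Obj C\<rbrakk> \<Longrightarrow> \<alpha> V (Unit C) W = \<iota> (V \<boxdot> W)"

definition invertible_object :: "('o, 'm, 'k, 'z) tensor_cat_scheme \<Rightarrow> 'o \<Rightarrow> bool" where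
  "invertible_object C U \<longleftrightarrow>
     U \<in> Obj C \<and>
     (\<exists>U' \<in> Obj C. Iso C (TensO C U U') (Unit C) \<noteq> {} \<and> Iso C (TensO C U' U) (Unit C) \<noteq> {})"


section \<open>Monoidal autoequivalences\<close>

text \<open>All functors below are endofunctors.\<close>

record ('o, 'm) endofun =
  FO :: "'o \<Rightarrow> 'o"
  FA :: "'m \<Rightarrow> 'm"

record ('o, 'm) mon_endofun = "('o, 'm) endofun" +
  Psi :: "'o \<Rightarrow> 'o \<Rightarrow> 'm"

definition is_functor :: "('o, 'm, 'z) cat_scheme \<Rightarrow> ('o, 'm, 'y) endofun_scheme \<Rightarrow> bool" where
  "is_functor C F \<longleftrightarrow>
     (\<forall>A \<in> Obj C. FO F A \<in> Obj C) \<and>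
     (\<forall>A B. \<forall>f \<in> Hom C A B. FA F f \<in> Hom C (FO F A) (FO F B)) \<and>
     (\<forall>A \<in> Obj C. FA F (Idn C A) = Idn C (FO F A)) \<and>
     (\<forall>A B D. \<forall>f \<in> Hom C A B. \<forall>g \<in> Hom C B D. FA F (Cmp C g f) = Cmp C (FA F g) (FA F f))"

definition is_linear :: "('o, 'm, 'k, 'z) lin_cat_scheme \<Rightarrow> ('o, 'm, 'y) endofun_scheme \<Rightarrow> bool" where
  "is_linear C F \<longleftrightarrow>
     (\<forall>A B. \<forall>f \<in> Hom C A B. \<forall>g \<in> Hom C A B. FA F (Add C f g) = Add C (FA F f) (FA F g)) \<and>
     (\<forall>a. \<forall>f \<in> Arr C. FA F (Scale C a f) = Scale C a (FA F f))"

definition nat_iso ::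
    "('o, 'm, 'z) cat_scheme \<Rightarrow> ('o, 'm, 'x) endofun_scheme \<Rightarrow> ('o, 'm, 'y) endofun_scheme \<Rightarrow>
     ('o \<Rightarrow> 'm) \<Rightarrow> bool" where
  "nat_iso C F F' \<eta> \<longleftrightarrow>
     (\<forall>A \<in> Obj C. \<eta> A \<in> Iso C (FO F A) (FO F' A)) \<and>
     (\<forall>A B. \<forall>f \<in> Hom C A B. Cmp C (\<eta> B) (FA F f) = Cmp C (FA F' f) (\<eta> A))"

definition id_fun :: "('o, 'm) endofun" where
  "id_fun = \<lparr>FO = (\<lambda>A. A), FA = (\<lambda>f. f)\<rparr>"

definition comp_fun ::
    "('o, 'm, 'x) endofun_scheme \<Rightarrow> ('o, 'm, 'y) endofun_scheme \<Rightarrow> ('o, 'm) endofun" where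
  "comp_fun F H = \<lparr>FO = (\<lambda>A. FO F (FO H A)), FA = (\<lambda>f. FA F (FA H f))\<rparr>"

definition is_equivalence :: "('o, 'm, 'z) cat_scheme \<Rightarrow> ('o, 'm, 'y) endofun_scheme \<Rightarrow> bool" where
  "is_equivalence C F \<longleftrightarrow>
     (\<exists>H :: ('o, 'm) endofun. is_functor C H \<and>
        (\<exists>\<eta>. nat_iso C (comp_fun F H) id_fun \<eta>) \<and> (\<exists>\<epsilon>. nat_iso C (comp_fun H F) id_fun \<epsilon>))"

text \<open>
  Linear monoidal autoequivalences with trivial unit data: the unit is preserved strictly, with
  identity unit constraint.
\<close>

definition mon_autoequiv ::
    "('o, 'm, 'k, 'z) tensor_cat_scheme \<Rightarrow> ('o, 'm) mon_endofun \<Rightarrow> bool" where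
  "mon_autoequiv C F \<longleftrightarrow>
     is_functor C F \<and> is_linear C F \<and> is_equivalence C F \<and>
     FO F (Unit C) = Unit C \<and>
     (\<forall>V \<in> Obj C. \<forall>W \<in> Obj C.
        Psi F V W \<in> Iso C (TensO C (FO F V) (FO F W)) (FO F (TensO C V W))) \<and>
     (\<forall>V V' W W'. \<forall>f \<in> Hom C V V'. \<forall>g \<in> Hom C W W'.
        Cmp C (Psi F V' W') (TensA C (FA F f) (FA F g)) = Cmp C (FA F (TensA C f g)) (Psi F V W)) \<and>
     (\<forall>V \<in> Obj C. \<forall>W \<in> Obj C. \<forall>Z \<in> Obj C.
        FA F (Assoc C V W Z) \<cdot>\<^bsub>C\<^esub> Psi F V (TensO C W Z) \<cdot>\<^bsub>C\<^esub> (Idn C (FO F V) \<boxtimes>\<^bsub>C\<^esub> Psi F W Z) =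
        Psi F (TensO C V W) Z \<cdot>\<^bsub>C\<^esub> (Psi F V W \<boxtimes>\<^bsub>C\<^esub> Idn C (FO F Z)) \<cdot>\<^bsub>C\<^esub>
          Assoc C (FO F V) (FO F W) (FO F Z)) \<and>
     (\<forall>V \<in> Obj C. Psi F V (Unit C) = Idn C (FO F V) \<and> Psi F (Unit C) V = Idn C (FO F V))"

definition id_mon :: "('o, 'm, 'k, 'z) tensor_cat_scheme \<Rightarrow> ('o, 'm) mon_endofun" where
  "id_mon C = \<lparr>FO = (\<lambda>A. A), FA = (\<lambda>f. f), Psi = (\<lambda>V W. Idn C (TensO C V W))\<rparr>"

definition comp_mon ::
    "('o, 'm, 'k, 'z) tensor_cat_scheme \<Rightarrow> ('o, 'm) mon_endofun \<Rightarrow> ('o, 'm) mon_endofun \<Rightarrow>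
     ('o, 'm) mon_endofun" where
  "comp_mon C F H =
     \<lparr>FO = (\<lambda>A. FO F (FO H A)), FA = (\<lambda>f. FA F (FA H f)),
      Psi = (\<lambda>V W. Cmp C (FA F (Psi H V W)) (Psi F (FO H V) (FO H W)))\<rparr>"

text \<open>Equality of monoidal functors: the values outside of \<open>Obj C\<close> and \<open>Arr C\<close> are irrelevant.\<close>

definition eq_mon ::
    "('o, 'm, 'k, 'z) tensor_cat_scheme \<Rightarrow> ('o, 'm) mon_endofun \<Rightarrow> ('o, 'm) mon_endofun \<Rightarrow> bool" where
  "eq_mon C F F' \<longleftrightarrow>
     (\<forall>A \<in> Obj C. FO F A = FO F' A) \<and> (\<forall>f \<in> Arr C. FA F f = FA F' f) \<and>
     (\<forall>V \<in> Obj C. \<forall>W \<in> Obj C. Psi F V W = Psi F' V W)"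

definition mon_nat_iso ::
    "('o, 'm, 'k, 'z) tensor_cat_scheme \<Rightarrow> ('o, 'm) mon_endofun \<Rightarrow> ('o, 'm) mon_endofun \<Rightarrow>
     ('o \<Rightarrow> 'm) \<Rightarrow> bool" where
  "mon_nat_iso C F F' \<eta> \<longleftrightarrow>
     nat_iso C F F' \<eta> \<and>
     (\<forall>V \<in> Obj C. \<forall>W \<in> Obj C.
        Cmp C (\<eta> (TensO C V W)) (Psi F V W) = Cmp C (Psi F' V W) (TensA C (\<eta> V) (\<eta> W))) \<and>
     \<eta> (Unit C) = Idn C (Unit C)"


section \<open>Group actions and the twisted crossed product\<close>

text \<open>
  \<open>act \<sigma>\<close> is the monoidal autoequivalence \<open>\<sigma>\<^sub>*\<close> with its \<open>\<psi>\<^sup>\<sigma>\<close>.  Trivial unit data: \<open>e\<^sub>*\<close> is the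
  identity, with \<open>\<nu>\<close> the identity transformation; the unit coherence then forces
  \<open>\<chi>\<close> to be the identity as soon as one index is \<open>e\<close>.
\<close>

locale categorical_action =
  fixes G :: "('g, 'x) monoid_scheme"
    and C :: "('o, 'm, 'k::field, 'z) tensor_cat_scheme"
    and act :: "'g \<Rightarrow> ('o, 'm) mon_endofun"
    and \<chi> :: "'g \<Rightarrow> 'g \<Rightarrow> 'o \<Rightarrow> 'm"
  assumes group: "group G"
    and tensor_category: "tensor_category C"
    and act_autoequiv: "\<sigma> \<in> carrier G \<Longrightarrow> mon_autoequiv C (act \<sigma>)"
    and \<chi>_mon_nat_iso: "\<lbrakk>\<sigma> \<in> carrier G; \<tau> \<in> carrier G\<rbrakk> \<Longrightarrow>
          mon_nat_iso C (comp_mon C (act \<sigma>) (act \<tau>)) (act (\<sigma> \<otimes>\<^bsub>G\<^esub> \<tau>)) (\<chi> \<sigma> \<tau>)"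
    and \<chi>_coherence: "\<lbrakk>\<sigma> \<in> carrier G; \<tau> \<in> carrier G; \<upsilon> \<in> carrier G; V \<in> Obj C\<rbrakk> \<Longrightarrow>
          \<chi> (\<sigma> \<otimes>\<^bsub>G\<^esub> \<tau>) \<upsilon> V \<cdot>\<^bsub>C\<^esub> \<chi> \<sigma> \<tau> (FO (act \<upsilon>) V) =
          \<chi> \<sigma> (\<tau> \<otimes>\<^bsub>G\<^esub> \<upsilon>) V \<cdot>\<^bsub>C\<^esub> FA (act \<sigma>) (\<chi> \<tau> \<upsilon> V)"
    and act_one: "eq_mon C (act \<one>\<^bsub>G\<^esub>) (id_mon C)"
    and \<chi>_one_left: "\<lbrakk>\<sigma> \<in> carrier G; V \<in> Obj C\<rbrakk> \<Longrightarrow> \<chi> \<one>\<^bsub>G\<^esub> \<sigma> V = Idn C (FO (act \<sigma>) V)"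
    and \<chi>_one_right: "\<lbrakk>\<sigma> \<in> carrier G; V \<in> Obj C\<rbrakk> \<Longrightarrow> \<chi> \<sigma> \<one>\<^bsub>G\<^esub> V = Idn C (FO (act \<sigma>) V)"

text \<open>
  The direct sum over \<open>k \<in> K\<close> is the coproduct of linear categories: objects are pairs \<open>(V, k)\<close>, an
  arrow \<open>(f, k, l)\<close> goes from \<open>(Dom f, k)\<close> to \<open>(Cod f, l)\<close>, and there are only zero arrows between
  different summands.  The arrow \<open>[f, k]\<close> is \<open>(f, k, k)\<close>.  By bilinearity, a tensor product with a
  zero arrow between different summands is zero, even if the target summand agrees with the source
  summand after multiplication.
\<close>

definition crossed_product ::
    "('o, 'm, 'k::field, 'z) tensor_cat_scheme \<Rightarrow> ('g, 'x) monoid_scheme \<Rightarrow>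
     ('g \<Rightarrow> ('o, 'm) mon_endofun) \<Rightarrow> ('g \<Rightarrow> 'g \<Rightarrow> 'o \<Rightarrow> 'm) \<Rightarrow> ('g list \<Rightarrow> 'k) \<Rightarrow>
     ('o \<times> 'g, 'm \<times> 'g \<times> 'g, 'k) tensor_cat" where
  "crossed_product C K act \<chi> \<omega> =
     \<lparr>Obj = Obj C \<times> carrier K,
      Arr = {(f, k, l). f \<in> Arr C \<and> k \<in> carrier K \<and> l \<in> carrier K \<and>
               (k \<noteq> l \<longrightarrow> f = Zero C (Dom C f) (Cod C f))},
      Dom = (\<lambda>(f, k, l). (Dom C f, k)),
      Cod = (\<lambda>(f, k, l). (Cod C f, l)),
      Idn = (\<lambda>(V, k). (Idn C V, k, k)),
      Cmp = (\<lambda>(g, l', m) (f, k, l). (Cmp C g f, k, m)),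
      Zero = (\<lambda>(V, k) (W, l). (Zero C V W, k, l)),
      Add = (\<lambda>(f, k, l) (g, k', l'). (Add C f g, k, l)),
      Scale = (\<lambda>a (f, k, l). (Scale C a f, k, l)),
      Unit = (Unit C, \<one>\<^bsub>K\<^esub>),
      TensO = (\<lambda>(V, k) (W, l). (TensO C V (FO (act k) W), k \<otimes>\<^bsub>K\<^esub> l)),
      TensA = (\<lambda>(f, k, k') (g, l, l').
         (if k = k' \<and> l = l' then TensA C f (FA (act k) g)
          else Zero C (TensO C (Dom C f) (FO (act k) (Dom C g)))
                      (TensO C (Cod C f) (FO (act k') (Cod C g))),
          k \<otimes>\<^bsub>K\<^esub> l, k' \<otimes>\<^bsub>K\<^esub> l')),
      Assoc = (\<lambda>(V, k) (W, l) (Z, m).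
         (Scale C (\<omega> [k, l, m])
            (Assoc C V (FO (act k) W) (FO (act (k \<otimes>\<^bsub>K\<^esub> l)) Z) \<cdot>\<^bsub>C\<^esub>
             (Idn C V \<boxtimes>\<^bsub>C\<^esub> (Idn C (FO (act k) W) \<boxtimes>\<^bsub>C\<^esub> \<chi> k l Z)) \<cdot>\<^bsub>C\<^esub>
             (Idn C V \<boxtimes>\<^bsub>C\<^esub> inv_arr C (Psi (act k) W (FO (act l) Z)))),
          k \<otimes>\<^bsub>K\<^esub> l \<otimes>\<^bsub>K\<^esub> m, k \<otimes>\<^bsub>K\<^esub> l \<otimes>\<^bsub>K\<^esub> m))\<rparr>"


section \<open>Pseudonatural isomorphisms and modifications\<close>

text \<open>
  The 1-morphisms of the 3-group of monoidal autoequivalences of \<open>D\<close> are the \<open>F\<close> with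
  \<open>mon_autoequiv D F\<close>, with tensor product \<open>comp_mon D\<close>.  A 2-morphism is a pair \<open>(U, \<chi>)\<close>, where
  \<open>\<chi> V\<close> goes from \<open>F V \<boxdot> U\<close> to \<open>U \<boxdot> F' V\<close>.
\<close>

definition pseudonat_iso ::
    "('o, 'm, 'k, 'z) tensor_cat_scheme \<Rightarrow> ('o, 'm) mon_endofun \<Rightarrow> ('o, 'm) mon_endofun \<Rightarrow>
     'o \<times> ('o \<Rightarrow> 'm) \<Rightarrow> bool" where
  "pseudonat_iso D F F' = (\<lambda>(U, \<chi>).
     invertible_object D U \<and>
     (\<forall>V \<in> Obj D. \<chi> V \<in> Iso D (TensO D (FO F V) U) (TensO D U (FO F' V))) \<and>
     (\<forall>V W. \<forall>f \<in> Hom D V W.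
        \<chi> W \<cdot>\<^bsub>D\<^esub> (FA F f \<boxtimes>\<^bsub>D\<^esub> Idn D U) = (Idn D U \<boxtimes>\<^bsub>D\<^esub> FA F' f) \<cdot>\<^bsub>D\<^esub> \<chi> V) \<and>
     (\<forall>V \<in> Obj D. \<forall>W \<in> Obj D.
        \<chi> (TensO D V W) \<cdot>\<^bsub>D\<^esub> (Psi F V W \<boxtimes>\<^bsub>D\<^esub> Idn D U) =
        (Idn D U \<boxtimes>\<^bsub>D\<^esub> Psi F' V W) \<cdot>\<^bsub>D\<^esub>
        inv_arr D (Assoc D U (FO F' V) (FO F' W)) \<cdot>\<^bsub>D\<^esub>
        (\<chi> V \<boxtimes>\<^bsub>D\<^esub> Idn D (FO F' W)) \<cdot>\<^bsub>D\<^esub>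
        Assoc D (FO F V) U (FO F' W) \<cdot>\<^bsub>D\<^esub>
        (Idn D (FO F V) \<boxtimes>\<^bsub>D\<^esub> \<chi> W) \<cdot>\<^bsub>D\<^esub>
        inv_arr D (Assoc D (FO F V) (FO F W) U)) \<and>
     \<chi> (Unit D) = Idn D U)"

definition ps_id ::
    "('o, 'm, 'k, 'z) tensor_cat_scheme \<Rightarrow> ('o, 'm) mon_endofun \<Rightarrow> 'o \<times> ('o \<Rightarrow> 'm)" where
  "ps_id D F = (Unit D, \<lambda>V. Idn D (FO F V))"

text \<open>
  \<open>ps_comp D F F' F'' X' X\<close> is the composite \<open>X' \<circ> X\<close> of \<open>X = (U, \<chi>) : F \<Rightarrow> F'\<close> and
  \<open>X' = (U', \<chi>') : F' \<Rightarrow> F''\<close>; note that its object is \<open>U \<boxdot> U'\<close>.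
\<close>

definition ps_comp ::
    "('o, 'm, 'k, 'z) tensor_cat_scheme \<Rightarrow>
     ('o, 'm) mon_endofun \<Rightarrow> ('o, 'm) mon_endofun \<Rightarrow> ('o, 'm) mon_endofun \<Rightarrow>
     'o \<times> ('o \<Rightarrow> 'm) \<Rightarrow> 'o \<times> ('o \<Rightarrow> 'm) \<Rightarrow> 'o \<times> ('o \<Rightarrow> 'm)" where
  "ps_comp D F F' F'' = (\<lambda>(U', \<chi>') (U, \<chi>).
     (TensO D U U', \<lambda>V.
        Assoc D U U' (FO F'' V) \<cdot>\<^bsub>D\<^esub>
        (Idn D U \<boxtimes>\<^bsub>D\<^esub> \<chi>' V) \<cdot>\<^bsub>D\<^esub>
        inv_arr D (Assoc D U (FO F' V) U') \<cdot>\<^bsub>D\<^esub>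
        (\<chi> V \<boxtimes>\<^bsub>D\<^esub> Idn D U') \<cdot>\<^bsub>D\<^esub>
        Assoc D (FO F V) U U'))"

text \<open>
  \<open>ps_tensor D K K' H H' X' X\<close> is the tensor product \<open>X' \<otimes> X : K H \<Rightarrow> K' H'\<close> of
  \<open>X' = (U', \<chi>') : K \<Rightarrow> K'\<close> and \<open>X = (U, \<chi>) : H \<Rightarrow> H'\<close>, with object \<open>K U \<boxdot> U'\<close>.  It is the composite
  of the whiskering of \<open>X\<close> with \<open>K\<close>, which is \<open>K \<chi>\<close> conjugated by the monoidal structure of \<open>K\<close>,
  and the whiskering of \<open>X'\<close> with \<open>H'\<close>, whose component at \<open>V\<close> is \<open>\<chi>' (H' V)\<close>.
\<close>

definition ps_tensor ::
    "('o, 'm, 'k, 'z) tensor_cat_scheme \<Rightarrow>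
     ('o, 'm) mon_endofun \<Rightarrow> ('o, 'm) mon_endofun \<Rightarrow> ('o, 'm) mon_endofun \<Rightarrow> ('o, 'm) mon_endofun \<Rightarrow>
     'o \<times> ('o \<Rightarrow> 'm) \<Rightarrow> 'o \<times> ('o \<Rightarrow> 'm) \<Rightarrow> 'o \<times> ('o \<Rightarrow> 'm)" where
  "ps_tensor D K K' H H' = (\<lambda>(U', \<chi>') (U, \<chi>).
     ps_comp D (comp_mon D K H) (comp_mon D K H') (comp_mon D K' H')
       (U', \<lambda>V. \<chi>' (FO H' V))
       (FO K U, \<lambda>V. inv_arr D (Psi K U (FO H' V)) \<cdot>\<^bsub>D\<^esub> FA K (\<chi> V) \<cdot>\<^bsub>D\<^esub> Psi K (FO H V) U))"

text \<open>Invertible modifications \<open>X \<Rrightarrow> Y\<close> between 2-morphisms \<open>F \<Rightarrow> F'\<close>.\<close>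

definition modification_iso ::
    "('o, 'm, 'k, 'z) tensor_cat_scheme \<Rightarrow> ('o, 'm) mon_endofun \<Rightarrow> ('o, 'm) mon_endofun \<Rightarrow>
     'o \<times> ('o \<Rightarrow> 'm) \<Rightarrow> 'o \<times> ('o \<Rightarrow> 'm) \<Rightarrow> 'm \<Rightarrow> bool" where
  "modification_iso D F F' X Y m \<longleftrightarrow>
     m \<in> Iso D (fst X) (fst Y) \<and>
     (\<forall>V \<in> Obj D. (m \<boxtimes>\<^bsub>D\<^esub> Idn D (FO F' V)) \<cdot>\<^bsub>D\<^esub> snd X V =
                  snd Y V \<cdot>\<^bsub>D\<^esub> (Idn D (FO F V) \<boxtimes>\<^bsub>D\<^esub> m))"

text \<open>
  Tensor product \<open>g \<otimes> f\<close> of a modification \<open>g\<close> between 2-morphisms \<open>K \<Rightarrow> K'\<close> and a modification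
  \<open>f\<close>.  The identity modification of \<open>ps_id D F\<close> is \<open>Idn D (Unit D)\<close>.
\<close>

definition mod_tensor ::
    "('o, 'm, 'k, 'z) tensor_cat_scheme \<Rightarrow> ('o, 'm) mon_endofun \<Rightarrow> 'm \<Rightarrow> 'm \<Rightarrow> 'm" where
  "mod_tensor D K g f = FA K f \<boxtimes>\<^bsub>D\<^esub> g"


section \<open>Anomalous actions\<close>

text \<open>
  The two pasted modifications of the trihomomorphism axiom.  With \<open>U q r\<close> the object of \<open>X q r\<close>, both
  are arrows from \<open>F\<^sub>q F\<^sub>r U\<^sub>s\<^sub>t \<boxdot> (F\<^sub>q U\<^sub>r\<^sub>,\<^sub>s\<^sub>t \<boxdot> U\<^sub>q\<^sub>,\<^sub>r\<^sub>s\<^sub>t)\<close> to \<open>(U\<^sub>q\<^sub>r \<boxdot> U\<^sub>q\<^sub>r\<^sub>,\<^sub>s) \<boxdot> U\<^sub>q\<^sub>r\<^sub>s\<^sub>,\<^sub>t\<close>.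
  The inserted \<open>Psi\<close> compares \<open>1 \<otimes> (Y \<circ> X)\<close> with \<open>(1 \<otimes> Y) \<circ> (1 \<otimes> X)\<close>; the inserted associators are
  those of the composition of 2-morphisms; the canonical interchange of \<open>1 \<otimes> 1 \<otimes> X s t\<close> and
  \<open>X q r \<otimes> 1 \<otimes> 1\<close> is the component of \<open>X q r\<close> at \<open>U s t\<close>.
\<close>

definition pasting3 ::
    "('q, 'x) monoid_scheme \<Rightarrow> ('o, 'm, 'k, 'z) tensor_cat_scheme \<Rightarrow>
     ('q \<Rightarrow> ('o, 'm) mon_endofun) \<Rightarrow> ('q \<Rightarrow> 'q \<Rightarrow> 'o \<times> ('o \<Rightarrow> 'm)) \<Rightarrow> ('q \<Rightarrow> 'q \<Rightarrow> 'q \<Rightarrow> 'm) \<Rightarrow>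
     'q \<Rightarrow> 'q \<Rightarrow> 'q \<Rightarrow> 'q \<Rightarrow> 'm" where
  "pasting3 Q D F X \<Omega> q r s t =
     (let U = (\<lambda>q r. fst (X q r));
          rs = r \<otimes>\<^bsub>Q\<^esub> s; st = s \<otimes>\<^bsub>Q\<^esub> t; qrs = q \<otimes>\<^bsub>Q\<^esub> r \<otimes>\<^bsub>Q\<^esub> s; rst = r \<otimes>\<^bsub>Q\<^esub> s \<otimes>\<^bsub>Q\<^esub> t;
          one_\<Omega> = mod_tensor D (F q) (Idn D (Unit D)) (\<Omega> r s t);
          \<Omega>_one = mod_tensor D (comp_mon D (F q) (comp_mon D (F r) (F s)))
                    (\<Omega> q r s) (Idn D (Unit D))
      in (\<Omega>_one \<boxtimes>\<^bsub>D\<^esub> Idn D (U qrs t)) \<cdot>\<^bsub>D\<^esub>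
         Assoc D (FO (F q) (U r s)) (U q rs) (U qrs t) \<cdot>\<^bsub>D\<^esub>
         (Idn D (FO (F q) (U r s)) \<boxtimes>\<^bsub>D\<^esub> \<Omega> q rs t) \<cdot>\<^bsub>D\<^esub>
         inv_arr D (Assoc D (FO (F q) (U r s)) (FO (F q) (U rs t)) (U q rst)) \<cdot>\<^bsub>D\<^esub>
         ((inv_arr D (Psi (F q) (U r s) (U rs t)) \<cdot>\<^bsub>D\<^esub>
           one_\<Omega> \<cdot>\<^bsub>D\<^esub>
           Psi (F q) (FO (F r) (U s t)) (U r st)) \<boxtimes>\<^bsub>D\<^esub> Idn D (U q rst)) \<cdot>\<^bsub>D\<^esub>
         Assoc D (FO (F q) (FO (F r) (U s t))) (FO (F q) (U r st)) (U q rst))"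

definition pasting2 ::
    "('q, 'x) monoid_scheme \<Rightarrow> ('o, 'm, 'k, 'z) tensor_cat_scheme \<Rightarrow>
     ('q \<Rightarrow> ('o, 'm) mon_endofun) \<Rightarrow> ('q \<Rightarrow> 'q \<Rightarrow> 'o \<times> ('o \<Rightarrow> 'm)) \<Rightarrow> ('q \<Rightarrow> 'q \<Rightarrow> 'q \<Rightarrow> 'm) \<Rightarrow>
     'q \<Rightarrow> 'q \<Rightarrow> 'q \<Rightarrow> 'q \<Rightarrow> 'm" where
  "pasting2 Q D F X \<Omega> q r s t =
     (let U = (\<lambda>q r. fst (X q r));
          qr = q \<otimes>\<^bsub>Q\<^esub> r; st = s \<otimes>\<^bsub>Q\<^esub> t; qrs = q \<otimes>\<^bsub>Q\<^esub> r \<otimes>\<^bsub>Q\<^esub> s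
      in Assoc D (U q r) (U qr s) (U qrs t) \<cdot>\<^bsub>D\<^esub>
         (Idn D (U q r) \<boxtimes>\<^bsub>D\<^esub> \<Omega> qr s t) \<cdot>\<^bsub>D\<^esub>
         inv_arr D (Assoc D (U q r) (FO (F qr) (U s t)) (U qr st)) \<cdot>\<^bsub>D\<^esub>
         (snd (X q r) (U s t) \<boxtimes>\<^bsub>D\<^esub> Idn D (U qr st)) \<cdot>\<^bsub>D\<^esub>
         Assoc D (FO (F q) (FO (F r) (U s t))) (U q r) (U qr st) \<cdot>\<^bsub>D\<^esub>
         (Idn D (FO (F q) (FO (F r) (U s t))) \<boxtimes>\<^bsub>D\<^esub> \<Omega> q r st))"

text \<open>\<open>X q r\<close> is the pair \<open>(U\<^sub>q\<^sub>,\<^sub>r, \<chi>\<^sub>q\<^sub>,\<^sub>r)\<close>.\<close>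

locale anomalous_action =
  fixes Q :: "('q, 'x) monoid_scheme" (structure)
    and \<pi> :: "'q list \<Rightarrow> 'k::field"
    and D :: "('o, 'm, 'k, 'z) tensor_cat_scheme"
    and F :: "'q \<Rightarrow> ('o, 'm) mon_endofun"
    and X :: "'q \<Rightarrow> 'q \<Rightarrow> 'o \<times> ('o \<Rightarrow> 'm)"
    and \<Omega> :: "'q \<Rightarrow> 'q \<Rightarrow> 'q \<Rightarrow> 'm"
  assumes group: "group Q"
    and cocycle: "\<pi> \<in> cocycles Q 4"
    and tensor_category: "tensor_category D"
    and F_autoequiv: "q \<in> carrier Q \<Longrightarrow> mon_autoequiv D (F q)"
    and X_pseudonat_iso: "\<lbrakk>q \<in> carrier Q; r \<in> carrier Q\<rbrakk> \<Longrightarrow>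
          pseudonat_iso D (comp_mon D (F q) (F r)) (F (q \<otimes> r)) (X q r)"
    and \<Omega>_modification: "\<lbrakk>q \<in> carrier Q; r \<in> carrier Q; s \<in> carrier Q\<rbrakk> \<Longrightarrow>
          modification_iso D (comp_mon D (F q) (comp_mon D (F r) (F s))) (F (q \<otimes> r \<otimes> s))
            (ps_comp D
               (comp_mon D (F q) (comp_mon D (F r) (F s)))
               (comp_mon D (F q) (F (r \<otimes> s)))
               (F (q \<otimes> r \<otimes> s))
               (X q (r \<otimes> s))
               (ps_tensor D (F q) (F q) (comp_mon D (F r) (F s)) (F (r \<otimes> s)) (ps_id D (F q)) (X r s)))
            (ps_comp D
               (comp_mon D (F q) (comp_mon D (F r) (F s)))
               (comp_mon D (F (q \<otimes> r)) (F s))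
               (F (q \<otimes> r \<otimes> s))
               (X (q \<otimes> r) s)
               (ps_tensor D (comp_mon D (F q) (F r)) (F (q \<otimes> r)) (F s) (F s) (X q r) (ps_id D (F s))))
            (\<Omega> q r s)"
    and F_one: "eq_mon D (F \<one>) (id_mon D)"
    and X_one: "\<lbrakk>q \<in> carrier Q; r \<in> carrier Q; q = \<one> \<or> r = \<one>\<rbrakk> \<Longrightarrow>
          fst (X q r) = Unit D \<and> (\<forall>V \<in> Obj D. snd (X q r) V = Idn D (FO (F (q \<otimes> r)) V))"
    and \<Omega>_one: "\<lbrakk>q \<in> carrier Q; r \<in> carrier Q; s \<in> carrier Q; q = \<one> \<or> r = \<one> \<or> s = \<one>\<rbrakk> \<Longrightarrow>
          \<Omega> q r s = Idn D (fst (X q r) \<boxdot>\<^bsub>D\<^esub> fst (X (q \<otimes> r) s))"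
    and trihomomorphism: "\<lbrakk>q \<in> carrier Q; r \<in> carrier Q; s \<in> carrier Q; t \<in> carrier Q\<rbrakk> \<Longrightarrow>
          pasting3 Q D F X \<Omega> q r s t = Scale D (\<pi> [q, r, s, t]) (pasting2 Q D F X \<Omega> q r s t)"

end

theory Submission
  imports Defs
begin

text \<open>
  Allow degrees in all of \<open>G\<close> instead of only in \<open>K\<close>: the objects \<open>[V, g]\<close> with the tensor product
  and the associator of the crossed product satisfy the pentagon up to the scalar \<open>\<pi>\<close> of the degrees
  in \<open>Q\<close>, because \<open>d\<omega> = \<rho>\<^sup>*\<pi>\<close>.  As \<open>\<pi>\<close> is normalized, a pentagon with one corner of degree in \<open>K\<close> is
  exact; in particular \<open>D = C \<rtimes>\<^sub>\<omega> K\<close> is a tensor category.  Choose a section \<open>s\<close> of \<open>\<rho>\<close> with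
  \<open>s 1 = 1\<close>.  The object \<open>[I, s q]\<close> is invertible, and \<open>Q\<close> acts on \<open>D\<close> by conjugation with it:
  \<open>F q [V, k] = [(s q)\<^sub>* V, s q k (s q)\<^sup>-\<^sup>1]\<close> satisfies \<open>F q A \<cdot> [I, s q] = [I, s q] \<cdot> A\<close> on the nose, and
  \<open>U q r = [I, u q r]\<close> with \<open>u q r = s q s r (s (q r))\<^sup>-\<^sup>1\<close> satisfies
  \<open>U q r \<cdot> [I, s (q r)] = [I, s q] \<cdot> [I, s r]\<close>.  The monoidal structure of \<open>F q\<close>, the structure map of
  \<open>U q r\<close> and the modifications \<open>\<Omega>\<close> are determined by these equations.  All axioms compare composites
  of canonical arrows; the pentagons that enter have a corner in \<open>K\<close>, except the one with corners
  \<open>[I, s q], [I, s r], [I, s t], [I, s v]\<close>, which enters the trihomomorphism axiom and contributes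
  \<open>\<pi>(q, r, t, v)\<close>.
\<close>

text \<open>
  Instead of chasing diagrams one at a time, the proof establishes two coherence results.  For \<open>C\<close> with
  its action of \<open>G\<close>, every formal tensor expression is flattened to a list of objects
  \<open>g\<^sub>* V\<close>; an arrow is \<open>coherent\<close> if it commutes with the flattenings.  Associators, monoidal
  structure maps and \<open>\<chi>\<close> are coherent, coherent arrows are closed under all operations, and there is at
  most one coherent arrow between two formal expressions (\<open>coherent_unique\<close>).  For \<open>D\<close>, a formal
  expression has an underlying expression in \<open>C\<close>, a degree, and a flattening scalar that collects the
  values of \<open>\<omega>\<close> needed to let its factors act, one after the other, on an element \<open>y\<close> of \<open>G\<close>.  An arrow of \<open>D\<close> is coherent at \<open>p \<in> Q\<close> (\<open>dcoh\<close>) if its underlying arrow is coherent up to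
  a scalar, and this scalar is the quotient of the flattening scalars for every \<open>y\<close> over \<open>p\<close>.
  Again such an arrow is unique (\<open>dcoh_unique\<close>).  All structure maps are coherent at every \<open>p\<close>, except
  that \<open>\<Omega> q r t\<close> is coherent at \<open>q r t\<close>, while at \<open>q r t v\<close> only its multiple by the inverse of
  \<open>\<pi>(q, r, t, v)\<close> is (\<open>dcoh_\<Omega>\<close>).  The trihomomorphism axiom is the comparison at \<open>q r t v\<close>.
\<close>

section \<open>Categories in terms of domains and codomains\<close>

context category
begin

lemma Hom_iff: "f \<in> Hom C A B \<longleftrightarrow> f \<in> Arr C \<and> Dom C f = A \<and> Cod C f = B"
  by (simp add: Hom_def)

lemma Dom_Obj [simp]: "f \<in> Arr C \<Longrightarrow> Dom C f \<in> Obj C"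
  and Cod_Obj [simp]: "f \<in> Arr C \<Longrightarrow> Cod C f \<in> Obj C"
  by (simp_all add: Dom_closed Cod_closed)

lemma Idn_simps [simp]:
  assumes "A \<in> Obj C"
  shows "\<iota> A \<in> Arr C" "Dom C (\<iota> A) = A" "Cod C (\<iota> A) = A"
  using Idn_Hom[OF assms] by (simp_all add: Hom_iff)

lemma Cmp_simps [simp]:
  assumes "f \<in> Arr C" "g \<in> Arr C" "Dom C g = Cod C f"
  shows "g \<cdot> f \<in> Arr C" "Dom C (g \<cdot> f) = Dom C f" "Cod C (g \<cdot> f) = Cod C g"
  using Cmp_Hom[of f "Dom C f" "Cod C f" g "Cod C g"] assms by (simp_all add: Hom_iff)

lemma Cmp_assoc_arr [simp]:
  assumes "f \<in> Arr C" "g \<in> Arr C" "h \<in> Arr C" "Dom C g = Cod C f" "Dom C h = Cod C g"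
  shows "(h \<cdot> g) \<cdot> f = h \<cdot> g \<cdot> f"
  using Cmp_assoc[of f "Dom C f" "Cod C f" g "Cod C g" h "Cod C h"] assms by (simp add: Hom_iff)

lemma Cmp_Idn [simp]:
  "f \<in> Arr C \<Longrightarrow> Dom C f = A \<Longrightarrow> f \<cdot> \<iota> A = f"
  "f \<in> Arr C \<Longrightarrow> Cod C f = A \<Longrightarrow> \<iota> A \<cdot> f = f"
  using Cmp_Idn_right Cmp_Idn_left by (auto simp: Hom_iff)

text \<open>
  Rewriting with an equation of composites inside a longer composite that is bracketed to the right.
\<close>

lemma reassoc:
  assumes "p \<cdot> q = r \<cdot> t"
    and "z \<in> Arr C" "q \<in> Arr C" "p \<in> Arr C" "r \<in> Arr C" "t \<in> Arr C"
    and "Dom C q = Cod C z" "Dom C p = Cod C q" "Dom C t = Cod C z" "Dom C r = Cod C t"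
  shows "p \<cdot> q \<cdot> z = r \<cdot> t \<cdot> z"
  using assms by (metis Cmp_assoc_arr)

text \<open>Arrows with a two-sided inverse; \<open>Iso\<close> additionally fixes the domain and the codomain.\<close>

definition invertible :: "'m \<Rightarrow> bool" where
  "invertible f \<longleftrightarrow> (\<exists>g. inverse_arrows C f g)"

lemma invertibleI: "inverse_arrows C f g \<Longrightarrow> invertible f"
  by (auto simp: invertible_def)

lemma Iso_iff: "f \<in> Iso C A B \<longleftrightarrow> f \<in> Arr C \<and> Dom C f = A \<and> Cod C f = B \<and> invertible f"
  by (auto simp: Iso_def Hom_iff invertible_def)

lemma inverse_arrows_sym: "inverse_arrows C f g \<Longrightarrow> inverse_arrows C g f"
  by (auto simp: inverse_arrows_def Hom_iff)

lemma inverse_arrows_unique: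
  assumes "inverse_arrows C f g" "inverse_arrows C f h"
  shows "g = h"
proof -
  have "g = g \<cdot> f \<cdot> h" using assms by (simp add: inverse_arrows_def Hom_iff)
  also have "\<dots> = (g \<cdot> f) \<cdot> h" using assms by (subst Cmp_assoc_arr) (auto simp: inverse_arrows_def Hom_iff)
  also have "\<dots> = h" using assms by (simp add: inverse_arrows_def Hom_iff)
  finally show ?thesis .
qed

lemma inv_arr_eq: "inverse_arrows C f g \<Longrightarrow> inv_arr C f = g"
  unfolding inv_arr_def using inverse_arrows_unique by blast

lemma inverse_arrows_inv_arr: "invertible f \<Longrightarrow> inverse_arrows C f (inv_arr C f)"
  using inv_arr_eq by (auto simp: invertible_def)

lemma invertible_Arr [simp]: "invertible f \<Longrightarrow> f \<in> Arr C"
  by (auto simp: invertible_def inverse_arrows_def)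

lemma inv_arr_simps [simp]:
  assumes "invertible f"
  shows "inv_arr C f \<in> Arr C" "Dom C (inv_arr C f) = Cod C f" "Cod C (inv_arr C f) = Dom C f"
    "inv_arr C f \<cdot> f = \<iota> (Dom C f)" "f \<cdot> inv_arr C f = \<iota> (Cod C f)"
    "invertible (inv_arr C f)" "inv_arr C (inv_arr C f) = f"
proof -
  have i: "inverse_arrows C f (inv_arr C f)" using assms by (rule inverse_arrows_inv_arr)
  then show "inv_arr C f \<in> Arr C" "Dom C (inv_arr C f) = Cod C f" "Cod C (inv_arr C f) = Dom C f"
    "inv_arr C f \<cdot> f = \<iota> (Dom C f)" "f \<cdot> inv_arr C f = \<iota> (Cod C f)"
    by (simp_all add: inverse_arrows_def Hom_iff)
  show "invertible (inv_arr C f)" "inv_arr C (inv_arr C f) = f"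
    using inverse_arrows_sym[OF i] inv_arr_eq by (blast intro: invertibleI)+
qed

lemma inv_arr_Cmp [simp]:
  assumes "invertible f" "z \<in> Arr C"
  shows "Cod C z = Dom C f \<Longrightarrow> inv_arr C f \<cdot> f \<cdot> z = z"
    "Cod C z = Cod C f \<Longrightarrow> f \<cdot> inv_arr C f \<cdot> z = z"
proof -
  assume z: "Cod C z = Dom C f"
  have "inv_arr C f \<cdot> f \<cdot> z = (inv_arr C f \<cdot> f) \<cdot> z"
    using assms z by (subst Cmp_assoc_arr) simp_all
  then show "inv_arr C f \<cdot> f \<cdot> z = z" using assms z by simp
next
  assume z: "Cod C z = Cod C f"
  have "f \<cdot> inv_arr C f \<cdot> z = (f \<cdot> inv_arr C f) \<cdot> z"
    using assms z by (subst Cmp_assoc_arr) simp_all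
  then show "f \<cdot> inv_arr C f \<cdot> z = z" using assms z by simp
qed

lemma invertible_Idn [simp]: "A \<in> Obj C \<Longrightarrow> invertible (\<iota> A)"
  by (rule invertibleI[of _ "\<iota> A"]) (simp add: inverse_arrows_def Hom_iff)

lemma inv_arr_Idn [simp]: "A \<in> Obj C \<Longrightarrow> inv_arr C (\<iota> A) = \<iota> A"
  by (rule inv_arr_eq) (simp add: inverse_arrows_def Hom_iff)

lemma inverse_arrows_Cmp:
  assumes "invertible f" "invertible g" "Dom C g = Cod C f"
  shows "inverse_arrows C (g \<cdot> f) (inv_arr C f \<cdot> inv_arr C g)"
  using assms by (simp add: inverse_arrows_def Hom_iff)

lemma invertible_Cmp [simp]:
  "invertible f \<Longrightarrow> invertible g \<Longrightarrow> Dom C g = Cod C f \<Longrightarrow> invertible (g \<cdot> f)"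
  using inverse_arrows_Cmp by (blast intro: invertibleI)

lemma invertible_cancel_right:
  assumes "invertible m" "f \<in> Arr C" "f' \<in> Arr C" "Dom C f = Cod C m" "Dom C f' = Cod C m"
    and "f \<cdot> m = f' \<cdot> m"
  shows "f = f'"
proof -
  have "(f \<cdot> m) \<cdot> inv_arr C m = (f' \<cdot> m) \<cdot> inv_arr C m" by (simp add: assms(6))
  then show ?thesis using assms(1-5) by simp
qed

lemma inv_arr_natural:
  assumes "m' \<cdot> f = f' \<cdot> m"
    and "invertible m" "invertible m'" "f \<in> Arr C" "f' \<in> Arr C"
    and "Dom C m' = Cod C f" "Dom C f' = Cod C m" "Dom C f = Dom C m" "Cod C f' = Cod C m'"
  shows "inv_arr C m' \<cdot> f' = f \<cdot> inv_arr C m"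
proof (rule invertible_cancel_right[of m])
  show "(inv_arr C m' \<cdot> f') \<cdot> m = (f \<cdot> inv_arr C m) \<cdot> m"
    using assms(2-) by (simp flip: assms(1))
qed (use assms(2-) in simp_all)

end

context linear_category
begin

lemma lin_simps [simp]:
  "A \<in> Obj C \<Longrightarrow> B \<in> Obj C \<Longrightarrow> Zero C A B \<in> Arr C"
  "A \<in> Obj C \<Longrightarrow> B \<in> Obj C \<Longrightarrow> Dom C (Zero C A B) = A"
  "A \<in> Obj C \<Longrightarrow> B \<in> Obj C \<Longrightarrow> Cod C (Zero C A B) = B"
  "f \<in> Arr C \<Longrightarrow> Scale C a f \<in> Arr C"
  "f \<in> Arr C \<Longrightarrow> Dom C (Scale C a f) = Dom C f"
  "f \<in> Arr C \<Longrightarrow> Cod C (Scale C a f) = Cod C f"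
  "f \<in> Arr C \<Longrightarrow> g \<in> Arr C \<Longrightarrow> Dom C f = Dom C g \<Longrightarrow> Cod C f = Cod C g \<Longrightarrow> Add C f g \<in> Arr C"
  "f \<in> Arr C \<Longrightarrow> g \<in> Arr C \<Longrightarrow> Dom C f = Dom C g \<Longrightarrow> Cod C f = Cod C g \<Longrightarrow>
     Dom C (Add C f g) = Dom C g"
  "f \<in> Arr C \<Longrightarrow> g \<in> Arr C \<Longrightarrow> Dom C f = Dom C g \<Longrightarrow> Cod C f = Cod C g \<Longrightarrow>
     Cod C (Add C f g) = Cod C g"
  using Zero_Hom[of A B] Scale_Hom[of f "Dom C f" "Cod C f" a]
    Add_Hom[of f "Dom C f" "Cod C f" g] by (simp_all add: Hom_iff)

lemma Cmp_Scale [simp]: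
  assumes "f \<in> Arr C" "g \<in> Arr C" "Dom C g = Cod C f"
  shows "g \<cdot> Scale C a f = Scale C a (g \<cdot> f)" "Scale C a g \<cdot> f = Scale C a (g \<cdot> f)"
  using Cmp_Scale_right[of f _ _ g] Cmp_Scale_left[of f _ _ g] assms by (auto simp: Hom_iff)

lemma Scale_Scale_arr [simp]: "f \<in> Arr C \<Longrightarrow> Scale C a (Scale C b f) = Scale C (a * b) f"
  using Scale_Scale by (auto simp: Hom_iff)

lemma Scale_one_arr [simp]: "f \<in> Arr C \<Longrightarrow> Scale C 1 f = f"
  using Scale_one by (auto simp: Hom_iff)

lemma Add_arr_laws:
  assumes "f \<in> Arr C" "g \<in> Arr C" "Dom C f = Dom C g" "Cod C f = Cod C g"
  shows "h \<in> Arr C \<Longrightarrow> Dom C h = Dom C g \<Longrightarrow> Cod C h = Cod C g \<Longrightarrow>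
      Add C (Add C f g) h = Add C f (Add C g h)"
    and "Add C f g = Add C g f"
    and "Scale C a (Add C f g) = Add C (Scale C a f) (Scale C a g)"
    and "h \<in> Arr C \<Longrightarrow> Dom C h = Cod C g \<Longrightarrow> h \<cdot> Add C f g = Add C (h \<cdot> f) (h \<cdot> g)"
    and "h \<in> Arr C \<Longrightarrow> Cod C h = Dom C g \<Longrightarrow> Add C f g \<cdot> h = Add C (f \<cdot> h) (g \<cdot> h)"
  using assms Add_assoc[of f "Dom C g" "Cod C g" g h] Add_commute[of f "Dom C g" "Cod C g" g]
    Scale_add_right[of f "Dom C g" "Cod C g" g a] Cmp_Add_right[of f "Dom C g" "Cod C g" g h "Cod C h"]
    Cmp_Add_left[of h "Dom C h" "Cod C h" f "Cod C g" g]
  by (simp_all add: Hom_iff)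

lemma Add_arr_laws1:
  assumes "f \<in> Arr C"
  shows "Dom C f = A \<Longrightarrow> Cod C f = B \<Longrightarrow> Add C f (Zero C A B) = f"
    and "Dom C f = A \<Longrightarrow> Cod C f = B \<Longrightarrow> Add C (Zero C A B) f = f"
    and "Scale C (a + b) f = Add C (Scale C a f) (Scale C b f)"
  using assms Add_commute[of f A B "Zero C A B"] Zero_Hom[of A B] Add_Zero[of f A B] Scale_add_left[of f "Dom C f" "Cod C f" a b] by (auto simp: Hom_iff)

text \<open>An arrow \<open>z\<close> with \<open>z + z = z\<close> is zero, which gives every compatibility with zero arrows below.\<close>

lemma idempotent_Zero:
  assumes z: "z \<in> Arr C" and zz: "Add C z z = z"
  shows "z = Zero C (Dom C z) (Cod C z)"
proof -
  from z obtain y where y: "y \<in> Hom C (Dom C z) (Cod C z)"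
      "Add C z y = Zero C (Dom C z) (Cod C z)"
    using Add_inverse[of z "Dom C z" "Cod C z"] by (auto simp: Hom_iff)
  have zH: "z \<in> Hom C (Dom C z) (Cod C z)" using z by (simp add: Hom_iff)
  have "Zero C (Dom C z) (Cod C z) = Add C (Add C z z) y" by (simp add: zz y(2))
  also have "\<dots> = z" using Add_assoc[OF zH zH y(1)] y(2) Add_Zero[OF zH] by simp
  finally show ?thesis by simp
qed

lemma Add_Zero_Zero [simp]:
  "A \<in> Obj C \<Longrightarrow> B \<in> Obj C \<Longrightarrow> Add C (Zero C A B) (Zero C A B) = Zero C A B"
  using Add_Zero[of "Zero C A B" A B] Zero_Hom by simp

lemma Cmp_Zero [simp]:
  "f \<in> Arr C \<Longrightarrow> Cod C f = A \<Longrightarrow> B \<in> Obj C \<Longrightarrow> Zero C A B \<cdot> f = Zero C (Dom C f) B"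
  "f \<in> Arr C \<Longrightarrow> Dom C f = B \<Longrightarrow> A \<in> Obj C \<Longrightarrow> f \<cdot> Zero C A B = Zero C A (Cod C f)"
proof -
  assume f: "f \<in> Arr C" "Cod C f = A" "B \<in> Obj C"
  have "A \<in> Obj C" using f by auto
  then show "Zero C A B \<cdot> f = Zero C (Dom C f) B"
    using f idempotent_Zero[of "Zero C A B \<cdot> f"]
      Cmp_Add_left[of f "Dom C f" A "Zero C A B" B "Zero C A B"] by (simp add: Hom_iff)
next
  assume f: "f \<in> Arr C" "Dom C f = B" "A \<in> Obj C"
  have "B \<in> Obj C" using f by auto
  then show "f \<cdot> Zero C A B = Zero C A (Cod C f)"
    using f idempotent_Zero[of "f \<cdot> Zero C A B"]
      Cmp_Add_right[of "Zero C A B" A B "Zero C A B" f "Cod C f"] by (simp add: Hom_iff)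
qed

lemma Scale_Zero [simp]:
  assumes "A \<in> Obj C" "B \<in> Obj C"
  shows "Scale C a (Zero C A B) = Zero C A B"
  using idempotent_Zero[of "Scale C a (Zero C A B)"]
    Scale_add_right[of "Zero C A B" A B "Zero C A B" a] assms by (simp add: Hom_iff)

lemma invertible_Scale [simp]:
  assumes "invertible f" "a \<noteq> 0"
  shows "invertible (Scale C a f)" and "inv_arr C (Scale C a f) = Scale C (inverse a) (inv_arr C f)"
proof -
  have "inverse_arrows C (Scale C a f) (Scale C (inverse a) (inv_arr C f))"
    using assms by (simp add: inverse_arrows_def Hom_iff)
  then show "invertible (Scale C a f)" "inv_arr C (Scale C a f) = Scale C (inverse a) (inv_arr C f)"
    by (blast intro: invertibleI inv_arr_eq)+
qed

lemma linear_Zero: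
  assumes "is_functor C F" "is_linear C F" "A \<in> Obj C" "B \<in> Obj C"
  shows "FA F (Zero C A B) = Zero C (FO F A) (FO F B)"
proof -
  have "FA F (Zero C A B) \<in> Hom C (FO F A) (FO F B)"
    using assms Zero_Hom by (auto simp: is_functor_def)
  moreover have "Add C (FA F (Zero C A B)) (FA F (Zero C A B)) = FA F (Zero C A B)"
    using assms Zero_Hom by (metis Add_Zero_Zero is_linear_def)
  ultimately show ?thesis using idempotent_Zero[of "FA F (Zero C A B)"] by (auto simp: Hom_iff)
qed

end

context tensor_category
begin

declare Unit_Obj [simp] TensO_Obj [simp] Unit_left [simp] Unit_right [simp]
  Unit_arr_left [simp] Unit_arr_right [simp] TensA_Idn [simp]

lemma TensA_simps [simp]:
  assumes "f \<in> Arr C" "g \<in> Arr C"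
  shows "f \<boxtimes> g \<in> Arr C" "Dom C (f \<boxtimes> g) = Dom C f \<boxdot> Dom C g" "Cod C (f \<boxtimes> g) = Cod C f \<boxdot> Cod C g"
  using TensA_Hom[of f _ _ g] assms by (auto simp: Hom_iff)

lemma interchange [simp]:
  assumes "f \<in> Arr C" "f' \<in> Arr C" "g \<in> Arr C" "g' \<in> Arr C" "Dom C f' = Cod C f" "Dom C g' = Cod C g"
  shows "(f' \<boxtimes> g') \<cdot> (f \<boxtimes> g) = (f' \<cdot> f) \<boxtimes> (g' \<cdot> g)"
  using TensA_Cmp[of f _ _ f' _ g _ _ g'] assms by (auto simp: Hom_iff)

lemma interchange_Cmp [simp]:
  assumes "f \<in> Arr C" "f' \<in> Arr C" "g \<in> Arr C" "g' \<in> Arr C" "Dom C f' = Cod C f" "Dom C g' = Cod C g"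
    "z \<in> Arr C" "Cod C z = Dom C f \<boxdot> Dom C g"
  shows "(f' \<boxtimes> g') \<cdot> (f \<boxtimes> g) \<cdot> z = ((f' \<cdot> f) \<boxtimes> (g' \<cdot> g)) \<cdot> z"
  using assms by (subst interchange[symmetric]) (simp_all del: interchange)

lemma TensA_Scale [simp]:
  assumes "f \<in> Arr C" "g \<in> Arr C"
  shows "Scale C a f \<boxtimes> g = Scale C a (f \<boxtimes> g)" "f \<boxtimes> Scale C a g = Scale C a (f \<boxtimes> g)"
  using TensA_Scale_left[of f _ _ g] TensA_Scale_right[of f _ _ g] assms by (auto simp: Hom_iff)

lemma TensA_Zero [simp]:
  "f \<in> Arr C \<Longrightarrow> A \<in> Obj C \<Longrightarrow> B \<in> Obj C \<Longrightarrow>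
     Zero C A B \<boxtimes> f = Zero C (A \<boxdot> Dom C f) (B \<boxdot> Cod C f)"
  "f \<in> Arr C \<Longrightarrow> A \<in> Obj C \<Longrightarrow> B \<in> Obj C \<Longrightarrow>
     f \<boxtimes> Zero C A B = Zero C (Dom C f \<boxdot> A) (Cod C f \<boxdot> B)"
  using idempotent_Zero[of "Zero C A B \<boxtimes> f"] TensA_Add_left[of "Zero C A B" A B "Zero C A B" f]
    idempotent_Zero[of "f \<boxtimes> Zero C A B"] TensA_Add_right[of f _ _ "Zero C A B" A B "Zero C A B"]
  by (auto simp: Hom_iff)

lemma TensA_Add:
  assumes "f \<in> Arr C" "g \<in> Arr C" "Dom C f = Dom C g" "Cod C f = Cod C g" "h \<in> Arr C"
  shows "Add C f g \<boxtimes> h = Add C (f \<boxtimes> h) (g \<boxtimes> h)" "h \<boxtimes> Add C f g = Add C (h \<boxtimes> f) (h \<boxtimes> g)"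
  using TensA_Add_left[of f "Dom C g" "Cod C g" g h "Dom C h" "Cod C h"]
    TensA_Add_right[of h "Dom C h" "Cod C h" f "Dom C g" "Cod C g" g] assms by (simp_all add: Hom_iff)

lemma inverse_arrows_TensA:
  assumes "invertible f" "invertible g"
  shows "inverse_arrows C (f \<boxtimes> g) (inv_arr C f \<boxtimes> inv_arr C g)"
  using assms by (simp add: inverse_arrows_def Hom_iff)

lemma invertible_TensA [simp]: "invertible f \<Longrightarrow> invertible g \<Longrightarrow> invertible (f \<boxtimes> g)"
  using inverse_arrows_TensA by (blast intro: invertibleI)

lemma inv_arr_TensA [simp]:
  "invertible f \<Longrightarrow> invertible g \<Longrightarrow> inv_arr C (f \<boxtimes> g) = inv_arr C f \<boxtimes> inv_arr C g"
  using inverse_arrows_TensA inv_arr_eq by blast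

lemma Assoc_simps [simp]:
  assumes "V \<in> Obj C" "W \<in> Obj C" "Z \<in> Obj C"
  shows "\<alpha> V W Z \<in> Arr C" "Dom C (\<alpha> V W Z) = V \<boxdot> (W \<boxdot> Z)" "Cod C (\<alpha> V W Z) = (V \<boxdot> W) \<boxdot> Z"
    "invertible (\<alpha> V W Z)"
  using Assoc_Iso[OF assms] by (simp_all add: Iso_iff)

lemma Assoc_nat:
  assumes "f \<in> Arr C" "g \<in> Arr C" "h \<in> Arr C"
  shows "\<alpha> (Cod C f) (Cod C g) (Cod C h) \<cdot> (f \<boxtimes> (g \<boxtimes> h)) =
    ((f \<boxtimes> g) \<boxtimes> h) \<cdot> \<alpha> (Dom C f) (Dom C g) (Dom C h)"
  using Assoc_natural[of f _ _ g _ _ h] assms by (auto simp: Hom_iff)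

lemma Assoc_middle_Unit [simp]: "V \<in> Obj C \<Longrightarrow> W \<in> Obj C \<Longrightarrow> \<alpha> V (Unit C) W = \<iota> (V \<boxdot> W)"
  by (rule triangle)

text \<open>
  The pentagon for \<open>I, I, V, W\<close> makes \<open>\<alpha> I V W\<close> idempotent, and an invertible idempotent is an
  identity.
\<close>

lemma Assoc_left_Unit [simp]:
  assumes "V \<in> Obj C" "W \<in> Obj C"
  shows "\<alpha> (Unit C) V W = \<iota> (V \<boxdot> W)"
proof (rule invertible_cancel_right[of "\<alpha> (Unit C) V W"])
  show "\<alpha> (Unit C) V W \<cdot> \<alpha> (Unit C) V W = \<iota> (V \<boxdot> W) \<cdot> \<alpha> (Unit C) V W"
    using pentagon[of "Unit C" "Unit C" V W] assms by simp
qed (use assms in simp_all)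

end

section \<open>Coherence for a tensor category with a group action\<close>

context tensor_category
begin

context
  fixes F :: "('o, 'm) mon_endofun"
  assumes F: "mon_autoequiv C F"
begin

lemma autoequiv_FO: "A \<in> Obj C \<Longrightarrow> FO F A \<in> Obj C"
  using F by (simp add: mon_autoequiv_def is_functor_def)

lemma autoequiv_FA:
  assumes "f \<in> Arr C"
  shows "FA F f \<in> Arr C" "Dom C (FA F f) = FO F (Dom C f)" "Cod C (FA F f) = FO F (Cod C f)"
  using F assms by (auto simp: mon_autoequiv_def is_functor_def Hom_iff)

lemma autoequiv_Idn: "A \<in> Obj C \<Longrightarrow> FA F (\<iota> A) = \<iota> (FO F A)"
  using F by (simp add: mon_autoequiv_def is_functor_def)

lemma autoequiv_Cmp:
  assumes "f \<in> Arr C" "g \<in> Arr C" "Dom C g = Cod C f"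
  shows "FA F (g \<cdot> f) = FA F g \<cdot> FA F f"
proof -
  have "f \<in> Hom C (Dom C f) (Cod C f)" "g \<in> Hom C (Cod C f) (Cod C g)"
    using assms by (simp_all add: Hom_iff)
  then show ?thesis using F by (simp add: mon_autoequiv_def is_functor_def)
qed

lemma autoequiv_Scale: "f \<in> Arr C \<Longrightarrow> FA F (Scale C a f) = Scale C a (FA F f)"
  using F by (simp add: mon_autoequiv_def is_linear_def)

lemma autoequiv_Add:
  assumes "f \<in> Hom C A B" "g \<in> Hom C A B"
  shows "FA F (Add C f g) = Add C (FA F f) (FA F g)"
proof -
  have "is_linear C F" using F by (simp add: mon_autoequiv_def)
  then show ?thesis using assms unfolding is_linear_def by blast
qed

lemma autoequiv_Zero: "A \<in> Obj C \<Longrightarrow> B \<in> Obj C \<Longrightarrow> FA F (Zero C A B) = Zero C (FO F A) (FO F B)"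
  using F linear_Zero by (auto simp: mon_autoequiv_def)

lemma autoequiv_Unit: "FO F (Unit C) = Unit C"
  using F by (simp add: mon_autoequiv_def)

lemma autoequiv_Psi:
  assumes "V \<in> Obj C" "W \<in> Obj C"
  shows "Psi F V W \<in> Arr C" "Dom C (Psi F V W) = FO F V \<boxdot> FO F W"
    "Cod C (Psi F V W) = FO F (V \<boxdot> W)" "invertible (Psi F V W)"
  using F assms by (simp_all add: mon_autoequiv_def Iso_iff)

lemma autoequiv_Psi_Unit:
  assumes "V \<in> Obj C"
  shows "Psi F V (Unit C) = \<iota> (FO F V)" "Psi F (Unit C) V = \<iota> (FO F V)"
  using F assms by (simp_all add: mon_autoequiv_def)

lemma autoequiv_Psi_nat:
  assumes "f \<in> Arr C" "g \<in> Arr C"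
  shows "Psi F (Cod C f) (Cod C g) \<cdot> (FA F f \<boxtimes> FA F g) = FA F (f \<boxtimes> g) \<cdot> Psi F (Dom C f) (Dom C g)"
  using F assms by (simp add: mon_autoequiv_def Hom_iff)

lemma autoequiv_hexagon:
  assumes "V \<in> Obj C" "W \<in> Obj C" "Z \<in> Obj C"
  shows "FA F (\<alpha> V W Z) \<cdot> Psi F V (W \<boxdot> Z) \<cdot> (\<iota> (FO F V) \<boxtimes> Psi F W Z) =
    Psi F (V \<boxdot> W) Z \<cdot> (Psi F V W \<boxtimes> \<iota> (FO F Z)) \<cdot> \<alpha> (FO F V) (FO F W) (FO F Z)"
  using F assms by (simp add: mon_autoequiv_def)

lemma autoequiv_inverse_arrows:
  assumes "invertible f"
  shows "inverse_arrows C (FA F f) (FA F (inv_arr C f))"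
  using assms
  by (simp add: inverse_arrows_def Hom_iff autoequiv_FA autoequiv_Idn flip: autoequiv_Cmp)

lemma autoequiv_invertible:
  assumes "invertible f"
  shows "invertible (FA F f)" "inv_arr C (FA F f) = FA F (inv_arr C f)"
  using autoequiv_inverse_arrows[OF assms] by (rule invertibleI, rule inv_arr_eq)

end

end

sublocale categorical_action \<subseteq> tensor_category C
  by (rule tensor_category)

sublocale categorical_action \<subseteq> G: group G
  by (rule group)

text \<open>
  The locale \<open>categorical_action\<close> again, with \<open>C\<close> as the implicit structure of the notation.
\<close>

locale tensor_category_action = categorical_action G C act \<chi>
  for G :: "('g, 'x) monoid_scheme" and C :: "('o, 'm, 'k::field, 'z) tensor_cat_scheme" (structure)
    and act :: "'g \<Rightarrow> ('o, 'm) mon_endofun" and \<chi> :: "'g \<Rightarrow> 'g \<Rightarrow> 'o \<Rightarrow> 'm"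
begin

abbreviation gmult (infixl "\<star>" 75) where "g \<star> h \<equiv> g \<otimes>\<^bsub>G\<^esub> h"
abbreviation "e \<equiv> \<one>\<^bsub>G\<^esub>"

lemmas act_rules =
  autoequiv_FO[OF act_autoequiv] autoequiv_FA[OF act_autoequiv] autoequiv_Idn[OF act_autoequiv]
  autoequiv_Cmp[OF act_autoequiv] autoequiv_Scale[OF act_autoequiv] autoequiv_Unit[OF act_autoequiv]
  autoequiv_Zero[OF act_autoequiv]
  autoequiv_Psi[OF act_autoequiv] autoequiv_Psi_Unit[OF act_autoequiv]
  autoequiv_invertible[OF act_autoequiv]
declare act_rules [simp]

lemmas act_Add = autoequiv_Add[OF act_autoequiv]
lemmas Psi_nat = autoequiv_Psi_nat[OF act_autoequiv]
lemmas hexagon = autoequiv_hexagon[OF act_autoequiv]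

lemma act_one_simps [simp]:
  "A \<in> Obj C \<Longrightarrow> FO (act e) A = A"
  "f \<in> Arr C \<Longrightarrow> FA (act e) f = f"
  "V \<in> Obj C \<Longrightarrow> W \<in> Obj C \<Longrightarrow> Psi (act e) V W = \<iota> (V \<boxdot> W)"
  using act_one by (simp_all add: eq_mon_def id_mon_def)

declare \<chi>_one_left [simp] \<chi>_one_right [simp]

lemma \<chi>_simps [simp]:
  assumes "g \<in> carrier G" "h \<in> carrier G" "V \<in> Obj C"
  shows "\<chi> g h V \<in> Arr C" "Dom C (\<chi> g h V) = FO (act g) (FO (act h) V)"
    "Cod C (\<chi> g h V) = FO (act (g \<star> h)) V" "invertible (\<chi> g h V)"
  using \<chi>_mon_nat_iso[OF assms(1,2)] assms(3)
  by (auto simp: mon_nat_iso_def nat_iso_def comp_mon_def Iso_iff)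

lemma \<chi>_nat:
  assumes "g \<in> carrier G" "h \<in> carrier G" "f \<in> Arr C"
  shows "\<chi> g h (Cod C f) \<cdot> FA (act g) (FA (act h) f) = FA (act (g \<star> h)) f \<cdot> \<chi> g h (Dom C f)"
  using \<chi>_mon_nat_iso[OF assms(1,2)] assms(3)
  by (auto simp: mon_nat_iso_def nat_iso_def comp_mon_def Hom_iff)

lemma \<chi>_Unit [simp]:
  assumes "g \<in> carrier G" "h \<in> carrier G"
  shows "\<chi> g h (Unit C) = \<iota> (Unit C)"
  using \<chi>_mon_nat_iso[OF assms(1,2)] by (simp add: mon_nat_iso_def)

lemma \<chi>_monoidal:
  assumes "g \<in> carrier G" "h \<in> carrier G" "V \<in> Obj C" "W \<in> Obj C"
  shows "\<chi> g h (V \<boxdot> W) \<cdot> FA (act g) (Psi (act h) V W) \<cdot> Psi (act g) (FO (act h) V) (FO (act h) W) =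
    Psi (act (g \<star> h)) V W \<cdot> (\<chi> g h V \<boxtimes> \<chi> g h W)"
  using \<chi>_mon_nat_iso[OF assms(1,2)] assms(3,4) by (simp add: mon_nat_iso_def comp_mon_def)

end

text \<open>
  Formal objects.  For \<open>g\<close> in \<open>G\<close> and a formal object \<open>t\<close>, the normal form of \<open>g\<^sub>* t\<close> is a list of pairs
  \<open>(h, V)\<close>, and \<open>unflatten g t x\<close> is the canonical isomorphism from the right-nested tensor product
  of the \<open>h\<^sub>* V\<close> and \<open>x\<close> to \<open>g\<^sub>* t \<boxdot> x\<close>.  The spare argument \<open>x\<close> is what makes associators disappear:
  a tensor product of formal objects acts on \<open>x\<close> by one factor after the other, so that
  associativity becomes an equality of functions of \<open>x\<close>.
\<close>

datatype ('g, 'o) trm = Leaf 'o | One | Ten "('g, 'o) trm" "('g, 'o) trm" | Act 'g "('g, 'o) trm"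

context tensor_category_action
begin

primrec wf_trm :: "('g, 'o) trm \<Rightarrow> bool" where
  "wf_trm (Leaf V) \<longleftrightarrow> V \<in> Obj C"
| "wf_trm One \<longleftrightarrow> True"
| "wf_trm (Ten a b) \<longleftrightarrow> wf_trm a \<and> wf_trm b"
| "wf_trm (Act g a) \<longleftrightarrow> g \<in> carrier G \<and> wf_trm a"

primrec ev :: "('g, 'o) trm \<Rightarrow> 'o" where
  "ev (Leaf V) = V"
| "ev One = Unit C"
| "ev (Ten a b) = ev a \<boxdot> ev b"
| "ev (Act g a) = FO (act g) (ev a)"

primrec nf :: "'g \<Rightarrow> ('g, 'o) trm \<Rightarrow> ('g \<times> 'o) list" where
  "nf g (Leaf V) = [(g, V)]"
| "nf g One = []"
| "nf g (Ten a b) = nf g a @ nf g b"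
| "nf g (Act h a) = nf (g \<star> h) a"

definition evl :: "('g \<times> 'o) list \<Rightarrow> 'o \<Rightarrow> 'o" where
  "evl xs x = foldr (\<lambda>(g, V) y. FO (act g) V \<boxdot> y) xs x"

primrec unflatten :: "'g \<Rightarrow> ('g, 'o) trm \<Rightarrow> 'o \<Rightarrow> 'm" where
  "unflatten g (Leaf V) x = \<iota> (FO (act g) V \<boxdot> x)"
| "unflatten g One x = \<iota> x"
| "unflatten g (Ten a b) x =
     (Psi (act g) (ev a) (ev b) \<boxtimes> \<iota> x) \<cdot> \<alpha> (FO (act g) (ev a)) (FO (act g) (ev b)) x \<cdot>
     (\<iota> (FO (act g) (ev a)) \<boxtimes> unflatten g b x) \<cdot> unflatten g a (evl (nf g b) x)"
| "unflatten g (Act h a) x = (inv_arr C (\<chi> g h (ev a)) \<boxtimes> \<iota> x) \<cdot> unflatten (g \<star> h) a x"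

lemma ev_Obj [simp]: "wf_trm a \<Longrightarrow> ev a \<in> Obj C"
  by (induction a) auto

lemma evl_simps [simp]:
  "evl [] x = x" "evl ((g, V) # xs) x = FO (act g) V \<boxdot> evl xs x" "evl (xs @ ys) x = evl xs (evl ys x)"
  by (simp_all add: evl_def)

lemma evl_nf_Obj [simp]: "wf_trm a \<Longrightarrow> g \<in> carrier G \<Longrightarrow> x \<in> Obj C \<Longrightarrow> evl (nf g a) x \<in> Obj C"
  by (induction a arbitrary: g x) auto

lemma unflatten_simps [simp]:
  assumes "wf_trm a" "g \<in> carrier G" "x \<in> Obj C"
  shows "invertible (unflatten g a x)" "Dom C (unflatten g a x) = evl (nf g a) x"
    "Cod C (unflatten g a x) = FO (act g) (ev a) \<boxdot> x"
proof -
  have "invertible (unflatten g a x) \<and> Dom C (unflatten g a x) = evl (nf g a) x \<and>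
    Cod C (unflatten g a x) = FO (act g) (ev a) \<boxdot> x"
    using assms by (induction a arbitrary: g x) auto
  then show "invertible (unflatten g a x)" "Dom C (unflatten g a x) = evl (nf g a) x"
    "Cod C (unflatten g a x) = FO (act g) (ev a) \<boxdot> x" by auto
qed

declare unflatten.simps [simp del]

text \<open>
  The arrows \<open>a \<rightarrow> b\<close> that are compatible with flattening.  Quantifying over \<open>g\<close> and \<open>x\<close> makes the
  notion stable under tensor products and the action; for \<open>g = e\<close> and \<open>x = I\<close> it determines the
  arrow, so that all diagrams of such arrows commute.
\<close>

definition coherent :: "('g, 'o) trm \<Rightarrow> ('g, 'o) trm \<Rightarrow> 'm \<Rightarrow> bool" where
  "coherent a b f \<longleftrightarrow> wf_trm a \<and> wf_trm b \<and> f \<in> Arr C \<and> Dom C f = ev a \<and> Cod C f = ev b \<and>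
     (\<forall>g \<in> carrier G. nf g a = nf g b \<and>
        (\<forall>x \<in> Obj C. (FA (act g) f \<boxtimes> \<iota> x) \<cdot> unflatten g a x = unflatten g b x))"

lemma coherentD:
  assumes "coherent a b f"
  shows "wf_trm a" "wf_trm b" "f \<in> Arr C" "Dom C f = ev a" "Cod C f = ev b"
    "g \<in> carrier G \<Longrightarrow> nf g a = nf g b"
    "g \<in> carrier G \<Longrightarrow> x \<in> Obj C \<Longrightarrow> (FA (act g) f \<boxtimes> \<iota> x) \<cdot> unflatten g a x = unflatten g b x"
  using assms by (auto simp: coherent_def)

theorem coherent_unique:
  assumes "coherent a b f" "coherent a b f'"
  shows "f = f'"
proof -
  note f = coherentD[OF assms(1)] and f' = coherentD[OF assms(2)]
  have "f \<cdot> unflatten e a (Unit C) = unflatten e b (Unit C)"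
    using f(7)[of e "Unit C"] f(3) by simp
  moreover have "f' \<cdot> unflatten e a (Unit C) = unflatten e b (Unit C)"
    using f'(7)[of e "Unit C"] f'(3) by simp
  ultimately show ?thesis
    using f(1-5) f'(3-5) by (intro invertible_cancel_right[of "unflatten e a (Unit C)" f f']) simp_all
qed

lemma coherent_Idn: "wf_trm a \<Longrightarrow> coherent a a (\<iota> (ev a))"
  by (simp add: coherent_def)

lemma coherent_Cmp:
  assumes f: "coherent a b f" and h: "coherent b c h"
  shows "coherent a c (h \<cdot> f)"
proof -
  note f' = coherentD[OF f] and h' = coherentD[OF h]
  have "(FA (act g) (h \<cdot> f) \<boxtimes> \<iota> x) \<cdot> unflatten g a x = unflatten g c x"
    if gx: "g \<in> carrier G" "x \<in> Obj C" for g x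
  proof -
    have "(FA (act g) (h \<cdot> f) \<boxtimes> \<iota> x) \<cdot> unflatten g a x =
        (FA (act g) h \<boxtimes> \<iota> x) \<cdot> (FA (act g) f \<boxtimes> \<iota> x) \<cdot> unflatten g a x"
      using f'(1-5) h'(1-5) gx by simp
    then show ?thesis by (simp only: f'(7)[OF gx] h'(7)[OF gx])
  qed
  then show ?thesis using f' h' by (simp add: coherent_def)
qed

text \<open>
  A coherent arrow is the quotient of the two unflattening isomorphisms at \<open>g = e\<close> and \<open>x = I\<close>.
\<close>

lemma coherent_invertible:
  assumes "coherent a b f"
  shows "invertible f"
proof -
  note f = coherentD[OF assms]
  have M: "f \<cdot> unflatten e a (Unit C) = unflatten e b (Unit C)"
    using f(7)[of e "Unit C"] f(3) by simp
  have "f = (f \<cdot> unflatten e a (Unit C)) \<cdot> inv_arr C (unflatten e a (Unit C))"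
    using f(1-5) by simp
  also have "invertible \<dots>"
    unfolding M using f(1-6) by (intro invertible_Cmp) simp_all
  finally show ?thesis .
qed

lemma coherent_inv_arr:
  assumes f: "coherent a b f"
  shows "coherent b a (inv_arr C f)"
proof -
  have i: "invertible f" using f by (rule coherent_invertible)
  note f' = coherentD[OF f]
  have "(FA (act g) (inv_arr C f) \<boxtimes> \<iota> x) \<cdot> unflatten g b x = unflatten g a x"
    if gx: "g \<in> carrier G" "x \<in> Obj C" for g x
    using f'(1-6) i gx by (simp flip: f'(7)[OF gx] autoequiv_Cmp[OF act_autoequiv])
  then show ?thesis using f' i by (simp add: coherent_def)
qed

text \<open>
  Naturality of \<open>\<chi> g h\<close> carries the condition for \<open>f\<close> at \<open>g h\<close> to the one for \<open>h\<^sub>* f\<close> at \<open>g\<close>.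
\<close>

lemma coherent_Act:
  assumes f: "coherent a b f" and h: "h \<in> carrier G"
  shows "coherent (Act h a) (Act h b) (FA (act h) f)"
proof -
  note f' = coherentD[OF f]
  have "(FA (act g) (FA (act h) f) \<boxtimes> \<iota> x) \<cdot> unflatten g (Act h a) x = unflatten g (Act h b) x"
    if gx: "g \<in> carrier G" "x \<in> Obj C" for g x
  proof -
    have n: "FA (act g) (FA (act h) f) \<cdot> inv_arr C (\<chi> g h (ev a)) =
        inv_arr C (\<chi> g h (ev b)) \<cdot> FA (act (g \<star> h)) f"
      using inv_arr_natural[OF \<chi>_nat[OF gx(1) h f'(3)]] f'(1-5) gx h by simp
    have "(FA (act g) (FA (act h) f) \<boxtimes> \<iota> x) \<cdot> unflatten g (Act h a) x =
        (inv_arr C (\<chi> g h (ev b)) \<boxtimes> \<iota> x) \<cdot> (FA (act (g \<star> h)) f \<boxtimes> \<iota> x) \<cdot> unflatten (g \<star> h) a x"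
      using f'(1-6) gx h n by (simp add: unflatten.simps)
    also have "\<dots> = unflatten g (Act h b) x"
      using f'(7)[of "g \<star> h" x] gx h by (simp add: unflatten.simps)
    finally show ?thesis .
  qed
  then show ?thesis using f' h by (simp add: coherent_def)
qed

text \<open>
  The second factor is compared at \<open>x\<close>, the first one at the flattened second factor.
\<close>

lemma coherent_Ten:
  assumes f: "coherent a b f" and h: "coherent a' b' h"
  shows "coherent (Ten a a') (Ten b b') (f \<boxtimes> h)"
proof -
  note f' = coherentD[OF f] and h' = coherentD[OF h]
  have "(FA (act g) (f \<boxtimes> h) \<boxtimes> \<iota> x) \<cdot> unflatten g (Ten a a') x = unflatten g (Ten b b') x"
    if gx: "g \<in> carrier G" "x \<in> Obj C" for g x
  proof -
    let ?y = "evl (nf g a') x"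
    have y: "?y = evl (nf g b') x" "?y \<in> Obj C" using h' gx by simp_all
    have n: "FA (act g) (f \<boxtimes> h) \<cdot> Psi (act g) (ev a) (ev a') =
        Psi (act g) (ev b) (ev b') \<cdot> (FA (act g) f \<boxtimes> FA (act g) h)"
      using Psi_nat[OF gx(1) f'(3) h'(3)] f'(4,5) h'(4,5) by simp
    have n2: "\<alpha> (FO (act g) (ev b)) (FO (act g) (ev b')) x \<cdot> (FA (act g) f \<boxtimes> (FA (act g) h \<boxtimes> \<iota> x)) =
        ((FA (act g) f \<boxtimes> FA (act g) h) \<boxtimes> \<iota> x) \<cdot> \<alpha> (FO (act g) (ev a)) (FO (act g) (ev a')) x"
      using Assoc_nat[of "FA (act g) f" "FA (act g) h" "\<iota> x"] gx f'(3,4,5) h'(3,4,5) by simp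
    have "(FA (act g) (f \<boxtimes> h) \<boxtimes> \<iota> x) \<cdot> unflatten g (Ten a a') x =
      (Psi (act g) (ev b) (ev b') \<boxtimes> \<iota> x) \<cdot> (((FA (act g) f \<boxtimes> FA (act g) h) \<boxtimes> \<iota> x) \<cdot>
        \<alpha> (FO (act g) (ev a)) (FO (act g) (ev a')) x) \<cdot>
      (\<iota> (FO (act g) (ev a)) \<boxtimes> unflatten g a' x) \<cdot> unflatten g a ?y"
      using f'(1-6) h'(1-6) gx y by (simp add: unflatten.simps n)
    also have "\<dots> = (Psi (act g) (ev b) (ev b') \<boxtimes> \<iota> x) \<cdot> \<alpha> (FO (act g) (ev b)) (FO (act g) (ev b')) x \<cdot>
      (FA (act g) f \<boxtimes> ((FA (act g) h \<boxtimes> \<iota> x) \<cdot> unflatten g a' x)) \<cdot> unflatten g a ?y"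
      using f'(1-6) h'(1-6) gx y by (simp flip: n2)
    also have "\<dots> = (Psi (act g) (ev b) (ev b') \<boxtimes> \<iota> x) \<cdot> \<alpha> (FO (act g) (ev b)) (FO (act g) (ev b')) x \<cdot>
      (\<iota> (FO (act g) (ev b)) \<boxtimes> unflatten g b' x) \<cdot> (FA (act g) f \<boxtimes> \<iota> ?y) \<cdot> unflatten g a ?y"
      using f'(1-6) h' gx y by simp
    also have "\<dots> = unflatten g (Ten b b') x"
      using f'(7)[OF gx(1) y(2)] by (simp add: y(1) unflatten.simps)
    finally show ?thesis .
  qed
  then show ?thesis using f' h' by (simp add: coherent_def)
qed

text \<open>
  Both unflattenings are rewritten to the same composite: the hexagon of \<open>g\<^sub>*\<close> replaces the image of the
  associator by the associator of the images, and the pentagon with fourth object \<open>x\<close> absorbs it.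
\<close>

lemma coherent_Assoc:
  assumes w: "wf_trm a" "wf_trm b" "wf_trm c"
  shows "coherent (Ten a (Ten b c)) (Ten (Ten a b) c) (\<alpha> (ev a) (ev b) (ev c))"
proof -
  have "(FA (act g) (\<alpha> (ev a) (ev b) (ev c)) \<boxtimes> \<iota> x) \<cdot> unflatten g (Ten a (Ten b c)) x =
      unflatten g (Ten (Ten a b) c) x" if gx: "g \<in> carrier G" "x \<in> Obj C" for g x
  proof -
    let ?A = "FO (act g) (ev a)" let ?B = "FO (act g) (ev b)" let ?C = "FO (act g) (ev c)"
    let ?P = "\<lambda>a b. Psi (act g) (ev a) (ev b)"
    let ?y = "evl (nf g c) x"
    let ?z = "evl (nf g b) ?y"
    have o: "?A \<in> Obj C" "?B \<in> Obj C" "?C \<in> Obj C" "?y \<in> Obj C" "?z \<in> Obj C" using w gx by simp_all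
    note [simp] = o
    have n1: "\<alpha> ?A (FO (act g) (ev b \<boxdot> ev c)) x \<cdot> (\<iota> ?A \<boxtimes> (?P b c \<boxtimes> \<iota> x)) =
        ((\<iota> ?A \<boxtimes> ?P b c) \<boxtimes> \<iota> x) \<cdot> \<alpha> ?A (?B \<boxdot> ?C) x"
      using Assoc_nat[of "\<iota> ?A" "?P b c" "\<iota> x"] w gx by simp
    have n2: "\<alpha> ?A ?B (?C \<boxdot> x) \<cdot> (\<iota> ?A \<boxtimes> (\<iota> ?B \<boxtimes> unflatten g c x)) =
        ((\<iota> (?A \<boxdot> ?B)) \<boxtimes> unflatten g c x) \<cdot> \<alpha> ?A ?B ?y"
      using Assoc_nat[of "\<iota> ?A" "\<iota> ?B" "unflatten g c x"] w gx by simp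
    have n3: "\<alpha> (FO (act g) (ev a \<boxdot> ev b)) ?C x \<cdot> (?P a b \<boxtimes> (\<iota> (?C \<boxdot> x))) =
        ((?P a b \<boxtimes> \<iota> ?C) \<boxtimes> \<iota> x) \<cdot> \<alpha> (?A \<boxdot> ?B) ?C x"
      using Assoc_nat[of "?P a b" "\<iota> ?C" "\<iota> x"] w gx by simp
    have h: "FA (act g) (\<alpha> (ev a) (ev b) (ev c)) \<cdot> Psi (act g) (ev a) (ev b \<boxdot> ev c) \<cdot> (\<iota> ?A \<boxtimes> ?P b c) =
        Psi (act g) (ev a \<boxdot> ev b) (ev c) \<cdot> (?P a b \<boxtimes> \<iota> ?C) \<cdot> \<alpha> ?A ?B ?C"
      using hexagon[OF gx(1)] w by simp
    have p: "(\<alpha> ?A ?B ?C \<boxtimes> \<iota> x) \<cdot> \<alpha> ?A (?B \<boxdot> ?C) x \<cdot> (\<iota> ?A \<boxtimes> \<alpha> ?B ?C x) =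
        \<alpha> (?A \<boxdot> ?B) ?C x \<cdot> \<alpha> ?A ?B (?C \<boxdot> x)"
      using pentagon[of ?A ?B ?C x] w gx by simp
    let ?T = "(\<iota> ?A \<boxtimes> (\<iota> ?B \<boxtimes> unflatten g c x)) \<cdot> (\<iota> ?A \<boxtimes> unflatten g b ?y) \<cdot> unflatten g a ?z"
    let ?T' = "(\<iota> ?A \<boxtimes> unflatten g b ?y) \<cdot> unflatten g a ?z"
    have "(FA (act g) (\<alpha> (ev a) (ev b) (ev c)) \<boxtimes> \<iota> x) \<cdot> unflatten g (Ten a (Ten b c)) x =
        ((FA (act g) (\<alpha> (ev a) (ev b) (ev c)) \<cdot> Psi (act g) (ev a) (ev b \<boxdot> ev c)) \<boxtimes> \<iota> x) \<cdot>
        (\<alpha> ?A (FO (act g) (ev b \<boxdot> ev c)) x \<cdot> (\<iota> ?A \<boxtimes> (?P b c \<boxtimes> \<iota> x))) \<cdot> (\<iota> ?A \<boxtimes> \<alpha> ?B ?C x) \<cdot> ?T"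
      using w gx by (simp add: unflatten.simps)
    also have "\<dots> = ((FA (act g) (\<alpha> (ev a) (ev b) (ev c)) \<cdot> Psi (act g) (ev a) (ev b \<boxdot> ev c) \<cdot> (\<iota> ?A \<boxtimes> ?P b c)) \<boxtimes> \<iota> x) \<cdot>
        \<alpha> ?A (?B \<boxdot> ?C) x \<cdot> (\<iota> ?A \<boxtimes> \<alpha> ?B ?C x) \<cdot> ?T"
      unfolding n1 using w gx by simp
    also have "\<dots> = ((Psi (act g) (ev a \<boxdot> ev b) (ev c) \<cdot> (?P a b \<boxtimes> \<iota> ?C)) \<boxtimes> \<iota> x) \<cdot>
        ((\<alpha> ?A ?B ?C \<boxtimes> \<iota> x) \<cdot> \<alpha> ?A (?B \<boxdot> ?C) x \<cdot> (\<iota> ?A \<boxtimes> \<alpha> ?B ?C x)) \<cdot> ?T"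
      unfolding h using w gx by simp
    also have "\<dots> = ((Psi (act g) (ev a \<boxdot> ev b) (ev c) \<cdot> (?P a b \<boxtimes> \<iota> ?C)) \<boxtimes> \<iota> x) \<cdot>
        \<alpha> (?A \<boxdot> ?B) ?C x \<cdot> (\<alpha> ?A ?B (?C \<boxdot> x) \<cdot> (\<iota> ?A \<boxtimes> (\<iota> ?B \<boxtimes> unflatten g c x))) \<cdot> ?T'"
      unfolding p using w gx by simp
    also have "\<dots> = (Psi (act g) (ev a \<boxdot> ev b) (ev c) \<boxtimes> \<iota> x) \<cdot>
        (((?P a b \<boxtimes> \<iota> ?C) \<boxtimes> \<iota> x) \<cdot> \<alpha> (?A \<boxdot> ?B) ?C x) \<cdot> (\<iota> (?A \<boxdot> ?B) \<boxtimes> unflatten g c x) \<cdot>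
        \<alpha> ?A ?B ?y \<cdot> ?T'"
      unfolding n2 using w gx by simp
    also have "\<dots> = unflatten g (Ten (Ten a b) c) x"
      unfolding n3[symmetric] using w gx by (simp add: unflatten.simps)
    finally show ?thesis .
  qed
  then show ?thesis using w by (simp add: coherent_def)
qed

text \<open>
  This is where \<open>\<chi> g h\<close> has to be a monoidal transformation.
\<close>

lemma coherent_Psi:
  assumes w: "wf_trm a" "wf_trm b" and h: "h \<in> carrier G"
  shows "coherent (Ten (Act h a) (Act h b)) (Act h (Ten a b)) (Psi (act h) (ev a) (ev b))"
proof -
  have "(FA (act g) (Psi (act h) (ev a) (ev b)) \<boxtimes> \<iota> x) \<cdot> unflatten g (Ten (Act h a) (Act h b)) x =
      unflatten g (Act h (Ten a b)) x" if gx: "g \<in> carrier G" "x \<in> Obj C" for g x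
  proof -
    let ?A = "FO (act (g \<star> h)) (ev a)" let ?B = "FO (act (g \<star> h)) (ev b)"
    let ?A' = "FO (act g) (FO (act h) (ev a))" let ?B' = "FO (act g) (FO (act h) (ev b))"
    let ?X = "inv_arr C (\<chi> g h (ev a))" let ?Y = "inv_arr C (\<chi> g h (ev b))"
    let ?y = "evl (nf (g \<star> h) b) x"
    let ?P = "FA (act g) (Psi (act h) (ev a) (ev b)) \<cdot> Psi (act g) (FO (act h) (ev a)) (FO (act h) (ev b))"
    have m: "?P \<cdot> (?X \<boxtimes> ?Y) = inv_arr C (\<chi> g h (ev a \<boxdot> ev b)) \<cdot> Psi (act (g \<star> h)) (ev a) (ev b)"
      using inv_arr_natural[of "\<chi> g h (ev a \<boxdot> ev b)" ?P "Psi (act (g \<star> h)) (ev a) (ev b)"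
          "\<chi> g h (ev a) \<boxtimes> \<chi> g h (ev b)"] \<chi>_monoidal[OF gx(1) h] w h gx by simp
    have n: "\<alpha> ?A' ?B' x \<cdot> (?X \<boxtimes> (?Y \<boxtimes> \<iota> x)) = ((?X \<boxtimes> ?Y) \<boxtimes> \<iota> x) \<cdot> \<alpha> ?A ?B x"
      using Assoc_nat[of ?X ?Y "\<iota> x"] w h gx by simp
    have "(FA (act g) (Psi (act h) (ev a) (ev b)) \<boxtimes> \<iota> x) \<cdot> unflatten g (Ten (Act h a) (Act h b)) x =
        (?P \<boxtimes> \<iota> x) \<cdot> (\<alpha> ?A' ?B' x \<cdot> (?X \<boxtimes> (?Y \<boxtimes> \<iota> x))) \<cdot>
        (\<iota> ?A \<boxtimes> unflatten (g \<star> h) b x) \<cdot> unflatten (g \<star> h) a ?y"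
      using w gx h by (simp add: unflatten.simps)
    also have "\<dots> = ((?P \<cdot> (?X \<boxtimes> ?Y)) \<boxtimes> \<iota> x) \<cdot> \<alpha> ?A ?B x \<cdot>
        (\<iota> ?A \<boxtimes> unflatten (g \<star> h) b x) \<cdot> unflatten (g \<star> h) a ?y"
      unfolding n using w gx h by simp
    also have "\<dots> = unflatten g (Act h (Ten a b)) x"
      unfolding m using w gx h by (simp add: unflatten.simps)
    finally show ?thesis .
  qed
  then show ?thesis using w h by (simp add: coherent_def)
qed

text \<open>
  Unflattening \<open>g\<^sub>* h\<^sub>* k\<^sub>* a\<close> and \<open>g\<^sub>* (h k)\<^sub>* a\<close> uses the two sides of the coherence law of \<open>\<chi>\<close>.
\<close>

lemma coherent_\<chi>:
  assumes w: "wf_trm a" and h: "h \<in> carrier G" "k \<in> carrier G"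
  shows "coherent (Act h (Act k a)) (Act (h \<star> k) a) (\<chi> h k (ev a))"
proof -
  have "(FA (act g) (\<chi> h k (ev a)) \<boxtimes> \<iota> x) \<cdot> unflatten g (Act h (Act k a)) x =
      unflatten g (Act (h \<star> k) a) x" if gx: "g \<in> carrier G" "x \<in> Obj C" for g x
  proof -
    let ?l = "\<chi> (g \<star> h) k (ev a) \<cdot> \<chi> g h (FO (act k) (ev a))"
    have c: "?l = \<chi> g (h \<star> k) (ev a) \<cdot> FA (act g) (\<chi> h k (ev a))"
      using \<chi>_coherence[OF gx(1) h] w by simp
    have "inv_arr C (\<chi> g h (FO (act k) (ev a))) \<cdot> inv_arr C (\<chi> (g \<star> h) k (ev a)) = inv_arr C ?l"
      using inv_arr_eq[OF inverse_arrows_Cmp] w h gx by simp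
    also have "\<dots> = inv_arr C (FA (act g) (\<chi> h k (ev a))) \<cdot> inv_arr C (\<chi> g (h \<star> k) (ev a))"
      unfolding c by (rule inv_arr_eq[OF inverse_arrows_Cmp]) (use w h gx in simp_all)
    finally have "FA (act g) (\<chi> h k (ev a)) \<cdot> inv_arr C (\<chi> g h (FO (act k) (ev a))) \<cdot>
        inv_arr C (\<chi> (g \<star> h) k (ev a)) = inv_arr C (\<chi> g (h \<star> k) (ev a))"
      using w h gx by (simp del: act_rules(17) add: G.m_assoc)
    then show ?thesis using w h gx by (simp add: unflatten.simps G.m_assoc)
  qed
  then show ?thesis using w h by (simp add: coherent_def G.m_assoc)
qed

text \<open>The underlying arrow of the associator of a crossed product.\<close>

definition crossed_assoc :: "'g \<Rightarrow> 'g \<Rightarrow> 'o \<Rightarrow> 'o \<Rightarrow> 'o \<Rightarrow> 'm" where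
  "crossed_assoc k l V W Z =
     \<alpha> V (FO (act k) W) (FO (act (k \<star> l)) Z) \<cdot>
     (\<iota> V \<boxtimes> (\<iota> (FO (act k) W) \<boxtimes> \<chi> k l Z)) \<cdot>
     (\<iota> V \<boxtimes> inv_arr C (Psi (act k) W (FO (act l) Z)))"

lemma crossed_assoc_simps [simp]:
  assumes "k \<in> carrier G" "l \<in> carrier G" "V \<in> Obj C" "W \<in> Obj C" "Z \<in> Obj C"
  shows "crossed_assoc k l V W Z \<in> Arr C"
    "Dom C (crossed_assoc k l V W Z) = V \<boxdot> FO (act k) (W \<boxdot> FO (act l) Z)"
    "Cod C (crossed_assoc k l V W Z) = V \<boxdot> FO (act k) W \<boxdot> FO (act (k \<star> l)) Z"
    "invertible (crossed_assoc k l V W Z)"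
  using assms by (simp_all add: crossed_assoc_def)

lemma crossed_assoc_nat:
  assumes k: "k \<in> carrier G" "l \<in> carrier G" and f: "f \<in> Arr C" "g \<in> Arr C" "h \<in> Arr C"
  shows "crossed_assoc k l (Cod C f) (Cod C g) (Cod C h) \<cdot> (f \<boxtimes> FA (act k) (g \<boxtimes> FA (act l) h)) =
    (f \<boxtimes> FA (act k) g \<boxtimes> FA (act (k \<star> l)) h) \<cdot> crossed_assoc k l (Dom C f) (Dom C g) (Dom C h)"
proof -
  have n1: "inv_arr C (Psi (act k) (Cod C g) (FO (act l) (Cod C h))) \<cdot> FA (act k) (g \<boxtimes> FA (act l) h) =
      (FA (act k) g \<boxtimes> FA (act k) (FA (act l) h)) \<cdot> inv_arr C (Psi (act k) (Dom C g) (FO (act l) (Dom C h)))"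
    using inv_arr_natural[OF Psi_nat[OF k(1) f(2), of "FA (act l) h"]] k f by simp
  have n2: "\<chi> k l (Cod C h) \<cdot> FA (act k) (FA (act l) h) = FA (act (k \<star> l)) h \<cdot> \<chi> k l (Dom C h)"
    using \<chi>_nat k f by simp
  have n3: "\<alpha> (Cod C f) (FO (act k) (Cod C g)) (FO (act (k \<star> l)) (Cod C h)) \<cdot>
        (f \<boxtimes> (FA (act k) g \<boxtimes> FA (act (k \<star> l)) h)) =
      (f \<boxtimes> FA (act k) g \<boxtimes> FA (act (k \<star> l)) h) \<cdot>
        \<alpha> (Dom C f) (FO (act k) (Dom C g)) (FO (act (k \<star> l)) (Dom C h))"
    using Assoc_nat[of f "FA (act k) g" "FA (act (k \<star> l)) h"] k f by simp
  have "crossed_assoc k l (Cod C f) (Cod C g) (Cod C h) \<cdot> (f \<boxtimes> FA (act k) (g \<boxtimes> FA (act l) h)) =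
      \<alpha> (Cod C f) (FO (act k) (Cod C g)) (FO (act (k \<star> l)) (Cod C h)) \<cdot>
      (f \<boxtimes> ((FA (act k) g \<boxtimes> (\<chi> k l (Cod C h) \<cdot> FA (act k) (FA (act l) h))) \<cdot>
        inv_arr C (Psi (act k) (Dom C g) (FO (act l) (Dom C h)))))"
    using k f by (simp add: crossed_assoc_def n1)
  also have "\<dots> = (\<alpha> (Cod C f) (FO (act k) (Cod C g)) (FO (act (k \<star> l)) (Cod C h)) \<cdot>
      (f \<boxtimes> (FA (act k) g \<boxtimes> FA (act (k \<star> l)) h))) \<cdot>
      (\<iota> (Dom C f) \<boxtimes> ((\<iota> (FO (act k) (Dom C g)) \<boxtimes> \<chi> k l (Dom C h)) \<cdot>
        inv_arr C (Psi (act k) (Dom C g) (FO (act l) (Dom C h)))))"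
    using k f by (simp add: n2)
  also have "\<dots> = (f \<boxtimes> FA (act k) g \<boxtimes> FA (act (k \<star> l)) h) \<cdot> crossed_assoc k l (Dom C f) (Dom C g) (Dom C h)"
    unfolding n3 using k f by (simp add: crossed_assoc_def)
  finally show ?thesis .
qed

lemma coherent_crossed_assoc:
  assumes "k \<in> carrier G" "l \<in> carrier G" "wf_trm a" "wf_trm b" "wf_trm c"
  shows "coherent (Ten a (Act k (Ten b (Act l c)))) (Ten (Ten a (Act k b)) (Act (k \<star> l) c))
    (crossed_assoc k l (ev a) (ev b) (ev c))"
proof -
  have "coherent (Act k (Ten b (Act l c))) (Ten (Act k b) (Act k (Act l c)))
      (inv_arr C (Psi (act k) (ev b) (FO (act l) (ev c))))"
    using coherent_inv_arr[OF coherent_Psi[of b "Act l c" k]] assms by simp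
  note 1 = coherent_Ten[OF coherent_Idn[OF assms(3)] this]
  note 2 = coherent_Ten[OF coherent_Idn[OF assms(3)]
    coherent_Ten[OF coherent_Idn coherent_\<chi>[OF assms(5,1,2)], of "Act k b"]]
  note 3 = coherent_Assoc[of a "Act k b" "Act (k \<star> l) c"]
  show ?thesis
    using coherent_Cmp[OF coherent_Cmp[OF 1 2] 3] assms by (simp add: crossed_assoc_def)
qed

text \<open>Arrows that are identities because of the strict units.\<close>

lemma coherent_Act_e: "wf_trm a \<Longrightarrow> coherent (Act e a) a (\<iota> (ev a))"
  by (simp add: coherent_def unflatten.simps)

lemma coherent_Act_One: "h \<in> carrier G \<Longrightarrow> coherent (Act h One) One (\<iota> (Unit C))"
  by (simp add: coherent_def unflatten.simps)

lemma coherent_Ten_One: "wf_trm a \<Longrightarrow> coherent (Ten a One) a (\<iota> (ev a))"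
  by (simp add: coherent_def unflatten.simps)

lemma coherent_One_Ten: "wf_trm a \<Longrightarrow> coherent (Ten One a) a (\<iota> (ev a))"
  by (simp add: coherent_def unflatten.simps)

end

section \<open>The twisted crossed product is a tensor category\<close>

locale twisted_action = tensor_category_action G C act \<chi>
  for G :: "('g, 'x) monoid_scheme" and C :: "('o, 'm, 'k::field, 'z) tensor_cat_scheme" (structure)
    and act :: "'g \<Rightarrow> ('o, 'm) mon_endofun" and \<chi> :: "'g \<Rightarrow> 'g \<Rightarrow> 'o \<Rightarrow> 'm" +
  fixes \<omega> :: "'g list \<Rightarrow> 'k"
  assumes \<omega>_nonzero: "\<lbrakk>x \<in> carrier G; y \<in> carrier G; z \<in> carrier G\<rbrakk> \<Longrightarrow> \<omega> [x, y, z] \<noteq> 0"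
    and \<omega>_normalized: "\<lbrakk>x \<in> carrier G; y \<in> carrier G; z \<in> carrier G; x = e \<or> y = e \<or> z = e\<rbrakk> \<Longrightarrow>
      \<omega> [x, y, z] = 1"
    and \<omega>_cocycle: "\<lbrakk>x \<in> carrier G; y \<in> carrier G; z \<in> carrier G; u \<in> carrier G\<rbrakk> \<Longrightarrow>
      \<omega> [y, z, u] * \<omega> [x, y \<star> z, u] * \<omega> [x, y, z] = \<omega> [x \<star> y, z, u] * \<omega> [x, y, z \<star> u]"
begin

definition "CP = crossed_product C G act \<chi> \<omega>"

lemma CP_simps [simp]:
  "Obj CP = Obj C \<times> carrier G"
  "(f, k, l) \<in> Arr CP \<longleftrightarrow> f \<in> Arr C \<and> k \<in> carrier G \<and> l \<in> carrier G \<and>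
     (k \<noteq> l \<longrightarrow> f = Zero C (Dom C f) (Cod C f))"
  "Dom CP (f, k, l) = (Dom C f, k)"
  "Cod CP (f, k, l) = (Cod C f, l)"
  "Idn CP (V, k) = (\<iota> V, k, k)"
  "Cmp CP (g, l', n) (f, k, l) = (g \<cdot> f, k, n)"
  "Zero CP (V, k) (W, l) = (Zero C V W, k, l)"
  "Add CP (f, k, l) (g, k', l') = (Add C f g, k, l)"
  "Scale CP a (f, k, l) = (Scale C a f, k, l)"
  "Unit CP = (Unit C, e)"
  "TensO CP (V, k) (W, l) = (V \<boxdot> FO (act k) W, k \<star> l)"
  "TensA CP (f, k, k') (g, l, l') =
     (if k = k' \<and> l = l' then f \<boxtimes> FA (act k) g
      else Zero C (Dom C f \<boxdot> FO (act k) (Dom C g)) (Cod C f \<boxdot> FO (act k') (Cod C g)),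
      k \<star> l, k' \<star> l')"
  "Assoc CP (V, k) (W, l) (Z, n) =
     (Scale C (\<omega> [k, l, n]) (crossed_assoc k l V W Z), k \<star> l \<star> n, k \<star> l \<star> n)"
  by (simp_all add: CP_def crossed_product_def crossed_assoc_def)

lemma Hom_CP: "h \<in> Hom CP A B \<longleftrightarrow> (\<exists>f. h = (f, snd A, snd B) \<and> f \<in> Arr C \<and>
    Dom C f = fst A \<and> Cod C f = fst B \<and> fst A \<in> Obj C \<and> fst B \<in> Obj C \<and> snd A \<in> carrier G \<and> snd B \<in> carrier G \<and>
    (snd A \<noteq> snd B \<longrightarrow> f = Zero C (fst A) (fst B)))"
  by (cases h; cases A; cases B) (auto simp: Hom_def)

lemma category_CP: "category CP"
  by unfold_locales (auto simp: Hom_CP)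

lemma linear_category_CP: "linear_category CP"
proof -
  interpret D: category CP by (rule category_CP)
  show ?thesis
  proof unfold_locales
    fix f A B assume "f \<in> Hom CP A B"
    then obtain f' where f: "f = (f', snd A, snd B)" "f' \<in> Arr C" "Dom C f' = fst A" "Cod C f' = fst B"
        "snd A \<in> carrier G" "snd B \<in> carrier G" "snd A \<noteq> snd B \<longrightarrow> f' = Zero C (fst A) (fst B)"
      by (auto simp: Hom_CP)
    then have "f' \<in> Hom C (fst A) (fst B)" by (simp add: Hom_iff)
    then obtain g where "g \<in> Hom C (fst A) (fst B)" "Add C f' g = Zero C (fst A) (fst B)"
      using Add_inverse by blast
    moreover from this have "snd A \<noteq> snd B \<Longrightarrow> g = Zero C (fst A) (fst B)"
      using f Add_commute Add_Zero Zero_Hom by (metis Cod_Obj Dom_Obj)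
    ultimately show "\<exists>g\<in>Hom CP A B. Add CP f g = Zero CP A B"
      using f by (intro bexI[of _ "(g, snd A, snd B)"]; cases A; cases B) (auto simp: Hom_CP Hom_iff)
  next
    fix f g A B assume "f \<in> Hom CP A B" "g \<in> Hom CP A B"
    then obtain f' g' where "f = (f', snd A, snd B)" "g = (g', snd A, snd B)"
        "f' \<in> Arr C" "g' \<in> Arr C" "Dom C f' = Dom C g'" "Cod C f' = Cod C g'"
      unfolding Hom_CP by metis
    then show "Add CP f g = Add CP g f"
      using Add_arr_laws(2)[of f' g'] by simp
  qed (auto simp: Hom_CP Add_arr_laws(1,3-5) Add_arr_laws1)
qed

lemma inverse_arrows_CP:
  assumes "invertible f" "k \<in> carrier G"
  shows "inverse_arrows CP (f, k, k) (inv_arr C f, k, k)"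
  using assms by (auto simp: inverse_arrows_def Hom_CP)

lemma Iso_CP:
  assumes "invertible f" "k \<in> carrier G" "A = (Dom C f, k)" "B = (Cod C f, k)"
  shows "(f, k, k) \<in> Iso CP A B"
  using assms inverse_arrows_CP[OF assms(1,2)] by (auto simp: Iso_def Hom_CP)

text \<open>
  Arrows between different summands are null, and null arrows absorb everything.  Equations between
  null arrows hold as soon as they are well typed, so that naturality has to be checked only within
  the summands.
\<close>

definition null :: "'m \<times> 'g \<times> 'g \<Rightarrow> bool" where
  "null x \<longleftrightarrow> fst x = Zero C (Dom C (fst x)) (Cod C (fst x))"

lemma null_off_diagonal: "(f, k, l) \<in> Arr CP \<Longrightarrow> k \<noteq> l \<Longrightarrow> null (f, k, l)"
  by (simp add: null_def)

lemma nullE: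
  assumes "null x" "x \<in> Arr CP"
  obtains A B k l where "A \<in> Obj C" "B \<in> Obj C" "x = (Zero C A B, k, l)" "k \<in> carrier G" "l \<in> carrier G"
  using assms by (cases x) (metis CP_simps(2) Cod_Obj Dom_Obj fst_conv null_def)

lemma null_TensA_left:
  assumes "null x" "x \<in> Arr CP" "y \<in> Arr CP"
  shows "null (TensA CP x y)"
  by (rule nullE[OF assms(1,2)], use assms(3) in \<open>cases y\<close>) (auto simp: null_def)

lemma null_TensA_right:
  assumes "null y" "x \<in> Arr CP" "y \<in> Arr CP"
  shows "null (TensA CP x y)"
  by (rule nullE[OF assms(1,3)], use assms(2) in \<open>cases x\<close>) (auto simp: null_def)

lemma null_Cmp_left:
  assumes "null y" "x \<in> Arr CP" "y \<in> Arr CP" "Dom CP y = Cod CP x"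
  shows "null (Cmp CP y x)"
  by (rule nullE[OF assms(1,3)], use assms(2,4) in \<open>cases x\<close>) (auto simp: null_def)

lemma null_Cmp_right:
  assumes "null x" "x \<in> Arr CP" "y \<in> Arr CP" "Dom CP y = Cod CP x"
  shows "null (Cmp CP y x)"
  by (rule nullE[OF assms(1,2)], use assms(3,4) in \<open>cases y\<close>) (auto simp: null_def)

lemma null_eqI:
  assumes "null x" "null y" "Dom CP x = Dom CP y" "Cod CP x = Cod CP y"
  shows "x = y"
  using assms by (cases x; cases y) (simp add: null_def)

lemma TensA_CP_Arr:
  assumes "x \<in> Arr CP" "y \<in> Arr CP"
  shows "TensA CP x y \<in> Arr CP" "Dom CP (TensA CP x y) = TensO CP (Dom CP x) (Dom CP y)"
    "Cod CP (TensA CP x y) = TensO CP (Cod CP x) (Cod CP y)"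
proof -
  obtain f k k' g l l' where xy: "x = (f, k, k')" "y = (g, l, l')" by (cases x; cases y)
  show "TensA CP x y \<in> Arr CP" "Dom CP (TensA CP x y) = TensO CP (Dom CP x) (Dom CP y)"
    "Cod CP (TensA CP x y) = TensO CP (Cod CP x) (Cod CP y)"
    using assms by (simp_all add: xy)
qed

lemma interchange_CP:
  assumes "x \<in> Arr CP" "x' \<in> Arr CP" "y \<in> Arr CP" "y' \<in> Arr CP"
    and "Dom CP x' = Cod CP x" "Dom CP y' = Cod CP y"
  shows "TensA CP (Cmp CP x' x) (Cmp CP y' y) = Cmp CP (TensA CP x' y') (TensA CP x y)" (is "?L = ?R")
proof -
  interpret D: category CP by (rule category_CP)
  obtain f k j f' k' j' g l i g' l' i' where
    xy: "x = (f, k, j)" "x' = (f', k', j')" "y = (g, l, i)" "y' = (g', l', i')"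
    by (cases x; cases x'; cases y; cases y')
  show ?thesis
  proof (cases "k = j \<and> k' = j' \<and> l = i \<and> l' = i'")
    case True
    then show ?thesis using assms by (simp add: xy)
  next
    case False
    then have "null x \<or> null x' \<or> null y \<or> null y'"
      using assms(1-4) null_off_diagonal unfolding xy by blast
    then have n: "null (TensA CP x' y') \<or> null (TensA CP x y)"
        "null (Cmp CP x' x) \<or> null (Cmp CP y' y)"
      using assms by (meson null_TensA_left null_TensA_right null_Cmp_left null_Cmp_right)+
    note T = TensA_CP_Arr assms
    have "null ?L" using n(2) by (rule disjE) (simp_all add: null_TensA_left null_TensA_right T)
    moreover have "null ?R" using n(1) by (rule disjE) (simp_all add: null_Cmp_left null_Cmp_right T)
    ultimately show ?thesis by (rule null_eqI) (simp_all add: T)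
  qed
qed

lemma Assoc_natural_CP:
  assumes "x \<in> Arr CP" "y \<in> Arr CP" "z \<in> Arr CP"
  shows "Cmp CP (Assoc CP (Cod CP x) (Cod CP y) (Cod CP z)) (TensA CP x (TensA CP y z)) =
    Cmp CP (TensA CP (TensA CP x y) z) (Assoc CP (Dom CP x) (Dom CP y) (Dom CP z))" (is "?L = ?R")
proof -
  interpret D: category CP by (rule category_CP)
  obtain f k k' g l l' h n n' where xyz: "x = (f, k, k')" "y = (g, l, l')" "z = (h, n, n')"
    by (cases x; cases y; cases z)
  show ?thesis
  proof (cases "k = k' \<and> l = l' \<and> n = n'")
    case True
    then show ?thesis using assms crossed_assoc_nat[of k l f g h] by (simp add: xyz G.m_assoc)
  next
    case False
    then have null: "null x \<or> null y \<or> null z"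
      using assms null_off_diagonal by (auto simp: xyz)
    have A: "Assoc CP (Cod CP x) (Cod CP y) (Cod CP z) \<in> Arr CP"
        "Assoc CP (Dom CP x) (Dom CP y) (Dom CP z) \<in> Arr CP"
        "Dom CP (Assoc CP (Cod CP x) (Cod CP y) (Cod CP z)) =
           TensO CP (Cod CP x) (TensO CP (Cod CP y) (Cod CP z))"
        "Cod CP (Assoc CP (Dom CP x) (Dom CP y) (Dom CP z)) =
           TensO CP (TensO CP (Dom CP x) (Dom CP y)) (Dom CP z)"
        "Cod CP (Assoc CP (Cod CP x) (Cod CP y) (Cod CP z)) =
           TensO CP (TensO CP (Cod CP x) (Cod CP y)) (Cod CP z)"
        "Dom CP (Assoc CP (Dom CP x) (Dom CP y) (Dom CP z)) =
           TensO CP (Dom CP x) (TensO CP (Dom CP y) (Dom CP z))"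
      using assms by (auto simp: xyz G.m_assoc)
    note T = TensA_CP_Arr assms A
    have "null (TensA CP x (TensA CP y z))" "null (TensA CP (TensA CP x y) z)"
      using null T by (meson null_TensA_left null_TensA_right)+
    then have "null ?L" "null ?R" by (simp_all add: null_Cmp_left null_Cmp_right T)
    then show ?thesis by (rule null_eqI) (simp_all add: T)
  qed
qed

text \<open>
  The underlying arrows of the two sides are coherent between the same formal objects, hence equal; the
  scalars agree by the cocycle condition.
\<close>

lemma pentagon_CP:
  assumes "V \<in> Obj C" "W \<in> Obj C" "Y \<in> Obj C" "Z \<in> Obj C"
    and k: "k \<in> carrier G" "l \<in> carrier G" "m \<in> carrier G" "n \<in> carrier G"
  shows "Cmp CP (TensA CP (Assoc CP (V, k) (W, l) (Y, m)) (Idn CP (Z, n)))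
      (Cmp CP (Assoc CP (V, k) (TensO CP (W, l) (Y, m)) (Z, n))
        (TensA CP (Idn CP (V, k)) (Assoc CP (W, l) (Y, m) (Z, n)))) =
    Cmp CP (Assoc CP (TensO CP (V, k) (W, l)) (Y, m) (Z, n))
      (Assoc CP (V, k) (W, l) (TensO CP (Y, m) (Z, n)))"
proof -
  let ?v = "Leaf V" let ?w = "Leaf W" let ?y = "Leaf Y" let ?z = "Leaf Z"
  have o: "wf_trm ?v" "wf_trm ?w" "wf_trm ?y" "wf_trm ?z" using assms by simp_all
  note 1 = coherent_Ten[OF coherent_Idn[OF o(1)] coherent_Act[OF coherent_crossed_assoc[OF k(2,3) o(2-4)] k(1)]]
  note 2 = coherent_crossed_assoc[of k "l \<star> m" ?v "Ten ?w (Act l ?y)" ?z]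
  note 3 = coherent_Ten[OF coherent_crossed_assoc[OF k(1,2) o(1-3)] coherent_Idn[of "Act (k \<star> (l \<star> m)) ?z"]]
  note 4 = coherent_crossed_assoc[of k l ?v ?w "Ten ?y (Act m ?z)"]
  note 5 = coherent_crossed_assoc[of "k \<star> l" m "Ten ?v (Act k ?w)" ?y ?z]
  have "(crossed_assoc k l V W Y \<boxtimes> \<iota> (FO (act (k \<star> l \<star> m)) Z)) \<cdot>
      crossed_assoc k (l \<star> m) V (W \<boxdot> FO (act l) Y) Z \<cdot>
      (\<iota> V \<boxtimes> FA (act k) (crossed_assoc l m W Y Z)) =
    crossed_assoc (k \<star> l) m (V \<boxdot> FO (act k) W) Y Z \<cdot> crossed_assoc k l V W (Y \<boxdot> FO (act m) Z)"
    using coherent_unique[OF coherent_Cmp[OF coherent_Cmp[OF 1 2] 3]] coherent_Cmp[OF 4 5] assms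
    by (simp add: G.m_assoc)
  moreover have "\<omega> [l, m, n] * (\<omega> [k, l \<star> m, n] * \<omega> [k, l, m]) = \<omega> [k, l, m \<star> n] * \<omega> [k \<star> l, m, n]"
    using \<omega>_cocycle[OF k] by (simp add: ac_simps)
  ultimately show ?thesis
    using assms by (simp add: G.m_assoc mult.assoc)
qed

theorem tensor_category_CP: "tensor_category CP"
proof -
  interpret D: linear_category CP by (rule linear_category_CP)
  show ?thesis
  proof unfold_locales
    fix V W Z assume "V \<in> Obj CP" "W \<in> Obj CP" "Z \<in> Obj CP"
    then show "Assoc CP V W Z \<in> Iso CP (TensO CP V (TensO CP W Z)) (TensO CP (TensO CP V W) Z)"
      by (auto intro!: Iso_CP simp: \<omega>_nonzero G.m_assoc)
  next
    fix f V V' g W W' h Z Z'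
    assume "f \<in> Hom CP V V'" "g \<in> Hom CP W W'" "h \<in> Hom CP Z Z'"
    then show "Cmp CP (Assoc CP V' W' Z') (TensA CP f (TensA CP g h)) =
        Cmp CP (TensA CP (TensA CP f g) h) (Assoc CP V W Z)"
      using Assoc_natural_CP[of f g h] by (simp add: D.Hom_iff)
  next
    fix f V V' f' V'' g W W' g' W''
    assume "f \<in> Hom CP V V'" "f' \<in> Hom CP V' V''" "g \<in> Hom CP W W'" "g' \<in> Hom CP W' W''"
    then show "TensA CP (Cmp CP f' f) (Cmp CP g' g) = Cmp CP (TensA CP f' g') (TensA CP f g)"
      by (intro interchange_CP) (simp_all add: D.Hom_iff)
  next
    fix V W Y Z assume "V \<in> Obj CP" "W \<in> Obj CP" "Y \<in> Obj CP" "Z \<in> Obj CP"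
    then show "Cmp CP (TensA CP (Assoc CP V W Y) (Idn CP Z))
        (Cmp CP (Assoc CP V (TensO CP W Y) Z) (TensA CP (Idn CP V) (Assoc CP W Y Z))) =
      Cmp CP (Assoc CP (TensO CP V W) Y Z) (Assoc CP V W (TensO CP Y Z))"
      using pentagon_CP by auto
  next
    fix V W assume "V \<in> Obj CP" "W \<in> Obj CP"
    then show "Assoc CP V (Unit CP) W = Idn CP (TensO CP V W)"
      by (auto simp: crossed_assoc_def \<omega>_normalized)
  qed (auto simp: Hom_CP TensA_Add act_Add[unfolded Hom_iff] split: if_splits)
qed

end

section \<open>Conjugation in the crossed product by an extension\<close>

text \<open>
  The data of the theorem together with a section \<open>s\<close> of \<open>\<rho>\<close>, not a homomorphism in general, that
  preserves the unit.
\<close>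

locale action_of_extension = tensor_category_action G C act \<chi>
  for G :: "('g, 'x) monoid_scheme" and C :: "('o, 'm, 'k::field, 'z) tensor_cat_scheme" (structure)
    and act :: "'g \<Rightarrow> ('o, 'm) mon_endofun" and \<chi> :: "'g \<Rightarrow> 'g \<Rightarrow> 'o \<Rightarrow> 'm" +
  fixes Q :: "('q, 'y) monoid_scheme" and \<rho> :: "'g \<Rightarrow> 'q" and \<pi> :: "'q list \<Rightarrow> 'k"
    and \<omega> :: "'g list \<Rightarrow> 'k" and s :: "'q \<Rightarrow> 'g"
  assumes Q_group: "group Q"
    and \<rho>_hom: "\<rho> \<in> hom G Q"
    and \<pi>_cocycle: "\<pi> \<in> cocycles Q 4"
    and \<omega>_cochain: "\<omega> \<in> cochains G 3"
    and d\<omega>: "differential G 3 \<omega> = pullback G \<rho> 4 \<pi>"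
    and s_closed [simp]: "q \<in> carrier Q \<Longrightarrow> s q \<in> carrier G"
    and \<rho>_s [simp]: "q \<in> carrier Q \<Longrightarrow> \<rho> (s q) = q"
    and s_one [simp]: "s \<one>\<^bsub>Q\<^esub> = e"
begin

sublocale Q: group Q
  by (rule Q_group)

sublocale \<rho>: group_hom G Q \<rho>
  by unfold_locales (rule \<rho>_hom)

abbreviation qmult (infixl "\<bullet>" 75) where "q \<bullet> r \<equiv> q \<otimes>\<^bsub>Q\<^esub> r"

abbreviation "K \<equiv> G\<lparr>carrier := kernel G Q \<rho>\<rparr>"

lemma carrier_K [simp]: "k \<in> kernel G Q \<rho> \<longleftrightarrow> k \<in> carrier G \<and> \<rho> k = \<one>\<^bsub>Q\<^esub>"
  by (simp add: kernel_def)

abbreviation w :: "'g \<Rightarrow> 'g \<Rightarrow> 'g \<Rightarrow> 'k" where "w x y z \<equiv> \<omega> [x, y, z]"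

lemma w_nonzero [simp]:
  "x \<in> carrier G \<Longrightarrow> y \<in> carrier G \<Longrightarrow> z \<in> carrier G \<Longrightarrow> w x y z \<noteq> 0"
  using \<omega>_cochain by (auto simp: cochains_def tuples_def PiE_def Pi_def)

lemma w_normalized [simp]:
  "y \<in> carrier G \<Longrightarrow> z \<in> carrier G \<Longrightarrow> w e y z = 1"
  "x \<in> carrier G \<Longrightarrow> z \<in> carrier G \<Longrightarrow> w x e z = 1"
  "x \<in> carrier G \<Longrightarrow> y \<in> carrier G \<Longrightarrow> w x y e = 1"
  using \<omega>_cochain by (auto simp: cochains_def tuples_def)

lemma \<pi>_nonzero [simp]:
  "x \<in> carrier Q \<Longrightarrow> y \<in> carrier Q \<Longrightarrow> z \<in> carrier Q \<Longrightarrow> v \<in> carrier Q \<Longrightarrow> \<pi> [x, y, z, v] \<noteq> 0"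
  using \<pi>_cocycle by (auto simp: cocycles_def cochains_def tuples_def PiE_def Pi_def)

lemma w_pentagon:
  assumes "x \<in> carrier G" "y \<in> carrier G" "z \<in> carrier G" "v \<in> carrier G"
  shows "w y z v * w x (y \<star> z) v * w x y z =
    \<pi> [\<rho> x, \<rho> y, \<rho> z, \<rho> v] * w (x \<star> y) z v * w x y (z \<star> v)"
  using d\<omega> differential_eq_pullback_iff[OF group \<omega>_cochain] assms by blast

text \<open>Since \<open>\<pi>\<close> is normalized, the anomaly disappears as soon as one of four elements lies in \<open>K\<close>.\<close>

lemma w_pentagon_K:
  assumes "x \<in> carrier G" "y \<in> carrier G" "z \<in> carrier G" "v \<in> carrier G"
    and "\<rho> x = \<one>\<^bsub>Q\<^esub> \<or> \<rho> y = \<one>\<^bsub>Q\<^esub> \<or> \<rho> z = \<one>\<^bsub>Q\<^esub> \<or> \<rho> v = \<one>\<^bsub>Q\<^esub>"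
  shows "w y z v * w x (y \<star> z) v * w x y z = w (x \<star> y) z v * w x y (z \<star> v)"
proof -
  have "\<pi> [\<rho> x, \<rho> y, \<rho> z, \<rho> v] = 1"
    using \<pi>_cocycle assms by (auto simp: cocycles_def cochains_def tuples_def)
  then show ?thesis using w_pentagon[OF assms(1-4)] by simp
qed

text \<open>
  By the exact pentagons, the restriction of \<open>\<omega>\<close> to \<open>K\<close> is a cocycle.
\<close>

sublocale K: twisted_action K C act \<chi> "restrict \<omega> (tuples K 3)"
proof -
  have K: "group K"
    using subgroup.subgroup_is_group[OF \<rho>.subgroup_kernel group] .
  show "twisted_action K C act \<chi> (restrict \<omega> (tuples K 3))"
  proof (intro twisted_action.intro tensor_category_action.intro categorical_action.intro
      twisted_action_axioms.intro)
    show "group K" by (rule K)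
  qed (auto simp: tensor_category act_autoequiv \<chi>_mon_nat_iso \<chi>_coherence act_one tuples_def
      w_pentagon_K)
qed

abbreviation "D \<equiv> K.CP"

sublocale D: tensor_category D
  by (rule K.tensor_category_CP)

lemma K_crossed_assoc [simp]: "K.crossed_assoc k l V W Z = crossed_assoc k l V W Z"
  by (simp add: crossed_assoc_def K.crossed_assoc_def)

lemma tuples_K [simp]:
  "[x, y, z] \<in> tuples K 3 \<longleftrightarrow> x \<in> carrier K \<and> y \<in> carrier K \<and> z \<in> carrier K"
  by (auto simp: tuples_def)

subsection \<open>Scalars\<close>

lemma mult_cancel_inv [simp]:
  "x \<in> carrier G \<Longrightarrow> y \<in> carrier G \<Longrightarrow> x \<star> (inv\<^bsub>G\<^esub> x \<star> y) = y"
  "x \<in> carrier G \<Longrightarrow> y \<in> carrier G \<Longrightarrow> inv\<^bsub>G\<^esub> x \<star> (x \<star> y) = y"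
  by (simp_all flip: G.m_assoc)

lemma Q_mult_cancel_inv [simp]:
  "x \<in> carrier Q \<Longrightarrow> y \<in> carrier Q \<Longrightarrow> x \<bullet> (inv\<^bsub>Q\<^esub> x \<bullet> y) = y"
  "x \<in> carrier Q \<Longrightarrow> y \<in> carrier Q \<Longrightarrow> inv\<^bsub>Q\<^esub> x \<bullet> (x \<bullet> y) = y"
  by (simp_all flip: Q.m_assoc)

lemmas word_simps = G.m_assoc G.inv_mult_group Q.m_assoc Q.inv_mult_group

abbreviation conjugate :: "'g \<Rightarrow> 'g \<Rightarrow> 'g" where "conjugate g k \<equiv> g \<star> (k \<star> inv\<^bsub>G\<^esub> g)"

text \<open>
  In the following products an element \<open>x\<close> of \<open>G\<close> stands for the object \<open>[I, x]\<close> of the crossed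
  product with \<open>G\<close>.  The first scalar belongs to the composite
  \<open>(g k g\<^sup>-\<^sup>1) (g y) \<rightarrow> ((g k g\<^sup>-\<^sup>1) g) y = (g k) y \<rightarrow> g (k y)\<close> of an associator and an inverse
  associator.
\<close>

definition swap_scalar :: "'g \<Rightarrow> 'g \<Rightarrow> 'g \<Rightarrow> 'k" where
  "swap_scalar g k y = w (conjugate g k) g y / w g k y"

text \<open>
  The scalar of the monoidal structure of conjugation by \<open>g\<close>.  It has the value that makes moving \<open>g\<close>
  past \<open>k l\<close> at once the same as moving it past \<open>l\<close> and then past \<open>k\<close>.
\<close>

definition Psi_scalar :: "'g \<Rightarrow> 'g \<Rightarrow> 'g \<Rightarrow> 'k" where
  "Psi_scalar g k l = w (conjugate g k) g l / (w g k l * w (conjugate g k) (conjugate g l) g)"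

text \<open>
  With \<open>a' = g a g\<^sup>-\<^sup>1\<close> and \<open>b' = g b g\<^sup>-\<^sup>1\<close>, the pentagons for \<open>g, a, b, y\<close>, for \<open>a', g, b, y\<close> and for
  \<open>a', b', g, y\<close> are exact, and each of them eliminates one value of \<open>\<omega>\<close> that depends on \<open>y\<close>.
\<close>

lemma swap_scalar_mult:
  assumes [simp]: "g \<in> carrier G" "a \<in> carrier G" "b \<in> carrier G" "y \<in> carrier G"
    and [simp]: "\<rho> a = \<one>\<^bsub>Q\<^esub>" "\<rho> b = \<one>\<^bsub>Q\<^esub>"
  shows "swap_scalar g a (b \<star> y) * swap_scalar g b y / w (conjugate g a) (conjugate g b) (g \<star> y) =
    Psi_scalar g a b * swap_scalar g (a \<star> b) y / w a b y"
proof -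
  have 1: "w a b y = w (g \<star> a) b y * w g a (b \<star> y) / (w g (a \<star> b) y * w g a b)"
    using w_pentagon_K[of g a b y] by (simp add: field_simps)
  have 2: "w g b y = w (conjugate g a \<star> g) b y * w (conjugate g a) g (b \<star> y) /
      (w (conjugate g a) (g \<star> b) y * w (conjugate g a) g b)"
    using w_pentagon_K[of "conjugate g a" g b y] by (simp add: field_simps)
  have 3: "w (conjugate g b) g y = w (conjugate g a \<star> conjugate g b) g y * w (conjugate g a) (conjugate g b) (g \<star> y) /
      (w (conjugate g a) (conjugate g b \<star> g) y * w (conjugate g a) (conjugate g b) g)"
    using w_pentagon_K[of "conjugate g a" "conjugate g b" g y] by (simp add: field_simps)
  show ?thesis
    unfolding swap_scalar_def Psi_scalar_def 1 2 3 by (simp add: word_simps field_simps)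
qed

abbreviation u :: "'q \<Rightarrow> 'q \<Rightarrow> 'g" where "u q r \<equiv> s q \<star> (s r \<star> inv\<^bsub>G\<^esub> s (q \<bullet> r))"

text \<open>
  The scalar of \<open>(u q r) (s (q r) y) \<rightarrow> ((u q r) (s (q r))) y = (s q s r) y \<rightarrow> s q (s r y)\<close>.
\<close>

definition split_scalar :: "'q \<Rightarrow> 'q \<Rightarrow> 'g \<Rightarrow> 'k" where
  "split_scalar q r y = w (u q r) (s (q \<bullet> r)) y / w (s q) (s r) y"

text \<open>
  The scalar of the structure map of \<open>U q r\<close> on the summand \<open>k\<close>, the value that the following lemma
  forces.
\<close>

definition X_scalar :: "'q \<Rightarrow> 'q \<Rightarrow> 'g \<Rightarrow> 'k" where
  "X_scalar q r k =
     w (conjugate (s q) (conjugate (s r) k)) (s q) (s r) * w (s q) (s r) k * w (u q r) (conjugate (s (q \<bullet> r)) k) (s (q \<bullet> r)) /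
     (w (s q) (conjugate (s r) k) (s r) * w (conjugate (s q) (conjugate (s r) k)) (u q r) (s (q \<bullet> r)) *
      w (u q r) (s (q \<bullet> r)) k)"

text \<open>
  Both sides move \<open>s q\<close> and \<open>s r\<close> to the left of \<open>k\<close>: the left side splits \<open>u q r\<close> first, the right
  side conjugates by \<open>s (q r)\<close> first.  Six pentagons enter, and each of them contains \<open>k\<close> or one of
  its conjugates.
\<close>

lemma swap_scalar_split:
  assumes [simp]: "q \<in> carrier Q" "r \<in> carrier Q" "k \<in> carrier G" "y \<in> carrier G"
    and [simp]: "\<rho> k = \<one>\<^bsub>Q\<^esub>"
  shows "swap_scalar (s q) (conjugate (s r) k) (s r \<star> y) * swap_scalar (s r) k y * split_scalar q r y /
      w (conjugate (s q) (conjugate (s r) k)) (u q r) (s (q \<bullet> r) \<star> y) =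
    X_scalar q r k * (split_scalar q r (k \<star> y) * swap_scalar (s (q \<bullet> r)) k y /
      w (u q r) (conjugate (s (q \<bullet> r)) k) (s (q \<bullet> r) \<star> y))"
proof -
  define g h m where ghm: "g = s q" "h = s r" "m = s (q \<bullet> r)"
  define v where "v = u q r"
  define k1 k2 k3 where k: "k1 = conjugate h k" "k2 = conjugate g k1" "k3 = conjugate m k"
  have [simp]: "g \<in> carrier G" "h \<in> carrier G" "m \<in> carrier G" "v \<in> carrier G"
    "k1 \<in> carrier G" "k2 \<in> carrier G" "k3 \<in> carrier G" by (simp_all add: ghm v_def k)
  have [simp]: "\<rho> k1 = \<one>\<^bsub>Q\<^esub>" "\<rho> k2 = \<one>\<^bsub>Q\<^esub>" "\<rho> k3 = \<one>\<^bsub>Q\<^esub>" "\<rho> v = \<one>\<^bsub>Q\<^esub>"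
    by (simp_all add: ghm v_def k Q.inv_mult_group Q.m_assoc)
  have moves: "k1 \<star> h = h \<star> k" "k2 \<star> g = g \<star> k1" "k3 \<star> m = m \<star> k" "v \<star> m = g \<star> h" "k2 \<star> v = v \<star> k3"
    by (simp_all add: ghm v_def k word_simps)
  have 1: "w k2 g (h \<star> y) = w g h y * w k2 (g \<star> h) y * w k2 g h / w (g \<star> k1) h y"
    using w_pentagon_K[of k2 g h y] by (simp add: field_simps moves)
  have 2: "w k1 h y = w (g \<star> k1) h y * w g k1 (h \<star> y) / (w g (h \<star> k) y * w g k1 h)"
    using w_pentagon_K[of g k1 h y] by (simp add: field_simps moves)
  have 3: "w h k y = w (g \<star> h) k y * w g h (k \<star> y) / (w g (h \<star> k) y * w g h k)"
    using w_pentagon_K[of g h k y] by (simp add: field_simps)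
  have 4: "w v m y = w (v \<star> k3) m y * w k2 v (m \<star> y) / (w k2 (g \<star> h) y * w k2 v m)"
    using w_pentagon_K[of k2 v m y] by (simp add: field_simps moves)
  have 5: "w k3 m y = w (v \<star> k3) m y * w v k3 (m \<star> y) / (w v (m \<star> k) y * w v k3 m)"
    using w_pentagon_K[of v k3 m y] by (simp add: field_simps moves)
  have 6: "w m k y = w (g \<star> h) k y * w v m (k \<star> y) / (w v (m \<star> k) y * w v m k)"
    using w_pentagon_K[of v m k y] by (simp add: field_simps moves)
  show ?thesis
    unfolding swap_scalar_def split_scalar_def X_scalar_def
    unfolding v_def[symmetric]
    unfolding ghm[symmetric] k[symmetric] 1 2 3 4 5 6
    by (simp add: field_simps)
qed

text \<open>
  The scalar of \<open>\<Omega> q r t\<close>, the value that the following lemma forces for \<open>y = 1\<close>.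
\<close>

definition Omega_scalar :: "'q \<Rightarrow> 'q \<Rightarrow> 'q \<Rightarrow> 'k" where
  "Omega_scalar q r t = w (conjugate (s q) (u r t)) (s q) (s (r \<bullet> t)) * w (u q r) (u (q \<bullet> r) t) (s (q \<bullet> r \<bullet> t)) *
       w (s q) (s r) (s t) /
     (w (s q) (u r t) (s (r \<bullet> t)) * w (conjugate (s q) (u r t)) (u q (r \<bullet> t)) (s (q \<bullet> r \<bullet> t)) *
       w (u q r) (s (q \<bullet> r)) (s t))"

text \<open>
  Both sides lead from a product with \<open>s (q r t) y\<close> to \<open>s q (s r (s t y))\<close>.  Five of the six pentagons
  that compare them have a corner in \<open>K\<close>.  The sixth is the one for \<open>s q, s r, s t, y\<close>; it is the
  only source of an anomaly, and its value depends on \<open>y\<close> through \<open>\<rho> y\<close>.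
\<close>

lemma split_scalar_split:
  assumes [simp]: "q \<in> carrier Q" "r \<in> carrier Q" "t \<in> carrier Q" "y \<in> carrier G"
  shows "\<pi> [q, r, t, \<rho> y] * (swap_scalar (s q) (u r t) (s (r \<bullet> t) \<star> y) * split_scalar r t y * split_scalar q (r \<bullet> t) y /
      w (conjugate (s q) (u r t)) (u q (r \<bullet> t)) (s (q \<bullet> r \<bullet> t) \<star> y)) =
    Omega_scalar q r t * (split_scalar q r (s t \<star> y) * split_scalar (q \<bullet> r) t y /
      w (u q r) (u (q \<bullet> r) t) (s (q \<bullet> r \<bullet> t) \<star> y))"
proof -
  define g h l m1 m2 m where ghm: "g = s q" "h = s r" "l = s t" "m1 = s (r \<bullet> t)" "m2 = s (q \<bullet> r)" "m = s (q \<bullet> (r \<bullet> t))"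
  define a where "a = u r t" define a' where "a' = conjugate g a"
  define v where "v = u q (r \<bullet> t)" define b where "b = u q r" define c where "c = m2 \<star> (l \<star> inv\<^bsub>G\<^esub> m)"
  have assoc: "q \<bullet> r \<bullet> t = q \<bullet> (r \<bullet> t)" by (simp add: Q.m_assoc)
  have [simp]: "g \<in> carrier G" "h \<in> carrier G" "l \<in> carrier G" "m1 \<in> carrier G" "m2 \<in> carrier G" "m \<in> carrier G"
      "a \<in> carrier G" "a' \<in> carrier G" "v \<in> carrier G" "b \<in> carrier G" "c \<in> carrier G"
    by (simp_all add: ghm a_def a'_def v_def b_def c_def)
  have [simp]: "\<rho> a = \<one>\<^bsub>Q\<^esub>" "\<rho> a' = \<one>\<^bsub>Q\<^esub>" "\<rho> v = \<one>\<^bsub>Q\<^esub>" "\<rho> b = \<one>\<^bsub>Q\<^esub>" "\<rho> c = \<one>\<^bsub>Q\<^esub>"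
    by (simp_all add: ghm a_def a'_def v_def b_def c_def Q.inv_mult_group Q.m_assoc)
  have \<rho>ghl: "\<rho> g = q" "\<rho> h = r" "\<rho> l = t" by (simp_all add: ghm)
  have moves: "a' \<star> g = g \<star> a" "a \<star> m1 = h \<star> l" "v \<star> m = g \<star> m1" "b \<star> m2 = g \<star> h" "c \<star> m = m2 \<star> l"
      "a' \<star> v = b \<star> c"
    by (simp_all add: ghm a_def a'_def v_def b_def c_def word_simps)
  have [simp]: "\<pi> [q, r, t, \<rho> y] \<noteq> 0" by simp
  have 1: "w g m1 y = w (g \<star> a) m1 y * w a' g (m1 \<star> y) / (w a' (g \<star> m1) y * w a' g m1)"
    using w_pentagon_K[of a' g m1 y] by (simp add: field_simps moves)
  have 2: "w a m1 y = w (g \<star> a) m1 y * w g a (m1 \<star> y) / (w g (h \<star> l) y * w g a m1)"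
    using w_pentagon_K[of g a m1 y] by (simp add: field_simps moves)
  have 3: "w v m y = w (b \<star> c) m y * w a' v (m \<star> y) / (w a' (g \<star> m1) y * w a' v m)"
    using w_pentagon_K[of a' v m y] by (simp add: field_simps moves)
  have 4: "w h l y = \<pi> [q, r, t, \<rho> y] * w (g \<star> h) l y * w g h (l \<star> y) / (w g (h \<star> l) y * w g h l)"
    using w_pentagon[of g h l y] by (simp add: field_simps moves \<rho>ghl)
  have 5: "w m2 l y = w (g \<star> h) l y * w b m2 (l \<star> y) / (w b (m2 \<star> l) y * w b m2 l)"
    using w_pentagon_K[of b m2 l y] by (simp add: field_simps moves)
  have 6: "w c m y = w (b \<star> c) m y * w b c (m \<star> y) / (w b (m2 \<star> l) y * w b c m)"
    using w_pentagon_K[of b c m y] by (simp add: field_simps moves)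
  show ?thesis
    unfolding swap_scalar_def split_scalar_def Omega_scalar_def assoc
    unfolding a_def[symmetric] v_def[symmetric] b_def[symmetric]
    unfolding ghm[symmetric] a'_def[symmetric] c_def[symmetric] 1 2 3 4 5 6
    by (simp add: field_simps)
qed

end

section \<open>Coherence in the crossed product\<close>

context action_of_extension
begin

text \<open>
  Conjugation by \<open>[I, s q]\<close>.  The monoidal structure uses that \<open>(g k g\<^sup>-\<^sup>1)\<^sub>* g\<^sub>*\<close> and \<open>g\<^sub>* k\<^sub>*\<close> are both
  isomorphic to \<open>(g k)\<^sub>*\<close>.
\<close>

definition F :: "'q \<Rightarrow> ('o \<times> 'g, 'm \<times> 'g \<times> 'g) mon_endofun" where
  "F q = (let g = s q in
     \<lparr>FO = (\<lambda>(V, k). (FO (act g) V, conjugate g k)),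
      FA = (\<lambda>(f, k, l). (FA (act g) f, conjugate g k, conjugate g l)),
      Psi = (\<lambda>(V, k) (W, l).
        (Scale C (Psi_scalar g k l)
          (Psi (act g) V (FO (act k) W) \<cdot>
           (\<iota> (FO (act g) V) \<boxtimes> (inv_arr C (\<chi> g k W) \<cdot> \<chi> (conjugate g k) g W))),
         conjugate g (k \<star> l), conjugate g (k \<star> l)))\<rparr>)"

text \<open>
  With \<open>g = s q\<close>, \<open>h = s r\<close> and \<open>m = s (q r)\<close>, both \<open>g\<^sub>* h\<^sub>*\<close> and \<open>(u q r)\<^sub>* m\<^sub>*\<close> are isomorphic to
  \<open>(g h)\<^sub>*\<close>.
\<close>

definition X :: "'q \<Rightarrow> 'q \<Rightarrow> ('o \<times> 'g) \<times> ('o \<times> 'g \<Rightarrow> 'm \<times> 'g \<times> 'g)" where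
  "X q r = ((Unit C, u q r), \<lambda>(V, k).
     (Scale C (X_scalar q r k) (inv_arr C (\<chi> (u q r) (s (q \<bullet> r)) V) \<cdot> \<chi> (s q) (s r) V),
      conjugate (s q) (conjugate (s r) k) \<star> u q r, conjugate (s q) (conjugate (s r) k) \<star> u q r))"

definition \<Omega> :: "'q \<Rightarrow> 'q \<Rightarrow> 'q \<Rightarrow> 'm \<times> 'g \<times> 'g" where
  "\<Omega> q r t = (Scale C (Omega_scalar q r t) (\<iota> (Unit C)),
     u q r \<star> u (q \<bullet> r) t, u q r \<star> u (q \<bullet> r) t)"

end

text \<open>
  Formal objects of \<open>D\<close>.  The objects \<open>U q r\<close> need a constructor of their own, since flattening them
  splits \<open>u q r s (q r)\<close> into \<open>s q s r\<close>.
\<close>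

datatype ('q, 'g, 'o) dtrm = DLeaf 'o 'g | DOne | DU 'q 'q
  | DTen "('q, 'g, 'o) dtrm" "('q, 'g, 'o) dtrm" | DF 'q "('q, 'g, 'o) dtrm"

context action_of_extension
begin

primrec dwf :: "('q, 'g, 'o) dtrm \<Rightarrow> bool" where
  "dwf (DLeaf V k) \<longleftrightarrow> V \<in> Obj C \<and> k \<in> carrier K"
| "dwf DOne \<longleftrightarrow> True"
| "dwf (DU q r) \<longleftrightarrow> q \<in> carrier Q \<and> r \<in> carrier Q"
| "dwf (DTen a b) \<longleftrightarrow> dwf a \<and> dwf b"
| "dwf (DF q a) \<longleftrightarrow> q \<in> carrier Q \<and> dwf a"

text \<open>
  Degree and underlying formal object of \<open>C\<close>; together they determine the object \<open>dev a\<close> of \<open>D\<close>.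
\<close>

primrec deg :: "('q, 'g, 'o) dtrm \<Rightarrow> 'g" where
  "deg (DLeaf V k) = k"
| "deg DOne = e"
| "deg (DU q r) = u q r"
| "deg (DTen a b) = deg a \<star> deg b"
| "deg (DF q a) = conjugate (s q) (deg a)"

primrec tm :: "('q, 'g, 'o) dtrm \<Rightarrow> ('g, 'o) trm" where
  "tm (DLeaf V k) = Leaf V"
| "tm DOne = One"
| "tm (DU q r) = One"
| "tm (DTen a b) = Ten (tm a) (Act (deg a) (tm b))"
| "tm (DF q a) = Act (s q) (tm a)"

text \<open>
  The scalar of flattening \<open>a\<close> in front of \<open>y\<close>.  A tensor product is flattened after rebracketing
  \<open>(a b) y \<rightarrow> a (b y)\<close>.  For \<open>F q a\<close> and \<open>U q r\<close> the element \<open>y\<close> is written as a product that starts with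
  \<open>s q\<close> and with \<open>s (q r)\<close>, respectively.
\<close>

primrec flat :: "('q, 'g, 'o) dtrm \<Rightarrow> 'g \<Rightarrow> 'k" where
  "flat (DLeaf V k) y = 1"
| "flat DOne y = 1"
| "flat (DU q r) y = split_scalar q r (inv\<^bsub>G\<^esub> s (q \<bullet> r) \<star> y)"
| "flat (DTen a b) y = flat a (deg b \<star> y) * flat b y / w (deg a) (deg b) y"
| "flat (DF q a) y = swap_scalar (s q) (deg a) (inv\<^bsub>G\<^esub> s q \<star> y) * flat a (inv\<^bsub>G\<^esub> s q \<star> y)"

definition dev :: "('q, 'g, 'o) dtrm \<Rightarrow> 'o \<times> 'g" where
  "dev a = (ev (tm a), deg a)"

lemma deg_closed:
  assumes "dwf a"
  shows "deg a \<in> carrier G" "\<rho> (deg a) = \<one>\<^bsub>Q\<^esub>"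
proof -
  have "deg a \<in> carrier G \<and> \<rho> (deg a) = \<one>\<^bsub>Q\<^esub>"
    using assms by (induction a) (auto simp: Q.inv_mult_group Q.m_assoc)
  then show "deg a \<in> carrier G" "\<rho> (deg a) = \<one>\<^bsub>Q\<^esub>" by auto
qed

declare deg_closed [simp]

lemma wf_trm_tm [simp]: "dwf a \<Longrightarrow> wf_trm (tm a)"
  by (induction a) auto

lemma dev_Obj [simp]: "dwf a \<Longrightarrow> dev a \<in> Obj D"
  by (simp add: dev_def)

lemma swap_scalar_nonzero [simp]:
  "g \<in> carrier G \<Longrightarrow> k \<in> carrier G \<Longrightarrow> y \<in> carrier G \<Longrightarrow> swap_scalar g k y \<noteq> 0"
  by (simp add: swap_scalar_def)

lemma split_scalar_nonzero [simp]:
  "q \<in> carrier Q \<Longrightarrow> r \<in> carrier Q \<Longrightarrow> y \<in> carrier G \<Longrightarrow> split_scalar q r y \<noteq> 0"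
  by (simp add: split_scalar_def)

lemma scalars_nonzero [simp]:
  "g \<in> carrier G \<Longrightarrow> k \<in> carrier G \<Longrightarrow> l \<in> carrier G \<Longrightarrow> Psi_scalar g k l \<noteq> 0"
  "q \<in> carrier Q \<Longrightarrow> r \<in> carrier Q \<Longrightarrow> k \<in> carrier G \<Longrightarrow> X_scalar q r k \<noteq> 0"
  "q \<in> carrier Q \<Longrightarrow> r \<in> carrier Q \<Longrightarrow> t \<in> carrier Q \<Longrightarrow> Omega_scalar q r t \<noteq> 0"
  by (simp_all add: Psi_scalar_def X_scalar_def Omega_scalar_def)

lemma flat_nonzero [simp]: "dwf a \<Longrightarrow> y \<in> carrier G \<Longrightarrow> flat a y \<noteq> 0"
  by (induction a arbitrary: y) auto

text \<open>
  Coherence at \<open>p\<close>.  Asking for all \<open>y\<close> over \<open>p\<close> makes the notion stable under tensor products, as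
  degrees lie in the kernel of \<open>\<rho>\<close>.  The functor \<open>F q\<close> carries coherence at \<open>q\<^sup>-\<^sup>1 p\<close> to coherence at
  \<open>p\<close>.  The dependence on \<open>p\<close> is what records the anomaly.
\<close>

definition dcoh :: "'q \<Rightarrow> ('q, 'g, 'o) dtrm \<Rightarrow> ('q, 'g, 'o) dtrm \<Rightarrow> 'm \<times> 'g \<times> 'g \<Rightarrow> bool" where
  "dcoh p a b f \<longleftrightarrow> dwf a \<and> dwf b \<and> deg a = deg b \<and>
     (\<exists>c \<phi>. f = (Scale C c \<phi>, deg a, deg a) \<and> coherent (tm a) (tm b) \<phi> \<and>
        (\<forall>y \<in> carrier G. \<rho> y = p \<longrightarrow> flat a y = c * flat b y))"

lemma dcohE:
  assumes "dcoh p a b f"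
  obtains c \<phi> where "dwf a" "dwf b" "deg a = deg b" "f = (Scale C c \<phi>, deg a, deg a)"
    "coherent (tm a) (tm b) \<phi>" "\<And>y. y \<in> carrier G \<Longrightarrow> \<rho> y = p \<Longrightarrow> flat a y = c * flat b y"
  using assms unfolding dcoh_def by metis

lemma dcohI:
  assumes "dwf a" "dwf b" "deg a = deg b" "f = (Scale C c \<phi>, deg a, deg a)"
    "coherent (tm a) (tm b) \<phi>" "\<And>y. y \<in> carrier G \<Longrightarrow> \<rho> y = p \<Longrightarrow> flat a y = c * flat b y"
  shows "dcoh p a b f"
  using assms unfolding dcoh_def by blast

theorem dcoh_unique:
  assumes "p \<in> carrier Q" "dcoh p a b f" "dcoh p a b f'"
  shows "f = f'"
proof -
  obtain c \<phi> where f: "dwf a" "dwf b" "f = (Scale C c \<phi>, deg a, deg a)"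
      "coherent (tm a) (tm b) \<phi>" "flat a (s p) = c * flat b (s p)"
    using assms(2) by (rule dcohE) (use assms(1) in auto)
  obtain c' \<phi>' where f': "f' = (Scale C c' \<phi>', deg a, deg a)"
      "coherent (tm a) (tm b) \<phi>'" "flat a (s p) = c' * flat b (s p)"
    using assms(3) by (rule dcohE) (use assms(1) in auto)
  have "c = c'" using f(2,5) f'(3) assms(1) by simp
  moreover have "\<phi> = \<phi>'" using f(4) f'(2) by (rule coherent_unique)
  ultimately show ?thesis using f(3) f'(1) by simp
qed

lemma dcoh_Iso:
  assumes "p \<in> carrier Q" "dcoh p a b f"
  shows "f \<in> Iso D (dev a) (dev b)" "dcoh p b a (inv_arr D f)"
proof -
  obtain c \<phi> where f: "dwf a" "dwf b" "deg a = deg b" "f = (Scale C c \<phi>, deg a, deg a)"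
      "coherent (tm a) (tm b) \<phi>" "\<And>y. y \<in> carrier G \<Longrightarrow> \<rho> y = p \<Longrightarrow> flat a y = c * flat b y"
    using assms(2) by (rule dcohE) auto
  have "flat a (s p) \<noteq> 0" using f(1) assms(1) by simp
  moreover have "flat a (s p) = c * flat b (s p)" using assms(1) by (intro f(6)) simp_all
  ultimately have c: "c \<noteq> 0" by auto
  note \<phi> = coherent_invertible[OF f(5)] coherentD[OF f(5)]
  show "f \<in> Iso D (dev a) (dev b)"
    unfolding f(4) by (rule K.Iso_CP) (use c f(1-3) \<phi> in \<open>simp_all add: dev_def\<close>)
  have "inv_arr D f = (inv_arr C (Scale C c \<phi>), deg a, deg a)"
    unfolding f(4) by (rule D.inv_arr_eq[OF K.inverse_arrows_CP]) (use c f(1) \<phi> in simp_all)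
  then show "dcoh p b a (inv_arr D f)"
    using f(1-3,6) c \<phi>(1) coherent_inv_arr[OF f(5)]
    by (intro dcohI[where c = "inverse c" and \<phi> = "inv_arr C \<phi>"]) simp_all
qed

lemma dcoh_Cmp:
  assumes "dcoh p a b f" "dcoh p b c h"
  shows "dcoh p a c (Cmp D h f)"
proof -
  obtain i \<phi> where f: "dwf a" "dwf b" "deg a = deg b" "f = (Scale C i \<phi>, deg a, deg a)"
      "coherent (tm a) (tm b) \<phi>" "\<And>y. y \<in> carrier G \<Longrightarrow> \<rho> y = p \<Longrightarrow> flat a y = i * flat b y"
    using assms(1) by (rule dcohE) auto
  obtain j \<psi> where h: "dwf c" "deg b = deg c" "h = (Scale C j \<psi>, deg b, deg b)"
      "coherent (tm b) (tm c) \<psi>" "\<And>y. y \<in> carrier G \<Longrightarrow> \<rho> y = p \<Longrightarrow> flat b y = j * flat c y"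
    using assms(2) by (rule dcohE) auto
  show ?thesis
    using f h coherentD[OF f(5)] coherentD[OF h(4)] coherent_Cmp[OF f(5) h(4)]
    by (intro dcohI[where c = "i * j" and \<phi> = "\<psi> \<cdot> \<phi>"]) simp_all
qed

lemma dcoh_TensA:
  assumes "dcoh p a b f" "dcoh p a' b' h"
  shows "dcoh p (DTen a a') (DTen b b') (TensA D f h)"
proof -
  obtain i \<phi> where f: "dwf a" "dwf b" "deg a = deg b" "f = (Scale C i \<phi>, deg a, deg a)"
      "coherent (tm a) (tm b) \<phi>" "\<And>y. y \<in> carrier G \<Longrightarrow> \<rho> y = p \<Longrightarrow> flat a y = i * flat b y"
    using assms(1) by (rule dcohE) auto
  obtain j \<psi> where h: "dwf a'" "dwf b'" "deg a' = deg b'" "h = (Scale C j \<psi>, deg a', deg a')"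
      "coherent (tm a') (tm b') \<psi>" "\<And>y. y \<in> carrier G \<Longrightarrow> \<rho> y = p \<Longrightarrow> flat a' y = j * flat b' y"
    using assms(2) by (rule dcohE) auto
  have flat: "flat (DTen a a') y = j * i * flat (DTen b b') y"
    if y: "y \<in> carrier G" "\<rho> y = p" for y
  proof -
    have "\<rho> (deg a' \<star> y) = \<rho> y" using h(1) y(1) by simp
    then have "flat a (deg a' \<star> y) = i * flat b (deg a' \<star> y)" using h(1) y by (intro f(6)) simp_all
    then show ?thesis using f(3) h(3) h(6)[OF y] by simp
  qed
  show ?thesis
    by (rule dcohI[where c = "j * i" and \<phi> = "\<phi> \<boxtimes> FA (act (deg a)) \<psi>", OF _ _ _ _ _ flat])
      (use f(1-5) h(1-5) coherentD(3)[OF f(5)] coherentD(3)[OF h(5)]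
        coherent_Ten[OF f(5) coherent_Act[OF h(5), of "deg a"]] in simp_all)
qed

lemma F_simps [simp]:
  "FO (F q) (V, k) = (FO (act (s q)) V, conjugate (s q) k)"
  "FA (F q) (f, k, l) = (FA (act (s q)) f, conjugate (s q) k, conjugate (s q) l)"
  "Psi (F q) (V, k) (W, l) =
     (Scale C (Psi_scalar (s q) k l)
       (Psi (act (s q)) V (FO (act k) W) \<cdot>
        (\<iota> (FO (act (s q)) V) \<boxtimes> (inv_arr C (\<chi> (s q) k W) \<cdot> \<chi> (conjugate (s q) k) (s q) W))),
      conjugate (s q) (k \<star> l), conjugate (s q) (k \<star> l))"
  by (simp_all add: F_def Let_def)

lemma dcoh_FA:
  assumes "dcoh (inv\<^bsub>Q\<^esub> q \<bullet> p) a b f" "q \<in> carrier Q" "p \<in> carrier Q"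
  shows "dcoh p (DF q a) (DF q b) (FA (F q) f)"
proof -
  obtain c \<phi> where f: "dwf a" "dwf b" "deg a = deg b" "f = (Scale C c \<phi>, deg a, deg a)"
      "coherent (tm a) (tm b) \<phi>"
      "\<And>y. y \<in> carrier G \<Longrightarrow> \<rho> y = inv\<^bsub>Q\<^esub> q \<bullet> p \<Longrightarrow> flat a y = c * flat b y"
    using assms(1) by (rule dcohE) auto
  show ?thesis
    using f assms(2) coherentD[OF f(5)] coherent_Act[OF f(5), of "s q"]
    by (intro dcohI[where c = c and \<phi> = "FA (act (s q)) \<phi>"]) simp_all
qed

lemma dcoh_identity:
  assumes "dwf a" "dwf b" "deg a = deg b" "coherent (tm a) (tm b) (\<iota> (ev (tm a)))"
    "\<And>y. y \<in> carrier G \<Longrightarrow> flat a y = flat b y"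
  shows "dcoh p a b (Idn D (dev a))"
  using assms by (intro dcohI[where c = 1 and \<phi> = "\<iota> (ev (tm a))"]) (simp_all add: dev_def)

lemma dcoh_Idn: "dwf a \<Longrightarrow> dcoh p a a (Idn D (dev a))"
  by (intro dcoh_identity) (simp_all add: coherent_Idn)

lemma dcoh_Assoc:
  assumes [simp]: "dwf a" "dwf b" "dwf c"
  shows "dcoh p (DTen a (DTen b c)) (DTen (DTen a b) c) (Assoc D (dev a) (dev b) (dev c))"
proof (rule dcohI)
  show "Assoc D (dev a) (dev b) (dev c) = (Scale C (w (deg a) (deg b) (deg c))
      (crossed_assoc (deg a) (deg b) (ev (tm a)) (ev (tm b)) (ev (tm c))),
      deg (DTen a (DTen b c)), deg (DTen a (DTen b c)))"
    by (simp add: dev_def word_simps)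
  show "coherent (tm (DTen a (DTen b c))) (tm (DTen (DTen a b) c))
      (crossed_assoc (deg a) (deg b) (ev (tm a)) (ev (tm b)) (ev (tm c)))"
    using coherent_crossed_assoc by simp
  fix y assume y: "y \<in> carrier G"
  have "w (deg b) (deg c) y = w (deg a \<star> deg b) (deg c) y * w (deg a) (deg b) (deg c \<star> y) /
      (w (deg a) (deg b \<star> deg c) y * w (deg a) (deg b) (deg c))"
    using w_pentagon_K[of "deg a" "deg b" "deg c" y] y by (simp add: field_simps)
  then show "flat (DTen a (DTen b c)) y = w (deg a) (deg b) (deg c) * flat (DTen (DTen a b) c) y"
    using y by (simp add: word_simps field_simps)
qed (simp_all add: word_simps)

lemma dcoh_Psi:
  assumes [simp]: "dwf a" "dwf b" "q \<in> carrier Q"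
  shows "dcoh p (DTen (DF q a) (DF q b)) (DF q (DTen a b)) (Psi (F q) (dev a) (dev b))"
proof (rule dcohI)
  let ?g = "s q" let ?k = "deg a"
  let ?\<phi> = "Psi (act ?g) (ev (tm a)) (FO (act ?k) (ev (tm b))) \<cdot>
    (\<iota> (FO (act ?g) (ev (tm a))) \<boxtimes> (inv_arr C (\<chi> ?g ?k (ev (tm b))) \<cdot> \<chi> (conjugate ?g ?k) ?g (ev (tm b))))"
  show "Psi (F q) (dev a) (dev b) = (Scale C (Psi_scalar ?g (deg a) (deg b)) ?\<phi>,
      deg (DTen (DF q a) (DF q b)), deg (DTen (DF q a) (DF q b)))"
    by (simp add: dev_def word_simps)
  have "coherent (Act (conjugate ?g ?k) (Act ?g (tm b))) (Act (?g \<star> ?k) (tm b)) (\<chi> (conjugate ?g ?k) ?g (ev (tm b)))"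
    using coherent_\<chi>[of "tm b" "conjugate ?g ?k" ?g] by (simp add: word_simps)
  note coherent_Cmp[OF this coherent_inv_arr[OF coherent_\<chi>]]
  note coherent_Ten[OF coherent_Idn[of "Act ?g (tm a)"] this]
  note coherent_Cmp[OF this coherent_Psi[of "tm a" "Act ?k (tm b)" ?g, simplified]]
  then show "coherent (tm (DTen (DF q a) (DF q b))) (tm (DF q (DTen a b))) ?\<phi>"
    by simp
  fix y assume y: "y \<in> carrier G"
  show "flat (DTen (DF q a) (DF q b)) y = Psi_scalar ?g (deg a) (deg b) * flat (DF q (DTen a b)) y"
    using swap_scalar_mult[of ?g "deg a" "deg b" "inv\<^bsub>G\<^esub> ?g \<star> y"] y by (simp add: word_simps field_simps)
qed (simp_all add: word_simps)

lemma dcoh_X: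
  assumes [simp]: "dwf a" "q \<in> carrier Q" "r \<in> carrier Q"
  shows "dcoh p (DTen (DF q (DF r a)) (DU q r)) (DTen (DU q r) (DF (q \<bullet> r) a)) (snd (X q r) (dev a))"
proof (rule dcohI)
  let ?V = "ev (tm a)" let ?m = "s (q \<bullet> r)" let ?v = "u q r"
  let ?\<phi> = "inv_arr C (\<chi> ?v ?m ?V) \<cdot> \<chi> (s q) (s r) ?V"
  show "snd (X q r) (dev a) = (Scale C (X_scalar q r (deg a)) ?\<phi>,
      deg (DTen (DF q (DF r a)) (DU q r)), deg (DTen (DF q (DF r a)) (DU q r)))"
    by (simp add: dev_def X_def)
  let ?k = "conjugate (s q) (conjugate (s r) (deg a))"
  have 1: "coherent (Ten (Act (s q) (Act (s r) (tm a))) (Act ?k One)) (Act (s q) (Act (s r) (tm a)))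
      (\<iota> (FO (act (s q)) (FO (act (s r)) ?V)))"
    using coherent_Cmp[OF coherent_Ten[OF coherent_Idn coherent_Act_One[of ?k]] coherent_Ten_One,
        of "Act (s q) (Act (s r) (tm a))"] by simp
  have 2: "coherent (Act (s q) (Act (s r) (tm a))) (Act (?v \<star> ?m) (tm a)) (\<chi> (s q) (s r) ?V)"
    using coherent_\<chi>[of "tm a" "s q" "s r"] by (simp add: word_simps)
  have 3: "coherent (Act (?v \<star> ?m) (tm a)) (Act ?v (Act ?m (tm a))) (inv_arr C (\<chi> ?v ?m ?V))"
    by (rule coherent_inv_arr[OF coherent_\<chi>]) simp_all
  have 4: "coherent (Act ?v (Act ?m (tm a))) (Ten One (Act ?v (Act ?m (tm a))))
      (\<iota> (FO (act ?v) (FO (act ?m) ?V)))"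
    using coherent_inv_arr[OF coherent_One_Ten[of "Act ?v (Act ?m (tm a))"]] by simp
  show "coherent (tm (DTen (DF q (DF r a)) (DU q r))) (tm (DTen (DU q r) (DF (q \<bullet> r) a))) ?\<phi>"
    using coherent_Cmp[OF coherent_Cmp[OF coherent_Cmp[OF 1 2] 3] 4] coherentD[OF 2] coherentD[OF 3]
    by simp
  fix y assume y: "y \<in> carrier G"
  show "flat (DTen (DF q (DF r a)) (DU q r)) y =
      X_scalar q r (deg a) * flat (DTen (DU q r) (DF (q \<bullet> r) a)) y"
    using swap_scalar_split[of q r "deg a" "inv\<^bsub>G\<^esub> ?m \<star> y"] y by (simp add: word_simps field_simps)
qed (simp_all add: word_simps)

text \<open>
  The elements over \<open>q r t v\<close> are those of the form \<open>s (q r t) y\<close> with \<open>y\<close> over \<open>v\<close>, so that the anomaly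
  of the scalars is \<open>\<pi>(q, r, t, v)\<close> for all of them.
\<close>

lemma dcoh_\<Omega>:
  assumes [simp]: "q \<in> carrier Q" "r \<in> carrier Q" "t \<in> carrier Q" "v \<in> carrier Q"
  shows "dcoh (q \<bullet> (r \<bullet> (t \<bullet> v))) (DTen (DF q (DU r t)) (DU q (r \<bullet> t))) (DTen (DU q r) (DU (q \<bullet> r) t))
    (Scale D (inverse (\<pi> [q, r, t, v])) (\<Omega> q r t))"
proof (rule dcohI)
  have deg: "u q r \<star> u (q \<bullet> r) t = deg (DTen (DF q (DU r t)) (DU q (r \<bullet> t)))"
    by (simp add: word_simps)
  show "Scale D (inverse (\<pi> [q, r, t, v])) (\<Omega> q r t) =
      (Scale C (inverse (\<pi> [q, r, t, v]) * Omega_scalar q r t) (\<iota> (Unit C)),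
       deg (DTen (DF q (DU r t)) (DU q (r \<bullet> t))), deg (DTen (DF q (DU r t)) (DU q (r \<bullet> t))))"
    unfolding \<Omega>_def deg by simp
  have 1: "coherent (Ten (Act (s q) One) (Act (conjugate (s q) (u r t)) One)) (Ten One One) (\<iota> (Unit C))"
    using coherent_Ten[OF coherent_Act_One[of "s q"] coherent_Act_One[of "conjugate (s q) (u r t)"]] by simp
  have 2: "coherent (Ten One One) (Ten One (Act (u q r) One)) (\<iota> (Unit C))"
    using coherent_Ten[OF coherent_Idn[of One] coherent_inv_arr[OF coherent_Act_One[of "u q r"]]] by simp
  show "coherent (tm (DTen (DF q (DU r t)) (DU q (r \<bullet> t)))) (tm (DTen (DU q r) (DU (q \<bullet> r) t))) (\<iota> (Unit C))"
    using coherent_Cmp[OF 1 2] by simp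
  fix y assume y: "y \<in> carrier G" "\<rho> y = q \<bullet> (r \<bullet> (t \<bullet> v))"
  then have "\<rho> (inv\<^bsub>G\<^esub> s (q \<bullet> r \<bullet> t) \<star> y) = v" by (simp add: word_simps)
  then show "flat (DTen (DF q (DU r t)) (DU q (r \<bullet> t))) y =
      inverse (\<pi> [q, r, t, v]) * Omega_scalar q r t * flat (DTen (DU q r) (DU (q \<bullet> r) t)) y"
    using split_scalar_split[of q r t "inv\<^bsub>G\<^esub> s (q \<bullet> r \<bullet> t) \<star> y"] y by (simp add: word_simps field_simps)
qed (simp_all add: word_simps)

end

section \<open>The anomalous action\<close>

context action_of_extension
begin

text \<open>
  Statements about objects of \<open>D\<close> can be proved for formal objects, the general object being a leaf.
\<close>

lemma reify:
  assumes "V \<in> Obj D"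
  obtains a where "dwf a" "V = dev a"
proof -
  obtain V' k where "V = (V', k)" by (cases V)
  then have "dwf (DLeaf V' k)" "V = dev (DLeaf V' k)" using assms by (simp_all add: dev_def)
  then show ?thesis by (rule that)
qed

lemma dev_fold:
  "FO (F q) (dev a) = dev (DF q a)"
  "TensO D (dev a) (dev b) = dev (DTen a b)"
  "Unit D = dev DOne"
  "fst (X q r) = dev (DU q r)"
  by (simp_all add: dev_def X_def)

lemma comp_mon_sel:
  "FO (comp_mon D H H') V = FO H (FO H' V)"
  "FA (comp_mon D H H') f = FA H (FA H' f)"
  "Psi (comp_mon D H H') V W = Cmp D (FA H (Psi H' V W)) (Psi H (FO H' V) (FO H' W))"
  by (simp_all add: comp_mon_def)

lemma dcoh_generators:
  "V = dev a \<Longrightarrow> dwf a \<Longrightarrow> dcoh p a a (Idn D V)"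
  "V = dev a \<Longrightarrow> W = dev b \<Longrightarrow> Z = dev c \<Longrightarrow> dwf a \<Longrightarrow> dwf b \<Longrightarrow> dwf c \<Longrightarrow>
     dcoh p (DTen a (DTen b c)) (DTen (DTen a b) c) (Assoc D V W Z)"
  "V = dev a \<Longrightarrow> W = dev b \<Longrightarrow> dwf a \<Longrightarrow> dwf b \<Longrightarrow> q \<in> carrier Q \<Longrightarrow>
     dcoh p (DTen (DF q a) (DF q b)) (DF q (DTen a b)) (Psi (F q) V W)"
  "V = dev a \<Longrightarrow> dwf a \<Longrightarrow> q \<in> carrier Q \<Longrightarrow> r \<in> carrier Q \<Longrightarrow>
     dcoh p (DTen (DF q (DF r a)) (DU q r)) (DTen (DU q r) (DF (q \<bullet> r) a)) (snd (X q r) V)"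
  using dcoh_Idn dcoh_Assoc dcoh_Psi dcoh_X by simp_all

lemma dcoh_inverse_generators:
  "V = dev a \<Longrightarrow> W = dev b \<Longrightarrow> Z = dev c \<Longrightarrow> dwf a \<Longrightarrow> dwf b \<Longrightarrow> dwf c \<Longrightarrow> p \<in> carrier Q \<Longrightarrow>
     dcoh p (DTen (DTen a b) c) (DTen a (DTen b c)) (inv_arr D (Assoc D V W Z))"
  "V = dev a \<Longrightarrow> W = dev b \<Longrightarrow> dwf a \<Longrightarrow> dwf b \<Longrightarrow> q \<in> carrier Q \<Longrightarrow> p \<in> carrier Q \<Longrightarrow>
     dcoh p (DF q (DTen a b)) (DTen (DF q a) (DF q b)) (inv_arr D (Psi (F q) V W))"
  by (rule dcoh_Iso(2)[OF _ dcoh_generators(2)]; assumption)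
    (rule dcoh_Iso(2)[OF _ dcoh_generators(3)]; assumption)

text \<open>
  Resolution with these rules, guided by the shape of an arrow and starting at its domain, computes the
  formal codomain and proves coherence.
\<close>

lemmas dcoh_rules = dcoh_Cmp dcoh_TensA dcoh_FA dcoh_generators dcoh_inverse_generators

lemma is_functor_F: "q \<in> carrier Q \<Longrightarrow> is_functor D (F q)"
  by (auto simp: is_functor_def K.Hom_CP)

lemma F_Arr:
  assumes "q \<in> carrier Q" "z \<in> Arr D"
  shows "FA (F q) z \<in> Arr D" "Dom D (FA (F q) z) = FO (F q) (Dom D z)"
    "Cod D (FA (F q) z) = FO (F q) (Cod D z)"
proof -
  have "\<forall>A B. \<forall>z \<in> Hom D A B. FA (F q) z \<in> Hom D (FO (F q) A) (FO (F q) B)"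
    using is_functor_F[OF assms(1)] unfolding is_functor_def by blast
  moreover have "z \<in> Hom D (Dom D z) (Cod D z)" using assms(2) by (simp only: D.Hom_iff simp_thms)
  ultimately have "FA (F q) z \<in> Hom D (FO (F q) (Dom D z)) (FO (F q) (Cod D z))" by blast
  then show "FA (F q) z \<in> Arr D" "Dom D (FA (F q) z) = FO (F q) (Dom D z)"
    "Cod D (FA (F q) z) = FO (F q) (Cod D z)"
    by (simp_all only: D.Hom_iff)
qed

text \<open>
  Within the summands this is the naturality of \<open>\<chi>\<close> and of \<open>\<psi>\<close>; between different summands both sides
  are null.
\<close>

lemma Psi_F_nat:
  assumes x: "x \<in> Arr D" "y \<in> Arr D" and q: "q \<in> carrier Q"
  shows "Cmp D (Psi (F q) (Cod D x) (Cod D y)) (TensA D (FA (F q) x) (FA (F q) y)) =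
    Cmp D (FA (F q) (TensA D x y)) (Psi (F q) (Dom D x) (Dom D y))" (is "?L = ?R")
proof -
  obtain f k k' h l l' where xy: "x = (f, k, k')" "y = (h, l, l')" by (cases x; cases y)
  have g: "s q \<in> carrier G" using q by simp
  show ?thesis
  proof (cases "k = k' \<and> l = l'")
    case True
    then have fh: "f \<in> Arr C" "h \<in> Arr C" "k \<in> carrier G" "l \<in> carrier G" "\<rho> k = \<one>\<^bsub>Q\<^esub>" "\<rho> l = \<one>\<^bsub>Q\<^esub>"
      using x by (simp_all add: xy)
    let ?g = "s q" let ?k = "conjugate (s q) k"
    have n1: "inv_arr C (\<chi> ?g k (Cod C h)) \<cdot> FA (act (?g \<star> k)) h =
        FA (act ?g) (FA (act k) h) \<cdot> inv_arr C (\<chi> ?g k (Dom C h))"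
      using inv_arr_natural[OF \<chi>_nat[OF g fh(3,2)]] g fh by simp
    have n2: "\<chi> ?k ?g (Cod C h) \<cdot> FA (act ?k) (FA (act ?g) h) = FA (act (?g \<star> k)) h \<cdot> \<chi> ?k ?g (Dom C h)"
      using \<chi>_nat[of ?k ?g h] g fh by (simp add: word_simps)
    have n3: "Psi (act ?g) (Cod C f) (FO (act k) (Cod C h)) \<cdot> (FA (act ?g) f \<boxtimes> FA (act ?g) (FA (act k) h)) =
        FA (act ?g) (f \<boxtimes> FA (act k) h) \<cdot> Psi (act ?g) (Dom C f) (FO (act k) (Dom C h))"
      using Psi_nat[OF g fh(1), of "FA (act k) h"] fh by simp
    have "(Psi (act ?g) (Cod C f) (FO (act k) (Cod C h)) \<cdot> (\<iota> (FO (act ?g) (Cod C f)) \<boxtimes>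
          (inv_arr C (\<chi> ?g k (Cod C h)) \<cdot> \<chi> ?k ?g (Cod C h)))) \<cdot>
          (FA (act ?g) f \<boxtimes> FA (act ?k) (FA (act ?g) h)) =
        Psi (act ?g) (Cod C f) (FO (act k) (Cod C h)) \<cdot>
          (FA (act ?g) f \<boxtimes> (inv_arr C (\<chi> ?g k (Cod C h)) \<cdot> \<chi> ?k ?g (Cod C h) \<cdot> FA (act ?k) (FA (act ?g) h)))"
      using fh g by (simp add: word_simps)
    also have "\<dots> = Psi (act ?g) (Cod C f) (FO (act k) (Cod C h)) \<cdot>
          (FA (act ?g) f \<boxtimes> (FA (act ?g) (FA (act k) h) \<cdot> inv_arr C (\<chi> ?g k (Dom C h)) \<cdot> \<chi> ?k ?g (Dom C h)))"
      unfolding n2 using fh g reassoc[OF n1, of "\<chi> ?k ?g (Dom C h)"] by (simp add: word_simps)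
    also have "\<dots> = (Psi (act ?g) (Cod C f) (FO (act k) (Cod C h)) \<cdot>
          (FA (act ?g) f \<boxtimes> FA (act ?g) (FA (act k) h))) \<cdot>
          (\<iota> (FO (act ?g) (Dom C f)) \<boxtimes> (inv_arr C (\<chi> ?g k (Dom C h)) \<cdot> \<chi> ?k ?g (Dom C h)))"
      using fh g by (simp add: word_simps)
    also have "\<dots> = FA (act ?g) (f \<boxtimes> FA (act k) h) \<cdot> Psi (act ?g) (Dom C f) (FO (act k) (Dom C h)) \<cdot>
          (\<iota> (FO (act ?g) (Dom C f)) \<boxtimes> (inv_arr C (\<chi> ?g k (Dom C h)) \<cdot> \<chi> ?k ?g (Dom C h)))"
      unfolding n3 using fh g by (simp add: word_simps)
    finally show ?thesis
      using True fh g by (simp add: xy word_simps)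
  next
    case False
    then have null: "K.null x \<or> K.null y"
      using x K.null_off_diagonal unfolding xy by blast
    have F_null: "K.null (FA (F q) z)" if "K.null z" "z \<in> Arr D" for z
      by (rule K.nullE[OF that]) (use g in \<open>simp add: K.null_def\<close>)
    have P: "Psi (F q) A B \<in> Arr D \<and> Dom D (Psi (F q) A B) = TensO D (FO (F q) A) (FO (F q) B) \<and>
        Cod D (Psi (F q) A B) = FO (F q) (TensO D A B)" if "A \<in> Obj D" "B \<in> Obj D" for A B
      using that g by (auto simp: word_simps)
    note T = K.TensA_CP_Arr x F_Arr[OF q] P
    have "K.null (TensA D (FA (F q) x) (FA (F q) y))" "K.null (FA (F q) (TensA D x y))"
      using null F_null K.null_TensA_left K.null_TensA_right T by metis+
    then have "K.null ?L" "K.null ?R"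
      by (simp_all add: K.null_Cmp_left K.null_Cmp_right T del: K.CP_simps(1))
    then show ?thesis by (rule K.null_eqI) (simp_all add: T del: K.CP_simps(1))
  qed
qed

lemma mon_autoequiv_F:
  assumes q: "q \<in> carrier Q"
  shows "mon_autoequiv D (F q)"
proof -
  let ?g = "s q"
  have g: "?g \<in> carrier G" using q by simp
  have linear: "is_linear D (F q)"
    using q g by (auto simp: is_linear_def K.Hom_CP act_Add[unfolded Hom_iff])
  let ?H = "\<lparr>FO = \<lambda>(V, k). (FO (act (inv\<^bsub>G\<^esub> ?g)) V, conjugate (inv\<^bsub>G\<^esub> ?g) k),
    FA = \<lambda>(f, k, l). (FA (act (inv\<^bsub>G\<^esub> ?g)) f, conjugate (inv\<^bsub>G\<^esub> ?g) k, conjugate (inv\<^bsub>G\<^esub> ?g) l)\<rparr>"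
  have "is_functor D ?H"
    using q g by (auto simp: is_functor_def K.Hom_CP)
  moreover have "nat_iso D (comp_fun (F q) ?H) id_fun (\<lambda>(V, k). (\<chi> ?g (inv\<^bsub>G\<^esub> ?g) V, k, k))"
    using q g \<chi>_nat[of ?g "inv\<^bsub>G\<^esub> ?g"]
    by (auto simp: nat_iso_def comp_fun_def id_fun_def K.Hom_CP word_simps intro!: K.Iso_CP)
  moreover have "nat_iso D (comp_fun ?H (F q)) id_fun (\<lambda>(V, k). (\<chi> (inv\<^bsub>G\<^esub> ?g) ?g V, k, k))"
    using q g \<chi>_nat[of "inv\<^bsub>G\<^esub> ?g" ?g]
    by (auto simp: nat_iso_def comp_fun_def id_fun_def K.Hom_CP word_simps intro!: K.Iso_CP)
  \<comment> \<open>The inverse is conjugation by \<open>(s q)\<^sup>-\<^sup>1\<close>, with \<open>\<chi>\<close> as unit and counit.\<close>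
  ultimately have equivalence: "is_equivalence D (F q)"
    unfolding is_equivalence_def by blast
  have unit: "FO (F q) (Unit D) = Unit D" using g by simp
  have Psi_Iso: "Psi (F q) V W \<in> Iso D (TensO D (FO (F q) V) (FO (F q) W)) (FO (F q) (TensO D V W))"
    if VW: "V \<in> Obj D" "W \<in> Obj D" for V W
  proof -
    obtain a b where "dwf a" "V = dev a" "dwf b" "W = dev b" using VW reify by metis
    then show ?thesis using dcoh_Iso(1)[OF Q.one_closed dcoh_Psi] q by (simp only: dev_fold)
  qed
  have hexagon: "Cmp D (FA (F q) (Assoc D V W Z)) (Cmp D (Psi (F q) V (TensO D W Z))
        (TensA D (Idn D (FO (F q) V)) (Psi (F q) W Z))) =
      Cmp D (Psi (F q) (TensO D V W) Z) (Cmp D (TensA D (Psi (F q) V W) (Idn D (FO (F q) Z)))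
        (Assoc D (FO (F q) V) (FO (F q) W) (FO (F q) Z)))"
    if VWZ: "V \<in> Obj D" "W \<in> Obj D" "Z \<in> Obj D" for V W Z
  proof -
    obtain a b c where abc: "dwf a" "V = dev a" "dwf b" "W = dev b" "dwf c" "Z = dev c"
      using VWZ reify by metis
    show ?thesis
      by (rule dcoh_unique[of "\<one>\<^bsub>Q\<^esub>" "DTen (DF q a) (DTen (DF q b) (DF q c))"
            "DF q (DTen (DTen a b) c)"])
        (rule dcoh_rules | (simp add: abc q dev_fold del: K.CP_simps F_simps; fail))+
  qed
  have Psi_unit: "Psi (F q) V (Unit D) = Idn D (FO (F q) V) \<and> Psi (F q) (Unit D) V = Idn D (FO (F q) V)"
    if "V \<in> Obj D" for V
    using that g by (auto simp: Psi_scalar_def)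
  have nat: "Cmp D (Psi (F q) V' W') (TensA D (FA (F q) f) (FA (F q) h)) =
      Cmp D (FA (F q) (TensA D f h)) (Psi (F q) V W)"
    if "f \<in> Hom D V V'" "h \<in> Hom D W W'" for V V' W W' f h
    using that Psi_F_nat[OF _ _ q, of f h] by (metis D.Hom_iff)
  show ?thesis
    unfolding mon_autoequiv_def
    using is_functor_F[OF q] linear equivalence unit Psi_Iso hexagon Psi_unit nat by blast
qed

text \<open>
  Within the summands this is the naturality of \<open>\<chi>\<close>; between different summands both sides are null.
\<close>

lemma X_nat:
  assumes q: "q \<in> carrier Q" "r \<in> carrier Q" and x: "x \<in> Arr D"
  shows "Cmp D (snd (X q r) (Cod D x)) (TensA D (FA (F q) (FA (F r) x)) (Idn D (fst (X q r)))) =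
    Cmp D (TensA D (Idn D (fst (X q r))) (FA (F (q \<bullet> r)) x)) (snd (X q r) (Dom D x))" (is "?L = ?R")
proof -
  obtain f k k' where xf: "x = (f, k, k')" by (cases x)
  show ?thesis
  proof (cases "k = k'")
    case True
    then have f: "f \<in> Arr C" "k \<in> carrier G" "\<rho> k = \<one>\<^bsub>Q\<^esub>" using x by (simp_all add: xf)
    let ?g = "s q" let ?h = "s r" let ?m = "s (q \<bullet> r)" let ?v = "u q r"
    have n1: "\<chi> ?g ?h (Cod C f) \<cdot> FA (act ?g) (FA (act ?h) f) = FA (act (?g \<star> ?h)) f \<cdot> \<chi> ?g ?h (Dom C f)"
      using \<chi>_nat[of ?g ?h f] q f by simp
    have n2: "inv_arr C (\<chi> ?v ?m (Cod C f)) \<cdot> FA (act (?g \<star> ?h)) f =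
        FA (act ?v) (FA (act ?m) f) \<cdot> inv_arr C (\<chi> ?v ?m (Dom C f))"
      using inv_arr_natural[OF \<chi>_nat[of ?v ?m f]] q f by (simp add: word_simps)
    have "(inv_arr C (\<chi> ?v ?m (Cod C f)) \<cdot> \<chi> ?g ?h (Cod C f)) \<cdot> FA (act ?g) (FA (act ?h) f) =
        FA (act ?v) (FA (act ?m) f) \<cdot> inv_arr C (\<chi> ?v ?m (Dom C f)) \<cdot> \<chi> ?g ?h (Dom C f)"
      using n1 reassoc[OF n2, of "\<chi> ?g ?h (Dom C f)"] q f by (simp add: word_simps)
    then show ?thesis
      using q f True by (simp add: xf X_def word_simps)
  next
    case False
    then have null: "K.null x" using x K.null_off_diagonal unfolding xf by blast
    have F_null: "K.null (FA (F q) z)" if "K.null z" "z \<in> Arr D" "q \<in> carrier Q" for z q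
      by (rule K.nullE[OF that(1,2)]) (use that(3) in \<open>simp add: K.null_def\<close>)
    have P: "snd (X q r) A \<in> Arr D \<and> Dom D (snd (X q r) A) = TensO D (FO (F q) (FO (F r) A)) (fst (X q r)) \<and>
        Cod D (snd (X q r) A) = TensO D (fst (X q r)) (FO (F (q \<bullet> r)) A)" if A: "A \<in> Obj D" for A
    proof -
      obtain a where a: "dwf a" "A = dev a" using A reify by metis
      then have "snd (X q r) A \<in> Iso D (dev (DTen (DF q (DF r a)) (DU q r))) (dev (DTen (DU q r) (DF (q \<bullet> r) a)))"
        using dcoh_Iso(1)[OF Q.one_closed dcoh_X] q by blast
      then show ?thesis by (simp only: D.Iso_iff a(2) dev_fold simp_thms)
    qed
    have U: "fst (X q r) \<in> Obj D" using dev_Obj[of "DU q r"] q by (simp only: dev_fold dwf.simps simp_thms)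
    note T = K.TensA_CP_Arr x F_Arr P U q
    have "K.null (TensA D (FA (F q) (FA (F r) x)) (Idn D (fst (X q r))))"
        "K.null (TensA D (Idn D (fst (X q r))) (FA (F (q \<bullet> r)) x))"
      using null by (simp_all add: K.null_TensA_left K.null_TensA_right F_null T del: K.CP_simps(1))
    then have "K.null ?L" "K.null ?R"
      by (simp_all add: K.null_Cmp_left K.null_Cmp_right T del: K.CP_simps(1))
    then show ?thesis by (rule K.null_eqI) (simp_all add: T del: K.CP_simps(1))
  qed
qed

lemma invertible_object_U:
  assumes "q \<in> carrier Q" "r \<in> carrier Q"
  shows "invertible_object D (fst (X q r))"
proof -
  let ?U = "(Unit C, inv\<^bsub>G\<^esub> u q r)"
  have U: "fst (X q r) \<in> Obj D" "?U \<in> Obj D" "TensO D (fst (X q r)) ?U = Unit D" "TensO D ?U (fst (X q r)) = Unit D"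
    using assms by (simp_all add: X_def word_simps)
  have "Idn D (Unit D) \<in> Iso D (Unit D) (Unit D)"
    by (simp only: D.Iso_iff D.Idn_simps[OF D.Unit_Obj] D.invertible_Idn[OF D.Unit_Obj] simp_thms)
  then show ?thesis
    unfolding invertible_object_def using U by (intro conjI bexI[of _ ?U]) auto
qed

lemma pseudonat_iso_X:
  assumes q: "q \<in> carrier Q" "r \<in> carrier Q"
  shows "pseudonat_iso D (comp_mon D (F q) (F r)) (F (q \<bullet> r)) (X q r)"
  unfolding pseudonat_iso_def case_prod_beta comp_mon_sel
proof (intro conjI ballI allI)
  show "invertible_object D (fst (X q r))" using q by (rule invertible_object_U)
next
  fix V assume "V \<in> Obj D"
  then obtain a where a: "dwf a" "V = dev a" using reify by metis
  then show "snd (X q r) V \<in> Iso D (TensO D (FO (F q) (FO (F r) V)) (fst (X q r)))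
      (TensO D (fst (X q r)) (FO (F (q \<bullet> r)) V))"
    using dcoh_Iso(1)[OF Q.one_closed dcoh_X] q by (simp only: dev_fold)
next
  fix V W f assume "f \<in> Hom D V W"
  then show "Cmp D (snd (X q r) W) (TensA D (FA (F q) (FA (F r) f)) (Idn D (fst (X q r)))) =
      Cmp D (TensA D (Idn D (fst (X q r))) (FA (F (q \<bullet> r)) f)) (snd (X q r) V)"
    using X_nat[OF q, of f] by (metis D.Hom_iff)
next
  fix V W assume "V \<in> Obj D" "W \<in> Obj D"
  then obtain a b where ab: "dwf a" "V = dev a" "dwf b" "W = dev b" using reify by metis
  let ?U = "fst (X q r)" let ?m = "q \<bullet> r"
  show "Cmp D (snd (X q r) (TensO D V W)) (TensA D (Cmp D (FA (F q) (Psi (F r) V W))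
        (Psi (F q) (FO (F r) V) (FO (F r) W))) (Idn D ?U)) =
      Cmp D (TensA D (Idn D ?U) (Psi (F ?m) V W))
        (Cmp D (inv_arr D (Assoc D ?U (FO (F ?m) V) (FO (F ?m) W)))
        (Cmp D (TensA D (snd (X q r) V) (Idn D (FO (F ?m) W)))
        (Cmp D (Assoc D (FO (F q) (FO (F r) V)) ?U (FO (F ?m) W))
        (Cmp D (TensA D (Idn D (FO (F q) (FO (F r) V))) (snd (X q r) W))
          (inv_arr D (Assoc D (FO (F q) (FO (F r) V)) (FO (F q) (FO (F r) W)) ?U))))))"
    by (rule dcoh_unique[of "\<one>\<^bsub>Q\<^esub>" "DTen (DTen (DF q (DF r a)) (DF q (DF r b))) (DU q r)"
          "DTen (DU q r) (DF ?m (DTen a b))"])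
      (rule dcoh_rules | (simp add: ab q dev_fold del: K.CP_simps F_simps; fail))+
next
  show "snd (X q r) (Unit D) = Idn D (fst (X q r))"
    using q by (simp add: X_def X_scalar_def)
qed

lemma dcoh_D:
  assumes "p \<in> carrier Q" "dcoh p a b f"
  shows "f \<in> Arr D" "Dom D f = dev a" "Cod D f = dev b" "D.invertible f"
  using dcoh_Iso(1)[OF assms] by (simp_all only: D.Iso_iff)

lemma \<pi>_one: "q \<in> carrier Q \<Longrightarrow> r \<in> carrier Q \<Longrightarrow> t \<in> carrier Q \<Longrightarrow> \<pi> [q, r, t, \<one>\<^bsub>Q\<^esub>] = 1"
  using \<pi>_cocycle by (auto simp: cocycles_def cochains_def tuples_def)

lemma \<Omega>_Arr: "q \<in> carrier Q \<Longrightarrow> r \<in> carrier Q \<Longrightarrow> t \<in> carrier Q \<Longrightarrow> \<Omega> q r t \<in> Arr D"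
  by (simp add: \<Omega>_def word_simps)

lemma dcoh_\<Omega>_no_anomaly:
  assumes "q \<in> carrier Q" "r \<in> carrier Q" "t \<in> carrier Q"
  shows "dcoh (q \<bullet> (r \<bullet> t)) (DTen (DF q (DU r t)) (DU q (r \<bullet> t))) (DTen (DU q r) (DU (q \<bullet> r) t)) (\<Omega> q r t)"
proof -
  have "Scale D 1 (\<Omega> q r t) = \<Omega> q r t" using assms \<Omega>_Arr by (intro D.Scale_one_arr)
  then show ?thesis
    using dcoh_\<Omega>[OF assms Q.one_closed] \<pi>_one[OF assms] assms by (simp del: K.CP_simps)
qed

text \<open>Identities between formal objects that differ by tensor units.\<close>

lemma dcoh_Idn_trans:
  assumes "dcoh p a b (Idn D (dev b))" "dcoh p b c (Idn D (dev c))" "p \<in> carrier Q"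
  shows "dcoh p a c (Idn D (dev c))"
proof -
  have c: "dev c \<in> Obj D" using assms(2) by (elim dcohE) (rule dev_Obj)
  have b: "dev b \<in> Obj D" using assms(1) by (elim dcohE) (rule dev_Obj)
  have "dev b = dev c" using dcoh_D(2)[OF assms(3,2)] D.Idn_simps(2)[OF c] by (simp only:)
  then show ?thesis
    using dcoh_Cmp[OF assms(1,2)] D.Cmp_Idn(1)[OF D.Idn_simps(1)[OF c] D.Idn_simps(2)[OF c]] by (simp only:)
qed

lemma dcoh_Idn_Ten:
  assumes "dcoh p a b (Idn D (dev b))" "dcoh p a' b' (Idn D (dev b'))"
  shows "dcoh p (DTen a a') (DTen b b') (Idn D (dev (DTen b b')))"
proof -
  have "dev b \<in> Obj D" "dev b' \<in> Obj D"
    using assms by (blast elim: dcohE intro: dev_Obj)+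
  then show ?thesis using dcoh_TensA[OF assms] by (simp only: D.TensA_Idn dev_fold)
qed

lemma dcoh_Idn_F:
  assumes "dcoh (inv\<^bsub>Q\<^esub> q \<bullet> p) a b (Idn D (dev b))" "q \<in> carrier Q" "p \<in> carrier Q"
  shows "dcoh p (DF q a) (DF q b) (Idn D (dev (DF q b)))"
proof -
  have "dwf b" using assms(1) by (blast elim: dcohE)
  then have "FA (F q) (Idn D (dev b)) = Idn D (dev (DF q b))"
    using assms(2) by (simp add: dev_def)
  then show ?thesis using dcoh_FA[OF assms] by (simp only:)
qed

text \<open>
  Formal objects that differ by tensor units only may be exchanged.
\<close>

lemma dcoh_change:
  assumes "dcoh p a' a (Idn D (dev a))" "dcoh p a b f" "dcoh p b' b (Idn D (dev b))" "p \<in> carrier Q"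
  shows "dcoh p a' b' f"
proof -
  have ab: "dev a \<in> Obj D" "dev b \<in> Obj D" using assms by (blast elim: dcohE intro: dev_Obj)+
  note f = dcoh_D[OF assms(4,2)]
  have "dcoh p b b' (Idn D (dev b))"
    using dcoh_Iso(2)[OF assms(4,3)] by (simp only: D.inv_arr_Idn[OF ab(2)])
  then show ?thesis
    using dcoh_Cmp[OF dcoh_Cmp[OF assms(1,2)], of b' "Idn D (dev b)"]
    by (simp only: D.Cmp_Idn(1)[OF f(1,2)] D.Cmp_Idn(2)[OF f(1,3)])
qed

lemma dcoh_Ten_One: "dwf a \<Longrightarrow> dcoh p (DTen a DOne) a (Idn D (dev a))"
proof -
  assume a: "dwf a"
  have "coherent (tm (DTen a DOne)) (tm a) (\<iota> (ev (tm a)))"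
    using coherent_Cmp[OF coherent_Ten[OF coherent_Idn coherent_Act_One] coherent_Ten_One] a by simp
  then show ?thesis
    using dcoh_identity[of "DTen a DOne" a p] a by (simp add: dev_def)
qed

lemma dcoh_One_Ten: "dwf a \<Longrightarrow> dcoh p (DTen DOne a) a (Idn D (dev a))"
proof -
  assume a: "dwf a"
  have "coherent (tm (DTen DOne a)) (tm a) (\<iota> (ev (tm a)))"
    using coherent_Cmp[OF coherent_Ten[OF coherent_Idn[of One] coherent_Act_e] coherent_One_Ten] a by simp
  then show ?thesis
    using dcoh_identity[of "DTen DOne a" a p] a by (simp add: dev_def)
qed

lemma dcoh_F_One: "q \<in> carrier Q \<Longrightarrow> dcoh p (DF q DOne) DOne (Idn D (dev DOne))"
  using dcoh_identity[of "DF q DOne" DOne p] coherent_Act_One[of "s q"]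
  by (simp add: dev_def swap_scalar_def)

lemma dcoh_swap_One:
  assumes "dwf a" "V = dev a" "p \<in> carrier Q"
  shows "dcoh p (DTen a DOne) (DTen DOne a) (Idn D V)"
proof -
  have V: "V \<in> Obj D" unfolding assms(2) using assms(1) by (rule dev_Obj)
  note 1 = dcoh_Cmp[OF dcoh_Ten_One dcoh_Iso(2)[OF _ dcoh_One_Ten], OF assms(1,3,1)]
  show ?thesis using 1 unfolding assms(2)[symmetric] D.inv_arr_Idn[OF V]
    by (simp only: D.Cmp_Idn(1)[OF D.Idn_simps(1)[OF V] D.Idn_simps(2)[OF V]])
qed

text \<open>
  The structure map of a composite of pseudonatural isomorphisms is coherent if those of the factors
  are.
\<close>

lemma dcoh_ps_comp:
  assumes Y: "dcoh p (DTen x a) (DTen a x') (snd Y V)" and Y': "dcoh p (DTen x' b) (DTen b x'') (snd Y' V)"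
    and ob: "fst Y = dev a" "fst Y' = dev b" "FO F1 V = dev x" "FO F2 V = dev x'" "FO F3 V = dev x''"
    and p: "p \<in> carrier Q" and wf_trm: "dwf a" "dwf b" "dwf x" "dwf x'" "dwf x''"
  shows "dcoh p (DTen x (DTen a b)) (DTen (DTen a b) x'') (snd (ps_comp D F1 F2 F3 Y' Y) V)"
  unfolding ps_comp_def case_prod_beta snd_conv ob
  by (rule dcoh_rules Y Y' | (simp add: p wf_trm del: K.CP_simps; fail))+

lemma fst_ps_comp:
  "fst Y = dev a \<Longrightarrow> fst Y' = dev b \<Longrightarrow> fst (ps_comp D F1 F2 F3 Y' Y) = dev (DTen a b)"
  by (simp only: ps_comp_def case_prod_beta fst_conv dev_fold)

lemma dcoh_ps_tensor:
  assumes 1: "dcoh p (DTen x a) (DTen a x') (Cmp D (inv_arr D (Psi H1 (fst Y) (FO H2' V)))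
        (Cmp D (FA H1 (snd Y V)) (Psi H1 (FO H2 V) (fst Y))))"
    and 2: "dcoh p (DTen x' b) (DTen b x'') (snd Y' (FO H2' V))"
    and ob: "FO H1 (fst Y) = dev a" "fst Y' = dev b" "FO H1 (FO H2 V) = dev x" "FO H1 (FO H2' V) = dev x'"
      "FO H1' (FO H2' V) = dev x''"
    and p: "p \<in> carrier Q" and wf_trm: "dwf a" "dwf b" "dwf x" "dwf x'" "dwf x''"
  shows "dcoh p (DTen x (DTen a b)) (DTen (DTen a b) x'') (snd (ps_tensor D H1 H1' H2 H2' Y' Y) V)"
  unfolding ps_tensor_def case_prod_beta
  by (rule dcoh_ps_comp[OF _ _ _ _ _ _ _ p wf_trm]; simp only: fst_conv snd_conv comp_mon_sel 1 2 ob)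

lemma fst_ps_tensor:
  "FO H1 (fst Y) = dev a \<Longrightarrow> fst Y' = dev b \<Longrightarrow> fst (ps_tensor D H1 H1' H2 H2' Y' Y) = dev (DTen a b)"
  by (simp only: ps_tensor_def case_prod_beta fst_ps_comp fst_conv)

text \<open>
  Both sides of the modification axiom are coherent at \<open>q r t\<close>, where \<open>\<Omega> q r t\<close> carries no anomaly.
\<close>

lemma modification_iso_\<Omega>:
  assumes q: "q \<in> carrier Q" "r \<in> carrier Q" "t \<in> carrier Q"
  shows "modification_iso D (comp_mon D (F q) (comp_mon D (F r) (F t))) (F (q \<bullet> r \<bullet> t))
    (ps_comp D (comp_mon D (F q) (comp_mon D (F r) (F t))) (comp_mon D (F q) (F (r \<bullet> t))) (F (q \<bullet> r \<bullet> t))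
      (X q (r \<bullet> t))
      (ps_tensor D (F q) (F q) (comp_mon D (F r) (F t)) (F (r \<bullet> t)) (ps_id D (F q)) (X r t)))
    (ps_comp D (comp_mon D (F q) (comp_mon D (F r) (F t))) (comp_mon D (F (q \<bullet> r)) (F t)) (F (q \<bullet> r \<bullet> t))
      (X (q \<bullet> r) t)
      (ps_tensor D (comp_mon D (F q) (F r)) (F (q \<bullet> r)) (F t) (F t) (X q r) (ps_id D (F t))))
    (\<Omega> q r t)"
    (is "modification_iso D _ _ ?S ?T _")
proof -
  let ?p = "q \<bullet> (r \<bullet> t)"
  have p: "?p \<in> carrier Q" and assoc: "q \<bullet> r \<bullet> t = ?p" using q by (simp_all add: Q.m_assoc)
  \<comment> \<open>Whiskering is a tensor product with an identity, whose object \<open>I\<close> appears as \<open>DOne\<close>.\<close>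
  let ?s = "DTen (DTen (DF q (DU r t)) DOne) (DU q (r \<bullet> t))"
  let ?t = "DTen (DTen (DF q (DF r DOne)) (DU q r)) (DU (q \<bullet> r) t)"
  have S: "dcoh ?p (DTen (DF q (DF r (DF t v))) ?s) (DTen ?s (DF ?p v)) (snd ?S (dev v))"
      "fst ?S = dev ?s" if v: "dwf v" for v
  proof -
    note simps = p q v dev_fold
    have 1: "dcoh ?p (DTen (DF q (DF r (DF t v))) (DF q (DU r t))) (DTen (DF q (DU r t)) (DF q (DF (r \<bullet> t) v)))
       (Cmp D (inv_arr D (Psi (F q) (fst (X r t)) (FO (F (r \<bullet> t)) (dev v))))
         (Cmp D (FA (F q) (snd (X r t) (dev v))) (Psi (F q) (FO (comp_mon D (F r) (F t)) (dev v)) (fst (X r t)))))"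
      unfolding comp_mon_sel
      by (rule dcoh_rules | (simp add: simps del: K.CP_simps F_simps; fail))+
    have 2: "dcoh ?p (DTen (DF q (DF (r \<bullet> t) v)) DOne) (DTen DOne (DF q (DF (r \<bullet> t) v)))
       (snd (ps_id D (F q)) (FO (F (r \<bullet> t)) (dev v)))"
      unfolding ps_id_def snd_conv using p q v by (intro dcoh_swap_One) (simp_all add: dev_fold del: F_simps)
    have 3: "dcoh ?p (DTen (DF q (DF (r \<bullet> t) v)) (DU q (r \<bullet> t))) (DTen (DU q (r \<bullet> t)) (DF ?p v)) (snd (X q (r \<bullet> t)) (dev v))"
      using q v dcoh_X by simp
    have ob: "FO (F q) (fst (X r t)) = dev (DF q (DU r t))"
        "FO (F q) (FO (comp_mon D (F r) (F t)) (dev v)) = dev (DF q (DF r (DF t v)))"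
        "FO (F q) (FO (F (r \<bullet> t)) (dev v)) = dev (DF q (DF (r \<bullet> t) v))"
        "fst (ps_id D (F q)) = dev DOne"
        "FO (comp_mon D (F q) (comp_mon D (F r) (F t))) (dev v) = dev (DF q (DF r (DF t v)))"
        "FO (comp_mon D (F q) (F (r \<bullet> t))) (dev v) = dev (DF q (DF (r \<bullet> t) v))"
      by (simp_all only: comp_mon_sel dev_fold ps_id_def fst_conv)
    note 5 = dcoh_ps_tensor[OF 1 2 ob(1,4,2,3,3) p] fst_ps_tensor[of "F q" "X r t", OF ob(1,4)]
    show "dcoh ?p (DTen (DF q (DF r (DF t v))) ?s) (DTen ?s (DF ?p v)) (snd ?S (dev v))"
      using q v
      by (intro dcoh_ps_comp[OF 5(1) 3 5(2) _ ob(5,6) _ p]; simp only: dev_fold assoc dwf.simps Q.m_closed simp_thms)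
    show "fst ?S = dev ?s" by (intro fst_ps_comp 5(2) dev_fold(4))
  qed
  have T: "dcoh ?p (DTen (DF q (DF r (DF t v))) ?t) (DTen ?t (DF ?p v)) (snd ?T (dev v))"
      "fst ?T = dev ?t" if v: "dwf v" for v
  proof -
    note simps = p q v dev_fold
    have c: "dcoh (inv\<^bsub>Q\<^esub> r \<bullet> (inv\<^bsub>Q\<^esub> q \<bullet> ?p)) (DTen (DF t v) DOne) (DTen DOne (DF t v)) (Idn D (FO (F t) (dev v)))"
      using p q v by (intro dcoh_swap_One) (simp_all add: dev_fold del: F_simps)
    have P: "dcoh ?p (DTen (DF q (DF r DOne)) (DF q (DF r (DF t v)))) (DF q (DF r (DTen DOne (DF t v))))
        (Psi (comp_mon D (F q) (F r)) (Unit D) (FO (F t) (dev v)))"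
      unfolding comp_mon_sel
      by (rule dcoh_rules | (simp add: simps del: K.CP_simps F_simps; fail))+
    have 1: "dcoh ?p (DTen (DF q (DF r (DF t v))) (DF q (DF r DOne))) (DTen (DF q (DF r DOne)) (DF q (DF r (DF t v))))
       (Cmp D (inv_arr D (Psi (comp_mon D (F q) (F r)) (fst (ps_id D (F t))) (FO (F t) (dev v))))
         (Cmp D (FA (comp_mon D (F q) (F r)) (snd (ps_id D (F t)) (dev v)))
           (Psi (comp_mon D (F q) (F r)) (FO (F t) (dev v)) (fst (ps_id D (F t))))))"
      unfolding ps_id_def fst_conv snd_conv
      apply (rule dcoh_Cmp[OF _ dcoh_Iso(2)[OF p P]])
      unfolding comp_mon_sel
      by (rule c dcoh_rules | (simp add: simps del: K.CP_simps F_simps; fail))+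
    have 2: "dcoh ?p (DTen (DF q (DF r (DF t v))) (DU q r)) (DTen (DU q r) (DF (q \<bullet> r) (DF t v)))
       (snd (X q r) (FO (F t) (dev v)))"
      by (rule dcoh_rules | (simp add: simps del: K.CP_simps F_simps; fail))+
    have 3: "dcoh ?p (DTen (DF (q \<bullet> r) (DF t v)) (DU (q \<bullet> r) t)) (DTen (DU (q \<bullet> r) t) (DF ?p v)) (snd (X (q \<bullet> r) t) (dev v))"
      using q v dcoh_X[of v "q \<bullet> r" t ?p] by (simp add: Q.m_assoc)
    have ob: "FO (comp_mon D (F q) (F r)) (fst (ps_id D (F t))) = dev (DF q (DF r DOne))"
        "FO (comp_mon D (F q) (F r)) (FO (F t) (dev v)) = dev (DF q (DF r (DF t v)))"
        "FO (F (q \<bullet> r)) (FO (F t) (dev v)) = dev (DF (q \<bullet> r) (DF t v))"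
        "FO (comp_mon D (F q) (comp_mon D (F r) (F t))) (dev v) = dev (DF q (DF r (DF t v)))"
        "FO (comp_mon D (F (q \<bullet> r)) (F t)) (dev v) = dev (DF (q \<bullet> r) (DF t v))"
      by (simp_all only: comp_mon_sel dev_fold ps_id_def fst_conv)
    note 5 = dcoh_ps_tensor[OF 1 2 ob(1) dev_fold(4) ob(2,2,3) p]
      fst_ps_tensor[of "comp_mon D (F q) (F r)" "ps_id D (F t)", OF ob(1) dev_fold(4)]
    show "dcoh ?p (DTen (DF q (DF r (DF t v))) ?t) (DTen ?t (DF ?p v)) (snd ?T (dev v))"
      using q v
      by (intro dcoh_ps_comp[OF 5(1) 3 5(2) _ ob(4,5) _ p]; simp only: dev_fold assoc dwf.simps Q.m_closed simp_thms)
    show "fst ?T = dev ?t" by (intro fst_ps_comp 5(2) dev_fold(4))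
  qed
  have "dcoh ?p ?s (DTen (DF q (DU r t)) (DU q (r \<bullet> t))) (Idn D (dev (DTen (DF q (DU r t)) (DU q (r \<bullet> t)))))"
    using q by (intro dcoh_Idn_Ten dcoh_Ten_One dcoh_Idn) simp_all
  moreover
  have "dcoh ?p (DF q (DF r DOne)) DOne (Idn D (dev DOne))"
    using q by (intro dcoh_Idn_trans[OF dcoh_Idn_F[OF dcoh_F_One] dcoh_F_One]) simp_all
  then have "dcoh ?p (DTen (DF q (DF r DOne)) (DU q r)) (DU q r) (Idn D (dev (DU q r)))"
    using q by (intro dcoh_Idn_trans[OF dcoh_Idn_Ten[OF _ dcoh_Idn] dcoh_One_Ten]) simp_all
  then have "dcoh ?p ?t (DTen (DU q r) (DU (q \<bullet> r) t)) (Idn D (dev (DTen (DU q r) (DU (q \<bullet> r) t))))"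
    using q by (intro dcoh_Idn_Ten dcoh_Idn) simp_all
  ultimately have \<Omega>: "dcoh ?p ?s ?t (\<Omega> q r t)"
    using dcoh_change[OF _ dcoh_\<Omega>_no_anomaly[OF q] _ p] by blast
  have ob: "fst ?S = dev ?s" "fst ?T = dev ?t" using S(2)[of DOne] T(2)[of DOne] by simp_all
  show ?thesis
    unfolding modification_iso_def ob
  proof (intro conjI ballI)
    show "\<Omega> q r t \<in> Iso D (dev ?s) (dev ?t)" using dcoh_Iso(1)[OF p \<Omega>] .
    fix V assume "V \<in> Obj D"
    then obtain v where v: "dwf v" "V = dev v" using reify by metis
    show "Cmp D (TensA D (\<Omega> q r t) (Idn D (FO (F (q \<bullet> r \<bullet> t)) V))) (snd ?S V) =
        Cmp D (snd ?T V) (TensA D (Idn D (FO (comp_mon D (F q) (comp_mon D (F r) (F t))) V)) (\<Omega> q r t))"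
      unfolding comp_mon_sel v(2) assoc
      by (rule dcoh_unique[OF p, of "DTen (DF q (DF r (DF t v))) ?s" "DTen ?t (DF ?p v)"])
        (rule S(1)[OF v(1), unfolded assoc comp_mon_sel] T(1)[OF v(1), unfolded assoc comp_mon_sel] \<Omega> dcoh_rules |
         (simp add: p q v(1) dev_fold del: K.CP_simps F_simps; fail))+
  qed
qed

lemma F_one: "eq_mon D (F \<one>\<^bsub>Q\<^esub>) (id_mon D)"
  by (auto simp: eq_mon_def id_mon_def Psi_scalar_def)

lemma X_one:
  assumes "q \<in> carrier Q" "r \<in> carrier Q" "q = \<one>\<^bsub>Q\<^esub> \<or> r = \<one>\<^bsub>Q\<^esub>"
  shows "fst (X q r) = Unit D \<and> (\<forall>V \<in> Obj D. snd (X q r) V = Idn D (FO (F (q \<bullet> r)) V))"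
  using assms by (auto simp: X_def X_scalar_def)

lemma \<Omega>_one:
  assumes "q \<in> carrier Q" "r \<in> carrier Q" "t \<in> carrier Q" "q = \<one>\<^bsub>Q\<^esub> \<or> r = \<one>\<^bsub>Q\<^esub> \<or> t = \<one>\<^bsub>Q\<^esub>"
  shows "\<Omega> q r t = Idn D (TensO D (fst (X q r)) (fst (X (q \<bullet> r) t)))"
proof -
  have "Omega_scalar q r t = 1"
    using assms by (auto simp: Omega_scalar_def)
  then show ?thesis using assms by (simp add: \<Omega>_def X_def)
qed

lemma mod_tensor_One:
  assumes "q \<in> carrier Q" "f \<in> Arr D"
  shows "mod_tensor D (F q) (Idn D (Unit D)) f = FA (F q) f"
  unfolding mod_tensor_def using F_Arr(1)[OF assms] by (rule D.Unit_arr_right)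

lemma mod_tensor_One':
  assumes "q \<in> carrier Q" "r \<in> carrier Q" "t \<in> carrier Q" "f \<in> Arr D"
  shows "mod_tensor D (comp_mon D (F q) (comp_mon D (F r) (F t))) f (Idn D (Unit D)) = f"
proof -
  have "FA (F q) (FA (F r) (FA (F t) (Idn D (Unit D)))) = Idn D (Unit D)"
    using assms(1-3) by simp
  then show ?thesis
    unfolding mod_tensor_def comp_mon_sel using D.Unit_arr_left[OF assms(4)] by (simp only:)
qed

text \<open>
  Both pasted modifications are compared at \<open>q r t v\<close>.  There \<open>\<Omega> q (r t) v\<close>, \<open>\<Omega> q r (t v)\<close> and
  \<open>\<Omega> (q r) t v\<close> are coherent, and \<open>\<Omega> r t v\<close>, which occurs inside \<open>F q\<close>, only has to be coherent at
  \<open>r t v\<close>.  But \<open>\<Omega> q r t\<close> has to be divided by \<open>\<pi>(q, r, t, v)\<close> in order to be coherent at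
  \<open>q r t v\<close>, and this produces the scalar.
\<close>

lemma pasting:
  assumes q: "q \<in> carrier Q" "r \<in> carrier Q" "t \<in> carrier Q" "v \<in> carrier Q"
  shows "pasting3 Q D F X \<Omega> q r t v = Scale D (\<pi> [q, r, t, v]) (pasting2 Q D F X \<Omega> q r t v)"
proof -
  let ?p = "q \<bullet> (r \<bullet> (t \<bullet> v))"
  let ?c = "\<pi> [q, r, t, v]"
  let ?\<Omega> = "Scale D (inverse ?c) (\<Omega> q r t)"
  let ?U = "\<lambda>q r. fst (X q r)"
  have p: "?p \<in> carrier Q" using q by simp
  have \<Omega>1: "dcoh ?p (DTen (DF q (DU r t)) (DU q (r \<bullet> t))) (DTen (DU q r) (DU (q \<bullet> r) t)) ?\<Omega>"
    using dcoh_\<Omega>[OF q] .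
  have \<Omega>2: "dcoh ?p (DTen (DF q (DU (r \<bullet> t) v)) (DU q (r \<bullet> t \<bullet> v)))
      (DTen (DU q (r \<bullet> t)) (DU (q \<bullet> r \<bullet> t) v)) (\<Omega> q (r \<bullet> t) v)"
    using dcoh_\<Omega>_no_anomaly[of q "r \<bullet> t" v] q by (simp add: Q.m_assoc)
  have \<Omega>3: "dcoh (inv\<^bsub>Q\<^esub> q \<bullet> ?p) (DTen (DF r (DU t v)) (DU r (t \<bullet> v))) (DTen (DU r t) (DU (r \<bullet> t) v)) (\<Omega> r t v)"
    using dcoh_\<Omega>_no_anomaly[of r t v] q by simp
  have \<Omega>4: "dcoh ?p (DTen (DF q (DU r (t \<bullet> v))) (DU q (r \<bullet> t \<bullet> v)))
      (DTen (DU q r) (DU (q \<bullet> r) (t \<bullet> v))) (\<Omega> q r (t \<bullet> v))"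
    using dcoh_\<Omega>_no_anomaly[of q r "t \<bullet> v"] q by (simp add: Q.m_assoc)
  have \<Omega>5: "dcoh ?p (DTen (DF (q \<bullet> r) (DU t v)) (DU (q \<bullet> r) (t \<bullet> v)))
      (DTen (DU (q \<bullet> r) t) (DU (q \<bullet> r \<bullet> t) v)) (\<Omega> (q \<bullet> r) t v)"
    using dcoh_\<Omega>_no_anomaly[of "q \<bullet> r" t v] q by (simp add: Q.m_assoc)
  note simps = p q dev_fold
  let ?s = "DTen (DF q (DF r (DU t v))) (DTen (DF q (DU r (t \<bullet> v))) (DU q (r \<bullet> t \<bullet> v)))"
  let ?t = "DTen (DTen (DU q r) (DU (q \<bullet> r) t)) (DU (q \<bullet> r \<bullet> t) v)"
  let ?m = "DTen (DTen (DF q (DU r t)) (DU q (r \<bullet> t))) (DU (q \<bullet> r \<bullet> t) v)"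
  let ?rest = "Cmp D (Assoc D (FO (F q) (?U r t)) (?U q (r \<bullet> t)) (?U (q \<bullet> r \<bullet> t) v))
         (Cmp D (TensA D (Idn D (FO (F q) (?U r t))) (\<Omega> q (r \<bullet> t) v))
         (Cmp D (inv_arr D (Assoc D (FO (F q) (?U r t)) (FO (F q) (?U (r \<bullet> t) v)) (?U q (r \<bullet> t \<bullet> v))))
         (Cmp D (TensA D (Cmp D (inv_arr D (Psi (F q) (?U r t) (?U (r \<bullet> t) v)))
             (Cmp D (FA (F q) (\<Omega> r t v)) (Psi (F q) (FO (F r) (?U t v)) (?U r (t \<bullet> v)))))
           (Idn D (?U q (r \<bullet> t \<bullet> v))))
         (Assoc D (FO (F q) (FO (F r) (?U t v))) (FO (F q) (?U r (t \<bullet> v))) (?U q (r \<bullet> t \<bullet> v))))))"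
  have p3: "pasting3 Q D F X \<Omega> q r t v = Cmp D (TensA D (\<Omega> q r t) (Idn D (?U (q \<bullet> r \<bullet> t) v))) ?rest"
    unfolding pasting3_def Let_def mod_tensor_One[OF q(1) \<Omega>_Arr[OF q(2-4)]]
      mod_tensor_One'[OF q(1-3) \<Omega>_Arr[OF q(1-3)]] ..
  have rest: "dcoh ?p ?s ?m ?rest"
    by (rule \<Omega>2 \<Omega>3 dcoh_rules | (simp add: simps del: K.CP_simps F_simps; fail))+
  have id: "dcoh ?p (DU (q \<bullet> r \<bullet> t) v) (DU (q \<bullet> r \<bullet> t) v) (Idn D (?U (q \<bullet> r \<bullet> t) v))"
    by (rule dcoh_generators(1)) (simp_all add: simps del: K.CP_simps)
  have last: "dcoh ?p ?m ?t (TensA D ?\<Omega> (Idn D (?U (q \<bullet> r \<bullet> t) v)))"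
    by (rule dcoh_TensA[OF \<Omega>1 id])
  have p2: "dcoh ?p ?s ?t (pasting2 Q D F X \<Omega> q r t v)"
    unfolding pasting2_def Let_def
    by (rule \<Omega>4 \<Omega>5 dcoh_rules | (simp add: simps del: K.CP_simps F_simps; fail))+
  have eq: "Cmp D (TensA D ?\<Omega> (Idn D (?U (q \<bullet> r \<bullet> t) v))) ?rest = pasting2 Q D F X \<Omega> q r t v"
    using dcoh_unique[OF p dcoh_Cmp[OF rest last] p2] .
  have "\<Omega> q r t = Scale D ?c ?\<Omega>"
    using D.Scale_Scale_arr[OF \<Omega>_Arr[OF q(1-3)]] D.Scale_one_arr[OF \<Omega>_Arr[OF q(1-3)]] q
    by (simp del: K.CP_simps)
  then have "pasting3 Q D F X \<Omega> q r t v =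
      Cmp D (TensA D (Scale D ?c ?\<Omega>) (Idn D (?U (q \<bullet> r \<bullet> t) v))) ?rest"
    unfolding p3 by (simp only:)
  also have "\<dots> = Scale D ?c (Cmp D (TensA D ?\<Omega> (Idn D (?U (q \<bullet> r \<bullet> t) v))) ?rest)"
    using dcoh_D[OF p \<Omega>1] dcoh_D[OF p id] dcoh_D[OF p rest] dcoh_D[OF p last]
    by (simp only: D.TensA_Scale D.Cmp_Scale)
  finally show ?thesis unfolding eq .
qed

theorem anomalous_action_F: "anomalous_action Q \<pi> D F X \<Omega>"
  by (rule anomalous_action.intro)
    (fact Q_group \<pi>_cocycle K.tensor_category_CP | rule mon_autoequiv_F pseudonat_iso_X modification_iso_\<Omega>
      F_one X_one \<Omega>_one pasting; assumption)+

end

theorem theorem1p1: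
  fixes Q :: "('q, 'y) monoid_scheme"
    and G :: "('g, 'x) monoid_scheme"
    and \<pi> :: "'q list \<Rightarrow> 'k::field"
    and \<pi>_class :: "('q list \<Rightarrow> 'k) set"
    and \<rho> :: "'g \<Rightarrow> 'q"
    and \<omega> :: "'g list \<Rightarrow> 'k"
    and C :: "('o, 'm, 'k, 'z) tensor_cat_scheme"
    and act :: "'g \<Rightarrow> ('o, 'm) mon_endofun"
    and \<chi> :: "'g \<Rightarrow> 'g \<Rightarrow> 'o \<Rightarrow> 'm"
  assumes "group Q"
    and "\<pi>_class \<in> carrier (cohomology Q 4)" and "\<pi> \<in> cocycles Q 4" and "\<pi> \<in> \<pi>_class"
    and "group G" and "\<rho> \<in> hom G Q" and "\<rho> ` carrier G = carrier Q"
    and K: "K = G\<lparr>carrier := kernel G Q \<rho>\<rparr>"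
    and "\<omega> \<in> cochains G 3" and "differential G 3 \<omega> = pullback G \<rho> 4 \<pi>"
    and "tensor_category C" and "categorical_action G C act \<chi>"
  shows "\<exists>F X \<Omega>. anomalous_action Q \<pi>
           (crossed_product C K act \<chi> (restrict \<omega> (tuples K 3))) F X \<Omega>"
proof -
  \<comment> \<open>A section of \<open>\<rho>\<close>, normalized so that the action is strictly unital.\<close>
  define s where "s = (\<lambda>q. if q = \<one>\<^bsub>Q\<^esub> then \<one>\<^bsub>G\<^esub> else SOME g. g \<in> carrier G \<and> \<rho> g = q)"
  have s: "s q \<in> carrier G \<and> \<rho> (s q) = q" if "q \<in> carrier Q" for q
  proof (cases "q = \<one>\<^bsub>Q\<^esub>")
    case True
    then show ?thesis
      using hom_one[OF assms(6,5,1)] group.is_monoid[OF assms(5)] by (simp add: s_def monoid.one_closed)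
  next
    case False
    have "q \<in> \<rho> ` carrier G" unfolding assms(7) by (rule that)
    then obtain g where "q = \<rho> g" "g \<in> carrier G" by (rule imageE)
    then have "g \<in> carrier G \<and> \<rho> g = q" by (intro conjI) (simp_all only:)
    then have "(SOME g. g \<in> carrier G \<and> \<rho> g = q) \<in> carrier G \<and> \<rho> (SOME g. g \<in> carrier G \<and> \<rho> g = q) = q"
      by (rule someI)
    then show ?thesis using False unfolding s_def by (simp only: if_False)
  qed
  interpret action_of_extension G C act \<chi> Q \<rho> \<pi> \<omega> s
  proof (intro action_of_extension.intro tensor_category_action.intro action_of_extension_axioms.intro)
    show "s \<one>\<^bsub>Q\<^esub> = \<one>\<^bsub>G\<^esub>" by (simp add: s_def)
  qed (use assms s in blast)+
  show ?thesis
    using anomalous_action_F unfolding K K.CP_def by blast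
qed
end
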